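(* Let $d \ge 2$ and $k \ge 1$ be fixed integers, let $f$ be a bounded Lebesgue-measurable probability density function on $\mathbb{R}^d$, and let $r = r_n$ be a sequence of positive reals with $r = o(n^{-1/d})$. (1) If $r = o\left(n^{-\frac{2k+2}{d(2k+1)}}\right)$, then a.a.s. $H_k(R(X_n;r)) = 0$. (2) If $r = \omega\left(n^{-\frac{2k+2}{d(2k+1)}}\right)$, then a.a.s. $H_k(R(X_n;r)) \neq 0$.
   Context: Let $x_1, x_2, \ldots$ be i.i.d. random points in $\mathbb{R}^d$ with common density $f$, and let $X_n = \{x_1, \ldots, x_n\}$. For $r>0$, the random Vietoris-Rips complex $R(X_n;r)$ is the simplicial complex with vertex set $X_n$ in which a set $\sigma \subseteq X_n$ is a face iff all pairwise Euclidean distances between points of $\sigma$ are at most $r$. Homology $H_k$ is simplicial homology with coefficients in an arbitrary fixed field. A property holds asymptotically almost surely (a.a.s.) if its probability tends to $1$ as $n \to \infty$. For non-negative sequences, $g = o(h)$ means that for every $\epsilon>0$, $g(n) \le \epsilon h(n)$ for all large $n$; $g = \omega(h)$ means that for every $K>0$, $g(n) \ge K h(n)$ for all large $n$. *)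

theory Defs
  imports
    "HOL-Probability.Probability"
    "HOL-Algebra.Coset"
    "HOL-Algebra.Elementary_Groups"
    "HOL-Library.Landau_Symbols"
begin

section \<open>Simplicial homology over a field\<close>

text \<open>
  An abstract simplicial complex is given by its set of faces; whether the empty set is counted as
  a face is irrelevant below.

  A \<open>k\<close>-chain is an alternating function on the orderings of the \<open>k\<close>-faces:
  the coefficient of an oriented simplex changes sign when two vertices are interchanged.
  This is the usual group of oriented chains, in the form that needs no ordering of the vertices;
  the oriented simplex \<open>[w\<^sub>0, \<dots>, w\<^sub>k]\<close> is the chain that takes the value 1 at that list, the sign of
  the permutation at each of its rearrangements, and 0 elsewhere.
\<close>

definition ordered_simplices :: "nat \<Rightarrow> 'v set set \<Rightarrow> 'v list set" where
  "ordered_simplices k K = {vs. length vs = Suc k \<and> distinct vs \<and> set vs \<in> K}"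

definition simplicial_chains :: "nat \<Rightarrow> 'v set set \<Rightarrow> ('v list \<Rightarrow> 'f::field) set" where
  "simplicial_chains k K = {c. (\<forall>vs. c vs \<noteq> 0 \<longrightarrow> vs \<in> ordered_simplices k K) \<and>
                    finite {vs. c vs \<noteq> 0} \<and>
                    (\<forall>xs u ys v zs. c (xs @ u # ys @ v # zs) = - c (xs @ v # ys @ u # zs))}"

text \<open>
  The coefficient of \<open>[v\<^sub>1, \<dots>, v\<^sub>k]\<close> in the boundary of \<open>c\<close> is the sum over all vertices \<open>v\<close> of the
  coefficient of \<open>[v, v\<^sub>1, \<dots>, v\<^sub>k]\<close> in \<open>c\<close>. On an oriented simplex this is the usual alternating sum
  of its facets, see \<open>boundary_oriented_simplex\<close>. The boundary of a \<open>0\<close>-chain is 0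
  (homology is not reduced).
\<close>

definition boundary :: "('v list \<Rightarrow> 'f::field) \<Rightarrow> 'v list \<Rightarrow> 'f" where
  "boundary c vs = (if vs = [] then 0 else \<Sum>v | c (v # vs) \<noteq> 0. c (v # vs))"

definition cycles :: "nat \<Rightarrow> 'v set set \<Rightarrow> ('v list \<Rightarrow> 'f::field) set" where
  "cycles k K = {c \<in> simplicial_chains k K. boundary c = (\<lambda>_. 0)}"

definition boundaries :: "nat \<Rightarrow> 'v set set \<Rightarrow> ('v list \<Rightarrow> 'f::field) set" where
  "boundaries k K = boundary ` simplicial_chains (Suc k) K"

definition cycle_group :: "'f::field itself \<Rightarrow> nat \<Rightarrow> 'v set set \<Rightarrow> ('v list \<Rightarrow> 'f) monoid" where
  "cycle_group F k K =
     \<lparr>carrier = cycles k K, mult = (\<lambda>c c' vs. c vs + c' vs), one = (\<lambda>_. 0)\<rparr>"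

text \<open>
  The additive group of the vector space \<open>H\<^sub>k(K; 'f)\<close>; the scalar multiplication plays no role in
  whether it vanishes.
\<close>

definition homology :: "'f::field itself \<Rightarrow> nat \<Rightarrow> 'v set set \<Rightarrow> ('v list \<Rightarrow> 'f) set monoid" where
  "homology F k K = cycle_group F k K Mod boundaries k K"


section \<open>Sanity checks for the chain complex\<close>

lemma chains_support:
  assumes "c \<in> simplicial_chains k K" "c vs \<noteq> 0"
  shows "length vs = Suc k" "distinct vs" "set vs \<in> K"
  using assms by (auto simp: simplicial_chains_def ordered_simplices_def)

lemma chains_finite_support: "c \<in> simplicial_chains k K \<Longrightarrow> finite {vs. c vs \<noteq> 0}"
  by (simp add: simplicial_chains_def)

lemma chains_swap:
  "c \<in> simplicial_chains k K \<Longrightarrow> c (xs @ u # ys @ v # zs) = - c (xs @ v # ys @ u # zs)"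
  unfolding simplicial_chains_def by blast

lemma chains_swap_hd: "c \<in> simplicial_chains k K \<Longrightarrow> c (u # v # zs) = - c (v # u # zs)"
  using chains_swap[of c k K "[]" u "[]" v zs] by simp

lemma chains_move_to_front:
  assumes "c \<in> simplicial_chains k K"
  shows "c (v # xs @ zs) = (- 1) ^ length xs * c (xs @ v # zs)"
proof (induction xs arbitrary: zs rule: rev_induct)
  case (snoc x xs)
  have "c (xs @ v # x # zs) = - c (xs @ x # v # zs)"
    using chains_swap[OF assms, of xs v "[]" x zs] by simp
  then show ?case using snoc[of "x # zs"] by simp
qed simp

text \<open>
  The chain \<open>c\<close> below is a multiple of the oriented simplex \<open>[w\<^sub>0, \<dots>, w\<^sub>k]\<close>; the
  coefficient of its boundary at the facet omitting \<open>w\<^sub>i\<close> is \<open>(-1)\<^sup>i\<close> times its own coefficient.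
\<close>

lemma boundary_oriented_simplex:
  fixes c :: "'v list \<Rightarrow> 'f::field"
  assumes c: "c \<in> simplicial_chains k K" and k: "k \<ge> 1"
    and supp: "\<And>vs. c vs \<noteq> 0 \<Longrightarrow> set vs = set ws"
    and ws: "distinct ws" "length ws = Suc k" and i: "i \<le> k"
  shows "boundary c (take i ws @ drop (Suc i) ws) = (- 1) ^ i * c ws"
proof -
  let ?t = "take i ws @ drop (Suc i) ws"
  have ws_eq: "ws = take i ws @ ws ! i # drop (Suc i) ws"
    using ws i by (simp add: id_take_nth_drop)
  have "?t \<noteq> []"
  proof
    assume "?t = []"
    then have "length ?t = 0" by (simp only: list.size)
    then show False using ws i k by auto
  qed
  have "v = ws ! i" if "c (v # ?t) \<noteq> 0" for v
  proof -
    have "set (v # ?t) = set ws" and d: "distinct (v # ?t)"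
      using supp[OF that] chains_support(2)[OF c that] by blast+
    then have "v \<in> set ws" "v \<notin> set ?t" by auto
    moreover have "set ws = set (take i ws) \<union> insert (ws ! i) (set (drop (Suc i) ws))"
      using arg_cong[OF ws_eq, of set] by (simp only: set_append list.set)
    ultimately show ?thesis by auto
  qed
  then have "boundary c ?t = (\<Sum>v\<in>{ws ! i}. c (v # ?t))"
    unfolding boundary_def using \<open>?t \<noteq> []\<close>
    by (simp only: if_False) (rule sum.mono_neutral_left, auto)
  then have "boundary c ?t = c (ws ! i # ?t)" by simp
  also have "\<dots> = (- 1) ^ i * c ws"
    using chains_move_to_front[OF c, of "ws ! i" "take i ws" "drop (Suc i) ws"] ws i
    by (simp flip: ws_eq)
  finally show ?thesis .
qed

lemma boundary_eq_sum:
  assumes "vs \<noteq> []" "finite V" "{v. c (v # vs) \<noteq> 0} \<subseteq> V"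
  shows "boundary c vs = (\<Sum>v\<in>V. c (v # vs))"
  using assms unfolding boundary_def by (auto intro!: sum.mono_neutral_left)

definition chain_vertices :: "('v list \<Rightarrow> 'f::zero) \<Rightarrow> 'v set" where
  "chain_vertices c = (\<Union>vs\<in>{vs. c vs \<noteq> 0}. set vs)"

lemma chain_vertices:
  "c vs \<noteq> 0 \<Longrightarrow> set vs \<subseteq> chain_vertices c"
  by (auto simp: chain_vertices_def)

lemma finite_chain_vertices: "c \<in> simplicial_chains k K \<Longrightarrow> finite (chain_vertices c)"
  by (auto simp: chain_vertices_def dest: chains_finite_support)

lemma boundary_chain_eq_sum:
  assumes "c \<in> simplicial_chains k K" "vs \<noteq> []"
  shows "boundary c vs = (\<Sum>v\<in>chain_vertices c. c (v # vs))"
proof (rule boundary_eq_sum)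
  show "{v. c (v # vs) \<noteq> 0} \<subseteq> chain_vertices c"
    using chain_vertices[of c] by fastforce
qed (use assms finite_chain_vertices in auto)

lemma boundary_in_chains:
  assumes K: "\<And>\<sigma> \<tau>. \<sigma> \<in> K \<Longrightarrow> \<tau> \<subseteq> \<sigma> \<Longrightarrow> \<tau> \<in> K" and c: "c \<in> simplicial_chains (Suc k) K"
  shows "boundary c \<in> simplicial_chains k K"
proof -
  have ex: "\<exists>v. c (v # vs) \<noteq> 0" if "boundary c vs \<noteq> 0" for vs
    using that unfolding boundary_def by (metis (mono_tags, lifting) empty_Collect_eq sum.empty)
  have "vs \<in> ordered_simplices k K" if nz: "boundary c vs \<noteq> 0" for vs
  proof -
    obtain v where v: "c (v # vs) \<noteq> 0" using ex[OF nz] by blast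
    have "set vs \<in> K" using K[OF chains_support(3)[OF c v]] by auto
    then show ?thesis using chains_support(1,2)[OF c v] by (auto simp: ordered_simplices_def)
  qed
  moreover have "{vs. boundary c vs \<noteq> 0} \<subseteq> tl ` {vs. c vs \<noteq> 0}"
    using ex by force
  then have "finite {vs. boundary c vs \<noteq> 0}"
    using chains_finite_support[OF c] finite_surj by blast
  moreover have "boundary c (xs @ u # ys @ v # zs) = - boundary c (xs @ v # ys @ u # zs)"
    for xs u ys v zs
  proof -
    have "boundary c (xs @ u # ys @ v # zs)
        = (\<Sum>w\<in>chain_vertices c. c ((w # xs) @ u # ys @ v # zs))"
      using c by (simp add: boundary_chain_eq_sum)
    also have "\<dots> = (\<Sum>w\<in>chain_vertices c. - c ((w # xs) @ v # ys @ u # zs))"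
      by (intro sum.cong refl chains_swap[OF c])
    also have "\<dots> = - boundary c (xs @ v # ys @ u # zs)"
      using c by (simp add: boundary_chain_eq_sum sum_negf)
    finally show ?thesis .
  qed
  ultimately show ?thesis unfolding simplicial_chains_def by blast
qed

lemma sum_alternating_eq_0:
  fixes g :: "'v \<Rightarrow> 'v \<Rightarrow> 'f::field"
  assumes "finite V" "\<And>u v. g u v = - g v u" "\<And>v. g v v = 0"
  shows "(\<Sum>u\<in>V. \<Sum>v\<in>V. g u v) = 0"
  using assms(1)
proof (induction V)
  case (insert a V)
  have "(\<Sum>u\<in>V. g u a) = - (\<Sum>u\<in>V. g a u)"
    by (subst sum_negf[symmetric]) (intro sum.cong refl assms(2))
  then show ?case using insert assms(3) by (simp add: sum.distrib)
qed simp

lemma boundary_boundary: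
  assumes c: "c \<in> simplicial_chains k K"
  shows "boundary (boundary c) = (\<lambda>_. 0)"
proof
  fix vs
  show "boundary (boundary c) vs = 0"
  proof (cases "vs = []")
    case False
    let ?V = "chain_vertices c"
    have "{u. boundary c (u # vs) \<noteq> 0} \<subseteq> ?V"
    proof
      fix u assume "u \<in> {u. boundary c (u # vs) \<noteq> 0}"
      then have "(\<Sum>v\<in>?V. c (v # u # vs)) \<noteq> 0"
        using boundary_chain_eq_sum[OF c] by simp
      then obtain v where "c (v # u # vs) \<noteq> 0" by (meson sum.neutral)
      then show "u \<in> ?V" using chain_vertices[of c "v # u # vs"] by simp
    qed
    then have "boundary (boundary c) vs = (\<Sum>u\<in>?V. boundary c (u # vs))"
      using False finite_chain_vertices[OF c] by (intro boundary_eq_sum)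
    also have "\<dots> = (\<Sum>u\<in>?V. \<Sum>v\<in>?V. c (v # u # vs))"
      by (simp add: boundary_chain_eq_sum[OF c])
    also have "\<dots> = 0"
    proof (rule sum_alternating_eq_0)
      show "c (v # u # vs) = - c (u # v # vs)" for u v
        by (rule chains_swap_hd[OF c])
      show "c (v # v # vs) = 0" for v
        using chains_support(2)[OF c, of "v # v # vs"] by auto
    qed (rule finite_chain_vertices[OF c])
    finally show ?thesis .
  qed (simp add: boundary_def)
qed

lemma chains_zero: "(\<lambda>_. 0) \<in> simplicial_chains k K"
  by (simp add: simplicial_chains_def)

lemma chains_add:
  assumes "c \<in> simplicial_chains k K" "c' \<in> simplicial_chains k K"
  shows "(\<lambda>vs. c vs + c' vs) \<in> simplicial_chains k K"
proof -
  have "finite {vs. c vs + c' vs \<noteq> 0}"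
    by (rule finite_subset[of _ "{vs. c vs \<noteq> 0} \<union> {vs. c' vs \<noteq> 0}"])
       (use assms in \<open>auto dest: chains_finite_support\<close>)
  moreover have "c (xs @ u # ys @ v # zs) + c' (xs @ u # ys @ v # zs) =
      - (c (xs @ v # ys @ u # zs) + c' (xs @ v # ys @ u # zs))" for xs u ys v zs
    using assms[THEN chains_swap, of xs u ys v zs] by simp
  moreover have "vs \<in> ordered_simplices k K" if "c vs + c' vs \<noteq> 0" for vs
    using that assms by (cases "c vs = 0") (auto simp: simplicial_chains_def)
  ultimately show ?thesis unfolding simplicial_chains_def by blast
qed

lemma chains_uminus:
  assumes "c \<in> simplicial_chains k K"
  shows "(\<lambda>vs. - c vs) \<in> simplicial_chains k K"
proof -
  have "- c (xs @ u # ys @ v # zs) = - (- c (xs @ v # ys @ u # zs))" for xs u ys v zs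
    by (rule arg_cong[OF chains_swap[OF assms]])
  then show ?thesis
    using assms unfolding simplicial_chains_def mem_Collect_eq neg_equal_0_iff_equal by blast
qed

lemma boundary_zero: "boundary (\<lambda>_. 0) = (\<lambda>_. 0)"
  by (simp add: boundary_def fun_eq_iff)

lemma boundary_uminus: "boundary (\<lambda>vs. - c vs) = (\<lambda>vs. - boundary c vs)"
  by (auto simp: boundary_def fun_eq_iff sum_negf)

lemma boundary_add:
  assumes "c \<in> simplicial_chains k K" "c' \<in> simplicial_chains k K"
  shows "boundary (\<lambda>vs. c vs + c' vs) = (\<lambda>vs. boundary c vs + boundary c' vs)"
proof
  fix vs
  let ?V = "chain_vertices c \<union> chain_vertices c'"
  have fin: "finite ?V" using assms by (auto intro: finite_chain_vertices)
  show "boundary (\<lambda>vs. c vs + c' vs) vs = boundary c vs + boundary c' vs"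
  proof (cases "vs = []")
    case False
    have *: "v \<in> chain_vertices e" if "e (v # vs) \<noteq> 0" for v and e :: "'a list \<Rightarrow> 'b"
      using chain_vertices[where c = e, OF that] by simp
    have "boundary (\<lambda>vs. c vs + c' vs) vs = (\<Sum>v\<in>?V. c (v # vs) + c' (v # vs))"
      using False fin *[of c] *[of c'] by (intro boundary_eq_sum) force+
    moreover have "boundary c vs = (\<Sum>v\<in>?V. c (v # vs))"
      using False fin *[of c] by (intro boundary_eq_sum) auto
    moreover have "boundary c' vs = (\<Sum>v\<in>?V. c' (v # vs))"
      using False fin *[of c'] by (intro boundary_eq_sum) auto
    ultimately show ?thesis by (simp add: sum.distrib)
  qed (simp add: boundary_def)
qed

lemma comm_group_cycle_group: "comm_group (cycle_group F k K)"
proof (rule comm_groupI)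
  fix c assume "c \<in> carrier (cycle_group F k K)"
  then have "(\<lambda>vs. - c vs) \<in> cycles k K"
    by (auto simp: cycle_group_def cycles_def chains_uminus boundary_uminus)
  then show "\<exists>c'\<in>carrier (cycle_group F k K).
      c' \<otimes>\<^bsub>cycle_group F k K\<^esub> c = \<one>\<^bsub>cycle_group F k K\<^esub>"
    by (intro bexI[of _ "\<lambda>vs. - c vs"]) (auto simp: cycle_group_def)
qed (auto simp: cycle_group_def cycles_def chains_zero boundary_zero chains_add boundary_add
       add_ac)

lemma subgroup_boundaries:
  assumes "\<And>\<sigma> \<tau>. \<sigma> \<in> K \<Longrightarrow> \<tau> \<subseteq> \<sigma> \<Longrightarrow> \<tau> \<in> K"
  shows "subgroup (boundaries k K) (cycle_group F k K)"
proof -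
  interpret comm_group "cycle_group F k K" by (rule comm_group_cycle_group)
  have sub: "boundaries k K \<subseteq> carrier (cycle_group F k K)"
  proof
    fix c :: "'a list \<Rightarrow> 'b" assume "c \<in> boundaries k K"
    then obtain b where b: "b \<in> simplicial_chains (Suc k) K" "c = boundary b"
      by (auto simp: boundaries_def)
    have "c \<in> simplicial_chains k K"
      unfolding b(2) by (rule boundary_in_chains[OF _ b(1)]) (rule assms)
    then show "c \<in> carrier (cycle_group F k K)"
      using boundary_boundary[OF b(1)] b(2) by (simp add: cycle_group_def cycles_def)
  qed
  show ?thesis
  proof (rule subgroupI)
    show "boundaries k K \<noteq> ({} :: ('a list \<Rightarrow> 'b) set)"
      using chains_zero by (auto simp: boundaries_def)
  next
    fix c :: "'a list \<Rightarrow> 'b" assume c: "c \<in> boundaries k K"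
    then obtain b where b: "b \<in> simplicial_chains (Suc k) K" "c = boundary b"
      by (auto simp: boundaries_def)
    have "(\<lambda>vs. - c vs) = boundary (\<lambda>vs. - b vs)"
      unfolding b(2) by (rule boundary_uminus[symmetric])
    then have neg: "(\<lambda>vs. - c vs) \<in> boundaries k K"
      unfolding boundaries_def using chains_uminus[OF b(1)] by blast
    have "inv\<^bsub>cycle_group F k K\<^esub> c = (\<lambda>vs. - c vs)"
    proof (rule inv_equality)
      show "(\<lambda>vs. - c vs) \<otimes>\<^bsub>cycle_group F k K\<^esub> c = \<one>\<^bsub>cycle_group F k K\<^esub>"
        by (simp add: cycle_group_def)
    qed (use c neg sub in blast)+
    with neg show "inv\<^bsub>cycle_group F k K\<^esub> c \<in> boundaries k K" by simp
  next
    fix c c' :: "'a list \<Rightarrow> 'b" assume "c \<in> boundaries k K" "c' \<in> boundaries k K"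
    then obtain b b' where b: "b \<in> simplicial_chains (Suc k) K" "c = boundary b"
        "b' \<in> simplicial_chains (Suc k) K" "c' = boundary b'"
      by (auto simp: boundaries_def)
    have "c \<otimes>\<^bsub>cycle_group F k K\<^esub> c' = boundary (\<lambda>vs. b vs + b' vs)"
      unfolding b(2,4) by (simp add: cycle_group_def boundary_add[OF b(1,3)])
    then show "c \<otimes>\<^bsub>cycle_group F k K\<^esub> c' \<in> boundaries k K"
      unfolding boundaries_def using chains_add[OF b(1,3)] by blast
  qed (use sub in auto)
qed

lemma comm_group_homology:
  assumes "\<And>\<sigma> \<tau>. \<sigma> \<in> K \<Longrightarrow> \<tau> \<subseteq> \<sigma> \<Longrightarrow> \<tau> \<in> K"
  shows "comm_group (homology F k K)"
  unfolding homology_def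
proof (rule comm_group.abelian_FactGroup[OF comm_group_cycle_group])
  show "subgroup (boundaries k K) (cycle_group F k K)"
    by (rule subgroup_boundaries) (rule assms, assumption+)
qed


section \<open>Random Vietoris--Rips complexes\<close>

definition rips_complex :: "'a::metric_space set \<Rightarrow> real \<Rightarrow> 'a set set" where
  "rips_complex V r = {\<sigma>. \<sigma> \<subseteq> V \<and> (\<forall>x\<in>\<sigma>. \<forall>y\<in>\<sigma>. dist x y \<le> r)}"

lemma comm_group_homology_rips_complex: "comm_group (homology F k (rips_complex V r))"
proof (rule comm_group_homology)
  show "\<tau> \<in> rips_complex V r" if "\<sigma> \<in> rips_complex V r" "\<tau> \<subseteq> \<sigma>" for \<sigma> \<tau>
    using that unfolding rips_complex_def by blast
qed

text \<open>
  The library's \<open>distributed\<close> with respect to \<open>lborel\<close> would require a Borel measurable density,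
  and with respect to \<open>lebesgue\<close> it would require \<open>X\<close> to be measurable for the
  completed sigma-algebra. Here \<open>X\<close> is an ordinary (Borel) random vector and the density is
  only Lebesgue measurable.
\<close>

definition has_density ::
    "'w measure \<Rightarrow> ('w \<Rightarrow> 'a::euclidean_space) \<Rightarrow> ('a \<Rightarrow> real) \<Rightarrow> bool" where
  "has_density M X f \<longleftrightarrow>
     X \<in> borel_measurable M \<and> f \<in> borel_measurable lebesgue \<and> (\<forall>x. 0 \<le> f x) \<and>
     (\<forall>A\<in>sets borel. emeasure M (X -` A \<inter> space M) = (\<integral>\<^sup>+ x\<in>A. ennreal (f x) \<partial>lebesgue))"

definition asymptotically_almost_surely :: "'w measure \<Rightarrow> (nat \<Rightarrow> 'w \<Rightarrow> bool) \<Rightarrow> bool" where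
  "asymptotically_almost_surely M P \<longleftrightarrow>
     (\<lambda>n. measure M {w \<in> space M. P n w}) \<longlonglongrightarrow> 1"

end

theory Submission
  imports Defs
begin

text \<open>
  Write \<open>N = 2k + 2\<close> and \<open>s = r ^ d\<close>. The two regimes say that \<open>n ^ N * s ^ (N - 1)\<close> tends to \<open>0\<close> or to
  infinity, and \<open>n * s\<close> tends to \<open>0\<close> in both.

  The topological input is that \<open>N\<close> is the least number of vertices of a clique complex with
  nontrivial \<open>H\<^sub>k\<close>. A clique complex with fewer than \<open>N\<close> vertices in each component has \<open>H\<^sub>k = 0\<close>, by induction through
  the link of a vertex (\<open>small_clique_complex_fill\<close>, \<open>clique_complex_fill\<close>). The boundary of the
  \<open>(k + 1)\<close>-dimensional cross-polytope has exactly \<open>N\<close> vertices, and its fundamental cycle is not a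
  boundary in a larger complex as soon as one of its facets lies in no larger simplex
  (\<open>cross_polytope_homology_nontrivial\<close>); it suffices that no further point is near one of its
  vertices.

  For the first part, \<open>N\<close> points in one component can be found within distance \<open>N r\<close> of one of them.
  As \<open>f\<close> is bounded, \<open>N\<close> given points all lie that close to one of them with probability at most a
  constant times \<open>s ^ (N - 1)\<close>, so a union bound gives a failure probability of order \<open>n ^ N * s ^ (N - 1)\<close>
  (\<open>prob_crowded_le\<close>).

  For the second part, the cross-polytope graph has a realisation in the plane that survives small
  perturbations (\<open>cross_polytope_configuration\<close>), and \<open>N\<close> given points form a copy of it at scale \<open>r\<close>
  with probability at least a constant times \<open>s ^ (N - 1)\<close> (\<open>density_local_lower_bound\<close>). The expected
  number of copies therefore has order \<open>n ^ N * s ^ (N - 1)\<close>. Copies on disjoint sets of indices are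
  independent, and pairs of overlapping copies contribute to the variance no more than the order of
  the mean, since each point that is not shared costs a factor \<open>n * s\<close>. By Chebyshev's inequality
  there are at least half as many copies as expected, and by Markov's inequality fewer have an
  additional point nearby, because these are rarer by a factor \<open>n * s\<close>. So some copy is isolated
  (\<open>prob_isolated_configuration_ge\<close>).

  That the homology vanishes is an event at all because it depends only on which points coincide
  and which are within distance \<open>r\<close> (\<open>measurable_trivial_rips_homology\<close>).
\<close>

section \<open>Alternating chains and the exterior product with a vertex\<close>

text \<open>
  In characteristic 2 the vanishing on repeated entries does not follow from antisymmetry.
\<close>

definition alternating :: "('v list \<Rightarrow> 'f::field) \<Rightarrow> bool" where
  "alternating c \<longleftrightarrow> (\<forall>xs u v zs. c (xs @ u # v # zs) = - c (xs @ v # u # zs)) \<and>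
                      (\<forall>xs u zs. c (xs @ u # u # zs) = 0)"

lemma alternatingI:
  assumes "\<And>xs u v zs. c (xs @ u # v # zs) = - c (xs @ v # u # zs)"
    and "\<And>xs u zs. c (xs @ u # u # zs) = 0"
  shows "alternating c"
  using assms unfolding alternating_def by blast

lemma alternating_adjacent: "alternating c \<Longrightarrow> c (xs @ u # v # zs) = - c (xs @ v # u # zs)"
  unfolding alternating_def by blast

lemma alternating_repeat: "alternating c \<Longrightarrow> c (xs @ u # u # zs) = 0"
  unfolding alternating_def by blast

lemma alternating_move:
  assumes "alternating c"
  shows "c (xs @ u # ys @ zs) = (- 1) ^ length ys * c (xs @ ys @ u # zs)"
proof (induction ys arbitrary: xs)
  case (Cons y ys)
  have "c (xs @ u # (y # ys) @ zs) = - c ((xs @ [y]) @ u # ys @ zs)"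
    using alternating_adjacent[OF assms, of xs u y "ys @ zs"] by simp
  then show ?case by (subst (asm) Cons.IH) simp
qed simp

lemma alternating_swap:
  assumes "alternating c"
  shows "c (xs @ u # ys @ v # zs) = - c (xs @ v # ys @ u # zs)"
proof -
  have "c ((xs @ ys) @ u # v # zs) = - c ((xs @ ys) @ v # u # zs)"
    by (rule alternating_adjacent[OF assms])
  then show ?thesis
    using alternating_move[OF assms, of xs u ys "v # zs"]
      alternating_move[OF assms, of xs v ys "u # zs"] by simp
qed

lemma alternating_distinct:
  assumes "alternating c" "c vs \<noteq> 0"
  shows "distinct vs"
proof (rule ccontr)
  assume "\<not> distinct vs"
  then obtain xs ys zs y where vs: "vs = xs @ y # ys @ y # zs"
    using not_distinct_decomp by fastforce
  have "c ((xs @ ys) @ y # y # zs) = 0"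
    by (rule alternating_repeat[OF assms(1)])
  then have "c vs = 0" unfolding vs alternating_move[OF assms(1), of xs y ys "y # zs"] by simp
  with assms(2) show False by simp
qed

lemma alternating_vanish:
  assumes "alternating c" "\<And>us. c (v # us) = 0" "v \<in> set vs"
  shows "c vs = 0"
proof -
  obtain xs zs where "vs = xs @ v # zs" using assms(3) by (meson split_list)
  then show ?thesis using alternating_move[OF assms(1), of "[]" v xs zs] assms(2) by simp
qed

lemma alternating_Cons:
  assumes "alternating c"
  shows "alternating (\<lambda>vs. c (v # vs))"
proof (rule alternatingI)
  show "c (v # xs @ u # w # zs) = - c (v # xs @ w # u # zs)" for xs u w zs
    using alternating_adjacent[OF assms, of "v # xs" u w zs] unfolding append_Cons .
  show "c (v # xs @ u # u # zs) = 0" for xs u zs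
    using alternating_repeat[OF assms, of "v # xs" u zs] unfolding append_Cons .
qed

lemma alternating_zero: "alternating (\<lambda>_. 0)"
  by (intro alternatingI) auto

lemma alternating_add:
  assumes "alternating c" "alternating c'"
  shows "alternating (\<lambda>vs. c vs + c' vs)"
proof (rule alternatingI)
  show "c (xs @ u # v # zs) + c' (xs @ u # v # zs)
      = - (c (xs @ v # u # zs) + c' (xs @ v # u # zs))" for xs u v zs
    using alternating_adjacent[OF assms(1), of xs u v zs] alternating_adjacent[OF assms(2), of xs u v zs]
    by simp
qed (simp add: alternating_repeat[OF assms(1)] alternating_repeat[OF assms(2)])

lemma alternating_uminus:
  assumes "alternating c"
  shows "alternating (\<lambda>vs. - c vs)"
proof (rule alternatingI)
  show "- c (xs @ u # v # zs) = - (- c (xs @ v # u # zs))" for xs u v zs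
    by (rule arg_cong[OF alternating_adjacent[OF assms]])
qed (simp add: alternating_repeat[OF assms])

lemma alternating_diff:
  assumes "alternating c" "alternating c'"
  shows "alternating (\<lambda>vs. c vs - c' vs)"
  using alternating_add[OF assms(1) alternating_uminus[OF assms(2)]] by simp

text \<open>
  The exterior product \<open>v \<and> c\<close>: its value at a list is the alternating sum of the values of \<open>c\<close> at
  the lists in which one occurrence of \<open>v\<close> is omitted. Peeling off the first entry turns this into a
  recursion in which the chain varies.
\<close>

primrec wedge :: "'v \<Rightarrow> ('v list \<Rightarrow> 'f::field) \<Rightarrow> 'v list \<Rightarrow> 'f" where
  "wedge v c [] = 0"
| "wedge v c (u # us) = (if u = v then c us else 0) - wedge v (\<lambda>ws. c (u # ws)) us"

lemma wedge_zero [simp]: "wedge v (\<lambda>_. 0) vs = 0"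
  by (induction vs) auto

lemma wedge_uminus: "wedge v (\<lambda>ws. - c ws) vs = - wedge v c vs"
  by (induction vs arbitrary: c) auto

lemma wedge_sum: "wedge v (\<lambda>ws. \<Sum>u\<in>V. c u ws) vs = (\<Sum>u\<in>V. wedge v (c u) vs)"
  by (induction vs arbitrary: c) (auto simp: sum_subtractf)

lemma alternating_wedge:
  assumes "alternating c"
  shows "alternating (wedge v c)"
proof (rule alternatingI)
  fix xs a b zs
  show "wedge v c (xs @ a # b # zs) = - wedge v c (xs @ b # a # zs)"
    using assms
  proof (induction xs arbitrary: c)
    case Nil
    have "c (a # b # ws) = - c (b # a # ws)" for ws
      using alternating_adjacent[OF Nil, of "[]" a b ws] by simp
    then have "wedge v (\<lambda>ws. c (a # b # ws)) zs = - wedge v (\<lambda>ws. c (b # a # ws)) zs"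
      by (simp flip: wedge_uminus)
    then show ?case by simp
  next
    case (Cons x xs)
    have "c (xs @ a # b # zs) = - c (xs @ b # a # zs)"
      by (rule alternating_adjacent[OF Cons.prems])
    then show ?case using Cons.IH[OF alternating_Cons[OF Cons.prems]] by simp
  qed
next
  fix xs a zs
  show "wedge v c (xs @ a # a # zs) = 0"
    using assms
  proof (induction xs arbitrary: c)
    case Nil
    have "(\<lambda>ws. c (a # a # ws)) = (\<lambda>_. 0)"
      using alternating_repeat[OF Nil, of "[]"] by simp
    then show ?case by simp
  next
    case (Cons x xs)
    have "c (xs @ a # a # zs) = 0"
      by (rule alternating_repeat[OF Cons.prems])
    then show ?case using Cons.IH[OF alternating_Cons[OF Cons.prems]] by simp
  qed
qed

lemma wedge_support:
  assumes "wedge v c vs \<noteq> 0"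
  shows "\<exists>ys. c ys \<noteq> 0 \<and> set vs = insert v (set ys) \<and> length vs = Suc (length ys)"
  using assms
proof (induction vs arbitrary: c)
  case (Cons u us)
  show ?case
  proof (cases "u = v \<and> c us \<noteq> 0")
    case False
    then have "wedge v (\<lambda>ws. c (u # ws)) us \<noteq> 0" using Cons.prems by (auto split: if_splits)
    then obtain ys where "c (u # ys) \<noteq> 0" "set us = insert v (set ys)" "length us = Suc (length ys)"
      using Cons.IH by blast
    then show ?thesis by (intro exI[of _ "u # ys"]) auto
  qed auto
qed simp

text \<open>
  The boundary map of the augmented chain complex: at the empty list it is the augmentation. This
  makes induction over links uniform down to the bottom degree. Summing over a fixed set of vertices
  instead of the support makes linearity immediate.
\<close>

definition aug_boundary :: "'v set \<Rightarrow> ('v list \<Rightarrow> 'f::field) \<Rightarrow> 'v list \<Rightarrow> 'f" where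
  "aug_boundary V c vs = (\<Sum>u\<in>V. c (u # vs))"

text \<open>
  The Leibniz rule. For a cycle \<open>c\<close> it says that \<open>v \<and> c\<close>, the cone over \<open>c\<close> with apex \<open>v\<close>, fills \<open>c\<close>.
\<close>

lemma aug_boundary_wedge:
  assumes "finite V" "v \<in> V"
  shows "aug_boundary V (wedge v c) vs = c vs - wedge v (aug_boundary V c) vs"
  using assms by (simp add: aug_boundary_def [abs_def] sum_subtractf wedge_sum)

lemma aug_boundary_add:
  "aug_boundary V (\<lambda>vs. c vs + c' vs) vs = aug_boundary V c vs + aug_boundary V c' vs"
  by (simp add: aug_boundary_def sum.distrib)

lemma aug_boundary_diff:
  "aug_boundary V (\<lambda>vs. c vs - c' vs) vs = aug_boundary V c vs - aug_boundary V c' vs"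
  by (simp add: aug_boundary_def sum_subtractf)

text \<open>
  Chains are graded by the number of vertices of their simplices rather than by dimension, so that
  the degree of the augmentation is the natural number 0.
\<close>

definition chain_of_length :: "nat \<Rightarrow> 'v set set \<Rightarrow> ('v list \<Rightarrow> 'f::field) \<Rightarrow> bool" where
  "chain_of_length m K c \<longleftrightarrow> alternating c \<and> (\<forall>vs. c vs \<noteq> 0 \<longrightarrow> length vs = m \<and> set vs \<in> K)"

lemma chain_of_length_iff:
  fixes c :: "'v list \<Rightarrow> 'f::field"
  assumes "finite V" "K \<subseteq> Pow V"
  shows "c \<in> simplicial_chains k K \<longleftrightarrow> chain_of_length (Suc k) K c"
proof
  assume c: "c \<in> simplicial_chains k K"
  have "c (xs @ u # v # zs) = - c (xs @ v # u # zs)" for xs u v zs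
    using chains_swap[OF c, of xs u "[]" v zs] by simp
  moreover have "c (xs @ u # u # zs) = 0" for xs u zs
    using chains_support(2)[OF c, of "xs @ u # u # zs"] by auto
  ultimately have "alternating c" by (rule alternatingI)
  then show "chain_of_length (Suc k) K c"
    using chains_support[OF c] unfolding chain_of_length_def by blast
next
  assume c: "chain_of_length (Suc k) K c"
  have "{vs. c vs \<noteq> 0} \<subseteq> {vs. set vs \<subseteq> V \<and> length vs = Suc k}"
    using c assms(2) unfolding chain_of_length_def by blast
  then have "finite {vs. c vs \<noteq> 0}"
    using finite_lists_length_eq[OF assms(1)] finite_subset by blast
  moreover have "alternating c" using c unfolding chain_of_length_def by blast
  moreover have "vs \<in> ordered_simplices k K" if "c vs \<noteq> 0" for vs
    using that c alternating_distinct[of c vs]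
    unfolding chain_of_length_def ordered_simplices_def by blast
  ultimately show "c \<in> simplicial_chains k K"
    unfolding simplicial_chains_def mem_Collect_eq by (intro conjI allI impI alternating_swap)
qed

lemma boundary_eq_aug_boundary:
  assumes "finite V" "K \<subseteq> Pow V" "chain_of_length m K c" "m \<ge> 2"
  shows "boundary c = aug_boundary V c"
proof
  fix vs
  have supp: "length (v # vs) = m \<and> v \<in> V" if "c (v # vs) \<noteq> 0" for v
    using assms that unfolding chain_of_length_def by fastforce
  show "boundary c vs = aug_boundary V c vs"
  proof (cases "vs = []")
    case True
    then have "c (v # vs) = 0" for v using supp[of v] assms(4) by auto
    then show ?thesis by (simp add: boundary_def aug_boundary_def True)
  next
    case False
    then show ?thesis
      using supp assms(1) unfolding aug_boundary_def by (intro boundary_eq_sum) auto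
  qed
qed

lemma trivial_homology_iff:
  fixes K :: "'v set set"
  assumes "\<forall>\<sigma>\<in>K. Pow \<sigma> \<subseteq> K"
  shows "trivial_group (homology TYPE('f::field) k K) \<longleftrightarrow>
    (cycles k K :: ('v list \<Rightarrow> 'f) set) \<subseteq> boundaries k K"
proof -
  let ?G = "cycle_group TYPE('f) k K"
  interpret comm_group ?G by (rule comm_group_cycle_group)
  have "subgroup (boundaries k K) ?G" by (rule subgroup_boundaries) (use assms in blast)
  then have "boundaries k K \<lhd> ?G" by (rule subgroup_imp_normal)
  then interpret normal "boundaries k K" ?G .
  have sub: "boundaries k K \<subseteq> carrier ?G" by (rule subset)
  have "carrier (homology TYPE('f) k K) = {boundaries k K} \<longleftrightarrow> carrier ?G \<subseteq> boundaries k K"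
  proof
    assume eq: "carrier (homology TYPE('f) k K) = {boundaries k K}"
    show "carrier ?G \<subseteq> boundaries k K"
    proof
      fix c assume c: "c \<in> carrier ?G"
      then have "boundaries k K #>\<^bsub>?G\<^esub> c = boundaries k K"
        using eq unfolding homology_def carrier_FactGroup by blast
      then show "c \<in> boundaries k K" using rcos_self[OF c] subgroup_axioms by metis
    qed
  next
    assume "carrier ?G \<subseteq> boundaries k K"
    then have eq: "carrier ?G = boundaries k K" using sub by blast
    have "boundaries k K \<noteq> ({} :: ('v list \<Rightarrow> 'f) set)" using one_closed by blast
    then show "carrier (homology TYPE('f) k K) = {boundaries k K}"
      unfolding homology_def carrier_FactGroup eq
      by (simp add: rcos_const[OF is_group] image_constant_conv)
  qed
  moreover have "group (homology TYPE('f) k K)"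
    unfolding homology_def by (rule factorgroup_is_group)
  ultimately show ?thesis
    by (simp add: trivial_group_def homology_def cycle_group_def)
qed

section \<open>Cycles in clique complexes with small components\<close>

definition clique_complex :: "('v \<Rightarrow> 'v \<Rightarrow> bool) \<Rightarrow> 'v set \<Rightarrow> 'v set set" where
  "clique_complex E W = {\<sigma>. \<sigma> \<subseteq> W \<and> (\<forall>x\<in>\<sigma>. \<forall>y\<in>\<sigma>. E x y)}"

lemma chain_vanish: "chain_of_length m K c \<Longrightarrow> set vs \<notin> K \<Longrightarrow> c vs = 0"
  unfolding chain_of_length_def by blast

lemma chain_of_lengthD:
  assumes "chain_of_length m K c"
  shows "alternating c" "c vs \<noteq> 0 \<Longrightarrow> length vs = m" "c vs \<noteq> 0 \<Longrightarrow> set vs \<in> K"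
  using assms unfolding chain_of_length_def by blast+

lemma chain_of_lengthI:
  assumes "alternating c" "\<And>vs. c vs \<noteq> 0 \<Longrightarrow> length vs = m" "\<And>vs. c vs \<noteq> 0 \<Longrightarrow> set vs \<in> K"
  shows "chain_of_length m K c"
  using assms unfolding chain_of_length_def by blast

text \<open>
  A clique complex with nontrivial reduced homology on simplices of \<open>m\<close> vertices has at least \<open>2m\<close>
  vertices. If some vertex \<open>v\<close> is adjacent to all others, the cone with apex \<open>v\<close> fills \<open>c\<close>. Otherwise
  write \<open>c = v \<and> a + c'\<close> with \<open>v\<close> not in \<open>c'\<close>. Then \<open>a\<close> is a cycle in the link of \<open>v\<close>, which lacks \<open>v\<close>
  and a vertex not adjacent to \<open>v\<close> and so has fewer than \<open>2(m - 1)\<close> vertices; by induction on \<open>m\<close> it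
  is filled by some \<open>b\<^sub>0\<close>. Adding the boundary of \<open>v \<and> b\<^sub>0\<close> to \<open>c\<close> removes \<open>v\<close>, and induction on the
  number of vertices applies.
\<close>

lemma small_clique_complex_fill:
  fixes c :: "'v list \<Rightarrow> 'f::field"
  assumes E: "symp E" "reflp E" and V: "finite V" "W \<subseteq> V" and card: "card W < 2 * m"
    and c: "chain_of_length m (clique_complex E W) c" and cycle: "aug_boundary V c = (\<lambda>_. 0)"
  shows "\<exists>b. chain_of_length (Suc m) (clique_complex E W) b \<and> aug_boundary V b = c"
  using V(2) card c cycle
proof (induction m arbitrary: W c)
  case (Suc m)
  have sym: "E x y" if "E y x" for x y using E(1) that by (rule sympD)
  have E_refl: "E x x" for x using E(2) by (rule reflpD)
  show ?case
    using Suc.prems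
  proof (induction "card W" arbitrary: W c rule: less_induct)
    case less
    have finW: "finite W" using less.prems(1) V(1) finite_subset by blast
    show ?case
    proof (cases "W = {}")
      case True
      have "c vs = 0" for vs
        using chain_of_lengthD(2,3)[OF less.prems(3), of vs] True
        by (cases vs) (auto simp: clique_complex_def)
      then have "c = (\<lambda>_. 0)" by blast
      then show ?thesis
        by (intro exI[of _ "\<lambda>_. 0"])
           (simp add: chain_of_length_def alternating_zero aug_boundary_def fun_eq_iff)
    next
      case False
      then obtain v where v: "v \<in> W" by blast
      have vV: "v \<in> V" using v less.prems(1) by blast
      show ?thesis
      proof (cases "\<forall>w\<in>W. E v w")
        case True
        have "chain_of_length (Suc (Suc m)) (clique_complex E W) (wedge v c)"
        proof (rule chain_of_lengthI)
          fix vs assume "wedge v c vs \<noteq> 0"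
          then obtain ys where ys: "c ys \<noteq> 0" "set vs = insert v (set ys)" "length vs = Suc (length ys)"
            using wedge_support by metis
          show "length vs = Suc (Suc m)" using chain_of_lengthD(2)[OF less.prems(3) ys(1)] ys by simp
          show "set vs \<in> clique_complex E W"
            using chain_of_lengthD(3)[OF less.prems(3) ys(1)] ys v True sym E_refl
            unfolding clique_complex_def by auto
        qed (rule alternating_wedge[OF chain_of_lengthD(1)[OF less.prems(3)]])
        moreover have "aug_boundary V (wedge v c) = c"
          by (rule ext) (simp add: aug_boundary_wedge[OF V(1) vV] less.prems(4))
        ultimately show ?thesis by blast
      next
        case False
        then obtain w where w: "w \<in> W" "\<not> E v w" by blast
        then have "w \<noteq> v" using E_refl by blast
        define L where "L = {u \<in> W. u \<noteq> v \<and> E v u}"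
        have "card (insert v (insert w L)) \<le> card W"
          using v w finW by (intro card_mono) (auto simp: L_def)
        moreover have "finite L" "v \<notin> L" "w \<notin> L" using w finW by (auto simp: L_def)
        ultimately have cardL: "card L < 2 * m" using less.prems(2) \<open>w \<noteq> v\<close> by simp
        \<comment> \<open>the coefficient of \<open>v\<close> in \<open>c\<close>\<close>
        define a where "a vs = c (v # vs)" for vs
        have a: "chain_of_length m (clique_complex E L) a"
        proof (rule chain_of_lengthI)
          show alt_a: "alternating a" unfolding a_def
            by (rule alternating_Cons[OF chain_of_lengthD(1)[OF less.prems(3)]])
          fix vs assume "a vs \<noteq> 0"
          then have nz: "c (v # vs) \<noteq> 0" by (simp add: a_def)
          show "length vs = m" using chain_of_lengthD(2)[OF less.prems(3) nz] by simp
          have "distinct (v # vs)"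
            using alternating_distinct[OF chain_of_lengthD(1)[OF less.prems(3)] nz] .
          then show "set vs \<in> clique_complex E L"
            using chain_of_lengthD(3)[OF less.prems(3) nz] unfolding clique_complex_def L_def by auto
        qed
        have c_swap: "c (v # u # vs) = - c (u # v # vs)" for u vs
          using alternating_adjacent[OF chain_of_lengthD(1)[OF less.prems(3)], of "[]" v u vs] by simp
        have "aug_boundary V a vs = - aug_boundary V c (v # vs)" for vs
          unfolding aug_boundary_def a_def sum_negf[symmetric] by (rule sum.cong[OF refl c_swap])
        then have bd_a: "aug_boundary V a = (\<lambda>_. 0)" using less.prems(4) by (simp add: fun_eq_iff)
        have "L \<subseteq> V" using less.prems(1) by (auto simp: L_def)
        then obtain b0 where b0: "chain_of_length (Suc m) (clique_complex E L) b0"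
          and bd_b0: "aug_boundary V b0 = a"
          using Suc.IH[OF _ cardL a bd_a] by blast
        \<comment> \<open>\<open>c\<^sub>1\<close> is \<open>c\<close> plus the boundary of \<open>v \<and> b\<^sub>0\<close>\<close>
        define c1 where "c1 vs = c vs + b0 vs - wedge v a vs" for vs
        have c1: "chain_of_length (Suc m) (clique_complex E (W - {v})) c1"
        proof (rule chain_of_lengthI)
          show alt: "alternating c1" unfolding c1_def
            by (intro alternating_diff alternating_add alternating_wedge chain_of_lengthD(1)[OF a]
                chain_of_lengthD(1)[OF b0] chain_of_lengthD(1)[OF less.prems(3)])
          fix vs assume nz: "c1 vs \<noteq> 0"
          have "c1 (v # us) = 0" for us
          proof -
            have "(\<lambda>ws. a (v # ws)) = (\<lambda>_. 0)"
              using alternating_repeat[OF chain_of_lengthD(1)[OF less.prems(3)], of "[]" v]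
              by (simp add: a_def fun_eq_iff)
            moreover have "b0 (v # us) = 0"
              using chain_vanish[OF b0, of "v # us"] by (simp add: clique_complex_def L_def)
            ultimately show ?thesis by (simp add: c1_def a_def)
          qed
          then have "v \<notin> set vs" using alternating_vanish[OF alt] nz by blast
          have "c vs \<noteq> 0 \<or> b0 vs \<noteq> 0 \<or> wedge v a vs \<noteq> 0" using nz unfolding c1_def by auto
          then have "length vs = Suc m \<and> set vs \<in> clique_complex E W"
          proof (elim disjE)
            assume "c vs \<noteq> 0"
            then show ?thesis using chain_of_lengthD(2,3)[OF less.prems(3)] by blast
          next
            assume "b0 vs \<noteq> 0"
            then show ?thesis using chain_of_lengthD(2,3)[OF b0]
              unfolding clique_complex_def L_def by blast
          next
            assume "wedge v a vs \<noteq> 0"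
            then show ?thesis using wedge_support \<open>v \<notin> set vs\<close> by fastforce
          qed
          then show "length vs = Suc m" "set vs \<in> clique_complex E (W - {v})"
            using \<open>v \<notin> set vs\<close> unfolding clique_complex_def by auto
        qed
        have "aug_boundary V c1 = (\<lambda>_. 0)"
          unfolding c1_def [abs_def]
          by (rule ext) (simp add: aug_boundary_diff aug_boundary_add aug_boundary_wedge[OF V(1) vV]
              less.prems(4) bd_b0 bd_a)
        moreover have "card (W - {v}) < card W" using finW v by (meson card_Diff1_less)
        ultimately obtain b1 where b1: "chain_of_length (Suc (Suc m)) (clique_complex E (W - {v})) b1"
          and bd_b1: "aug_boundary V b1 = c1"
          using less.hyps[of "W - {v}" c1] c1 less.prems(1,2) by auto
        have "chain_of_length (Suc (Suc m)) (clique_complex E W) (\<lambda>vs. b1 vs - wedge v b0 vs)"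
        proof (rule chain_of_lengthI)
          show "alternating (\<lambda>vs. b1 vs - wedge v b0 vs)"
            by (intro alternating_diff alternating_wedge chain_of_lengthD(1)[OF b0]
                chain_of_lengthD(1)[OF b1])
          fix vs assume "b1 vs - wedge v b0 vs \<noteq> 0"
          then have "b1 vs \<noteq> 0 \<or> wedge v b0 vs \<noteq> 0" by auto
          then have "length vs = Suc (Suc m) \<and> set vs \<in> clique_complex E W"
          proof
            assume "b1 vs \<noteq> 0"
            then show ?thesis using chain_of_lengthD(2,3)[OF b1] unfolding clique_complex_def by blast
          next
            assume "wedge v b0 vs \<noteq> 0"
            then obtain ys where ys: "b0 ys \<noteq> 0" "set vs = insert v (set ys)" "length vs = Suc (length ys)"
              using wedge_support by metis
            then show ?thesis
              using chain_of_lengthD(2,3)[OF b0 ys(1)] v sym E_refl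
              unfolding clique_complex_def L_def by auto
          qed
          then show "length vs = Suc (Suc m)" "set vs \<in> clique_complex E W" by blast+
        qed
        moreover have "aug_boundary V (\<lambda>vs. b1 vs - wedge v b0 vs) = c"
          by (rule ext) (simp add: aug_boundary_diff aug_boundary_wedge[OF V(1) vV] bd_b0 bd_b1 c1_def)
        ultimately show ?thesis by blast
      qed
    qed
  qed
qed simp

definition restrict_chain :: "'v set \<Rightarrow> ('v list \<Rightarrow> 'f::field) \<Rightarrow> 'v list \<Rightarrow> 'f" where
  "restrict_chain C c vs = (if set vs \<subseteq> C then c vs else 0)"

lemma alternating_restrict_chain:
  assumes "alternating c"
  shows "alternating (restrict_chain C c)"
proof (rule alternatingI)
  show "restrict_chain C c (xs @ u # v # zs) = - restrict_chain C c (xs @ v # u # zs)" for xs u v zs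
    using alternating_adjacent[OF assms, of xs u v zs] by (simp add: restrict_chain_def)
qed (simp add: restrict_chain_def alternating_repeat[OF assms])

text \<open>
  Every simplex lies in \<open>C\<close> or is disjoint from it when no edge leaves \<open>C\<close>, so the part of a cycle
  inside \<open>C\<close> is again a cycle and can be filled separately. In the lowest degree this would fail,
  because the augmentation need not vanish on each component; hence \<open>m \<ge> 2\<close>.
\<close>

lemma clique_complex_fill:
  fixes c :: "'v list \<Rightarrow> 'f::field"
  assumes E: "symp E" "reflp E" and V: "finite V" and m: "m \<ge> 2"
    and small: "\<And>v. v \<in> V \<Longrightarrow> \<exists>C\<subseteq>V. v \<in> C \<and> card C < 2 * m \<and> (\<forall>u\<in>C. \<forall>w\<in>V. E u w \<longrightarrow> w \<in> C)"
    and c: "chain_of_length m (clique_complex E V) c" and cycle: "aug_boundary V c = (\<lambda>_. 0)"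
  shows "\<exists>b. chain_of_length (Suc m) (clique_complex E V) b \<and> aug_boundary V b = c"
proof -
  have sym: "E x y" if "E y x" for x y using E(1) that by (rule sympD)
  have "\<exists>b. chain_of_length (Suc m) (clique_complex E V) b \<and> aug_boundary V b = c"
    if "W \<subseteq> V" "\<forall>u\<in>W. \<forall>w\<in>V. E u w \<longrightarrow> w \<in> W"
      "chain_of_length m (clique_complex E W) c" "aug_boundary V c = (\<lambda>_. 0)"
    for W and c :: "'v list \<Rightarrow> 'f"
    using that
  proof (induction "card W" arbitrary: W c rule: less_induct)
    case less
    have finW: "finite W" using less.prems(1) V finite_subset by blast
    note chain_c = chain_of_lengthD[OF less.prems(3)]
    show ?case
    proof (cases "W = {}")
      case True
      have "c vs = 0" for vs
        using chain_c(2,3)[of vs] True m by (cases vs) (auto simp: clique_complex_def)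
      then have "c = (\<lambda>_. 0)" by blast
      then show ?thesis
        by (intro exI[of _ "\<lambda>_. 0"])
           (simp add: chain_of_length_def alternating_zero aug_boundary_def fun_eq_iff)
    next
      case False
      then obtain v where v: "v \<in> W" by blast
      then obtain C0 where C0: "C0 \<subseteq> V" "v \<in> C0" "card C0 < 2 * m"
          "\<forall>u\<in>C0. \<forall>w\<in>V. E u w \<longrightarrow> w \<in> C0"
        using small[OF subsetD[OF less.prems(1) v]] by (elim exE conjE)
      define C where "C = C0 \<inter> W"
      have C: "C \<subseteq> V" "v \<in> C" using C0(1,2) v by (auto simp: C_def)
      have C_closed: "\<forall>u\<in>C. \<forall>w\<in>V. E u w \<longrightarrow> w \<in> C"
        using C0(4) less.prems(2) unfolding C_def by (meson IntD1 IntD2 IntI)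
      have "finite C0" using C0(1) V finite_subset by blast
      then have cardC: "card C < 2 * m"
        using C0(3) card_mono[of C0 C] by (simp add: C_def)
      define c1 where "c1 = restrict_chain C c"
      have c1: "chain_of_length m (clique_complex E C) c1"
      proof (rule chain_of_lengthI)
        fix vs assume "c1 vs \<noteq> 0"
        then have "set vs \<subseteq> C" "c vs \<noteq> 0" by (auto simp: c1_def restrict_chain_def split: if_splits)
        then show "length vs = m" "set vs \<in> clique_complex E C"
          using chain_c(2,3) unfolding clique_complex_def by blast+
      qed (simp add: c1_def alternating_restrict_chain chain_c(1))
      have bd_c1: "aug_boundary V c1 = (\<lambda>_. 0)"
      proof
        fix vs
        consider "vs = []" | "\<not> set vs \<subseteq> C" | u us where "vs = u # us" "set vs \<subseteq> C"
          by (cases vs) auto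
        then show "aug_boundary V c1 vs = 0"
        proof cases
          case 1
          have "c1 [u] = 0" for u using chain_of_lengthD(2)[OF c1, of "[u]"] m by auto
          then show ?thesis by (simp add: aug_boundary_def 1)
        next
          case 2
          then show ?thesis by (simp add: aug_boundary_def c1_def restrict_chain_def)
        next
          case 3
          have "c1 (w # vs) = c (w # vs)" if "w \<in> V" for w
          proof (cases "c (w # vs) = 0")
            case False
            then have "E u w" using chain_c(3)[OF False] 3(1) unfolding clique_complex_def by auto
            then have "w \<in> C" using C_closed 3 that by auto
            then show ?thesis using 3(2) by (simp add: c1_def restrict_chain_def)
          qed (simp add: c1_def restrict_chain_def)
          then have "aug_boundary V c1 vs = aug_boundary V c vs" by (simp add: aug_boundary_def)
          then show ?thesis using less.prems(4) by simp
        qed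
      qed
      obtain b1 where b1: "chain_of_length (Suc m) (clique_complex E C) b1" "aug_boundary V b1 = c1"
        using small_clique_complex_fill[OF E V C(1) cardC c1 bd_c1] by blast
      define c2 where "c2 vs = c vs - c1 vs" for vs
      have c2: "chain_of_length m (clique_complex E (W - C)) c2"
      proof (rule chain_of_lengthI)
        show "alternating c2" unfolding c2_def
          by (intro alternating_diff chain_c(1) chain_of_lengthD(1)[OF c1])
        fix vs assume "c2 vs \<noteq> 0"
        then have nz: "c vs \<noteq> 0" and "\<not> set vs \<subseteq> C"
          by (auto simp: c2_def c1_def restrict_chain_def split: if_splits)
        moreover have cl: "set vs \<in> clique_complex E W" by (rule chain_c(3)[OF nz])
        ultimately obtain w where w: "w \<in> set vs" "w \<notin> C" by blast
        have "u \<notin> C" if "u \<in> set vs" for u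
          using that w C_closed cl less.prems(1) unfolding clique_complex_def by blast
        then show "length vs = m" "set vs \<in> clique_complex E (W - C)"
          using chain_c(2)[OF nz] cl unfolding clique_complex_def by auto
      qed
      have "aug_boundary V c2 = (\<lambda>_. 0)"
        by (rule ext) (simp add: c2_def [abs_def] aug_boundary_diff bd_c1 less.prems(4))
      moreover have "card (W - C) < card W"
        using finW v C(2) by (intro psubset_card_mono) auto
      moreover have "\<forall>u\<in>W - C. \<forall>w\<in>V. E u w \<longrightarrow> w \<in> W - C"
        using less.prems(1,2) C_closed sym by blast
      ultimately obtain b2 where b2: "chain_of_length (Suc m) (clique_complex E V) b2"
          "aug_boundary V b2 = c2"
        using less.hyps[of "W - C" c2] c2 less.prems(1) by blast
      have "chain_of_length (Suc m) (clique_complex E V) (\<lambda>vs. b1 vs + b2 vs)"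
      proof (rule chain_of_lengthI)
        show "alternating (\<lambda>vs. b1 vs + b2 vs)"
          by (intro alternating_add chain_of_lengthD(1)[OF b1(1)] chain_of_lengthD(1)[OF b2(1)])
        fix vs assume "b1 vs + b2 vs \<noteq> 0"
        then have "b1 vs \<noteq> 0 \<or> b2 vs \<noteq> 0" by auto
        then show "length vs = Suc m" "set vs \<in> clique_complex E V"
          using chain_of_lengthD(2,3)[OF b1(1)] chain_of_lengthD(2,3)[OF b2(1)] C(1)
          unfolding clique_complex_def by blast+
      qed
      moreover have "aug_boundary V (\<lambda>vs. b1 vs + b2 vs) = c"
        by (rule ext) (simp add: aug_boundary_add b1(2) b2(2) c2_def)
      ultimately show ?thesis by blast
    qed
  qed
  from this[of V c] c cycle show ?thesis by blast
qed

section \<open>The cycle of a cross-polytope\<close>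

text \<open>
  The exterior product of the differences \<open>a i - b i\<close>, for \<open>i\<close> from \<open>j - 1\<close> down to \<open>0\<close>: the
  fundamental cycle of the boundary of the cross-polytope whose pairs of antipodal vertices are
  \<open>a i\<close> and \<open>b i\<close>.
\<close>

primrec cross_polytope_cycle :: "(nat \<Rightarrow> 'v) \<Rightarrow> (nat \<Rightarrow> 'v) \<Rightarrow> nat \<Rightarrow> 'v list \<Rightarrow> 'f::field" where
  "cross_polytope_cycle a b 0 = (\<lambda>vs. if vs = [] then 1 else 0)"
| "cross_polytope_cycle a b (Suc j) =
     (\<lambda>vs. wedge (a j) (cross_polytope_cycle a b j) vs - wedge (b j) (cross_polytope_cycle a b j) vs)"

lemma alternating_cross_polytope_cycle: "alternating (cross_polytope_cycle a b j)"
proof (induction j)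
  case 0
  show ?case by (rule alternatingI) auto
next
  case (Suc j)
  then show ?case by (simp add: alternating_diff alternating_wedge)
qed

text \<open>
  By the Leibniz rule, \<open>\<partial>(a \<and> z - b \<and> z) = z - z\<close> for every cycle \<open>z\<close>.
\<close>

lemma aug_boundary_cross_polytope_cycle:
  assumes "finite V" "\<And>i. i < j \<Longrightarrow> a i \<in> V \<and> b i \<in> V"
  shows "aug_boundary V (cross_polytope_cycle a b j :: 'v list \<Rightarrow> 'f::field) = (\<lambda>_. 0)"
  using assms(2)
proof (induction j)
  case (Suc j)
  then have "aug_boundary V (cross_polytope_cycle a b j :: 'v list \<Rightarrow> 'f) = (\<lambda>_. 0)" "a j \<in> V" "b j \<in> V" by auto
  then show ?case
    by (intro ext) (simp add: aug_boundary_diff aug_boundary_wedge[OF assms(1)])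
qed (simp add: aug_boundary_def fun_eq_iff)

lemma cross_polytope_cycle_support:
  assumes "cross_polytope_cycle a b j vs \<noteq> (0::'f::field)"
  shows "length vs = j \<and> (\<exists>s. set vs = (\<lambda>i. if s i then a i else b i) ` {..<j})"
  using assms
proof (induction j arbitrary: vs)
  case (Suc j)
  have "\<exists>ys t. cross_polytope_cycle a b j ys \<noteq> (0::'f) \<and> length vs = Suc (length ys) \<and>
      set vs = insert (if t then a j else b j) (set ys)"
  proof (cases "wedge (a j) (cross_polytope_cycle a b j) vs = (0::'f)")
    case True
    then have "wedge (b j) (cross_polytope_cycle a b j) vs \<noteq> (0::'f)" using Suc.prems by auto
    from wedge_support[OF this] show ?thesis by (metis (full_types))
  next
    case False
    from wedge_support[OF this] show ?thesis by (metis (full_types))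
  qed
  then obtain ys t where ys: "cross_polytope_cycle a b j ys \<noteq> (0::'f)" "length vs = Suc (length ys)"
      "set vs = insert (if t then a j else b j) (set ys)" by blast
  obtain s where "length ys = j" and s: "set ys = (\<lambda>i. if s i then a i else b i) ` {..<j}"
    using Suc.IH[OF ys(1)] by blast
  moreover have "set vs = (\<lambda>i. if (s(j := t)) i then a i else b i) ` {..<Suc j}"
    unfolding ys(3) s lessThan_Suc by auto
  ultimately show ?case using ys(2) by blast
qed (auto split: if_splits)

lemma cross_polytope_cycle_top_coeff:
  assumes "inj_on a {..<j}" "\<And>i l. i < j \<Longrightarrow> l < j \<Longrightarrow> a i \<noteq> b l"
  shows "cross_polytope_cycle a b j (rev (map a [0..<j])) = (1::'f::field)"
  using assms
proof (induction j)
  case (Suc j)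
  let ?z = "cross_polytope_cycle a b j :: 'a list \<Rightarrow> 'f"
  have "?z (a j # ws) = 0" for ws
  proof (rule ccontr)
    assume "?z (a j # ws) \<noteq> 0"
    then obtain s where "set (a j # ws) = (\<lambda>i. if s i then a i else b i) ` {..<j}"
      using cross_polytope_cycle_support by blast
    then have "a j \<in> (\<lambda>i. if s i then a i else b i) ` {..<j}" by force
    then obtain i where i: "i < j" "a j = (if s i then a i else b i)" by blast
    then show False using Suc.prems(2)[of j i] inj_onD[OF Suc.prems(1), of j i] by (auto split: if_splits)
  qed
  then have "?z (rev (map a [0..<j])) = 1 \<Longrightarrow> ?case"
    using Suc.prems(2)[of j j] by simp
  moreover have "inj_on a {..<j}" by (rule inj_on_subset[OF Suc.prems(1)]) auto
  ultimately show ?case using Suc.IH Suc.prems(2) by simp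
qed simp

text \<open>
  The coefficient of a boundary at a simplex is a sum over simplices with one more vertex, and is
  therefore \<open>0\<close> at every maximal simplex. The cycle of the cross-polytope has coefficient \<open>1\<close> at the
  facet spanned by all \<open>a i\<close>.
\<close>

lemma cross_polytope_homology_nontrivial:
  fixes a b :: "nat \<Rightarrow> 'v"
  assumes V: "finite V" and K: "K \<subseteq> Pow V" "\<forall>\<sigma>\<in>K. Pow \<sigma> \<subseteq> K" and k: "k \<ge> 1"
    and ab: "\<And>i. i \<le> k \<Longrightarrow> a i \<in> V \<and> b i \<in> V" "inj_on a {..k}"
      "\<And>i l. i \<le> k \<Longrightarrow> l \<le> k \<Longrightarrow> a i \<noteq> b l"
    and faces: "\<And>s. (\<lambda>i. if s i then a i else b i) ` {..k} \<in> K"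
    and maximal: "\<And>v. insert v (a ` {..k}) \<in> K \<Longrightarrow> v \<in> a ` {..k}"
  shows "\<not> trivial_group (homology TYPE('f::field) k K)"
proof
  assume "trivial_group (homology TYPE('f::field) k K)"
  then have triv: "(cycles k K :: ('v list \<Rightarrow> 'f) set) \<subseteq> boundaries k K"
    unfolding trivial_homology_iff[OF K(2)] .
  let ?z = "cross_polytope_cycle a b (Suc k) :: 'v list \<Rightarrow> 'f"
  have z: "chain_of_length (Suc k) K ?z"
  proof (rule chain_of_lengthI[OF alternating_cross_polytope_cycle])
    fix vs assume nz: "?z vs \<noteq> 0"
    show "length vs = Suc k" "set vs \<in> K"
      using cross_polytope_cycle_support[OF nz] faces by (auto simp: lessThan_Suc_atMost)
  qed
  have "aug_boundary V ?z = (\<lambda>_. 0)"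
    by (rule aug_boundary_cross_polytope_cycle) (use V ab(1) in auto)
  then have "boundary ?z = (\<lambda>_. 0)"
    using boundary_eq_aug_boundary[OF V K(1) z] k by simp
  then have "?z \<in> cycles k K"
    using z by (simp add: cycles_def chain_of_length_iff[OF V K(1)])
  then obtain c where c: "c \<in> simplicial_chains (Suc k) K" "?z = boundary c"
    using triv unfolding boundaries_def by blast
  let ?as = "rev (map a [0..<Suc k])"
  have set_as: "set ?as = a ` {..k}" by (simp add: atLeast0AtMost atLeastLessThanSuc_atLeastAtMost del: upt_Suc)
  have "c (v # ?as) = 0" for v
  proof (rule ccontr)
    assume nz: "c (v # ?as) \<noteq> 0"
    have "v \<notin> set ?as" using chains_support(2)[OF c(1) nz] unfolding distinct.simps by blast
    moreover have "insert v (set ?as) \<in> K" using chains_support(3)[OF c(1) nz] unfolding list.set .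
    ultimately have "v \<notin> a ` {..k}" "insert v (a ` {..k}) \<in> K" unfolding set_as by blast+
    then show False using maximal by blast
  qed
  then have "boundary c ?as = 0" by (simp add: boundary_def)
  moreover have "?z ?as = 1"
    by (rule cross_polytope_cycle_top_coeff) (use ab in \<open>auto simp: lessThan_Suc_atMost\<close>)
  ultimately show False unfolding c(2) by simp
qed

section \<open>Homology of Vietoris--Rips complexes\<close>

lemma trivial_homology_iff_fill:
  fixes K :: "'v set set"
  assumes V: "finite V" and K: "K \<subseteq> Pow V" "\<forall>\<sigma>\<in>K. Pow \<sigma> \<subseteq> K" and k: "k \<ge> 1"
  shows "trivial_group (homology TYPE('f::field) k K) \<longleftrightarrow>
    (\<forall>c :: 'v list \<Rightarrow> 'f. chain_of_length (Suc k) K c \<and> aug_boundary V c = (\<lambda>_. 0) \<longrightarrow>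
      (\<exists>b. chain_of_length (Suc (Suc k)) K b \<and> aug_boundary V b = c))"
proof -
  have "c \<in> cycles k K \<longleftrightarrow> chain_of_length (Suc k) K c \<and> aug_boundary V c = (\<lambda>_. 0)"
    for c :: "'v list \<Rightarrow> 'f"
    using boundary_eq_aug_boundary[OF V K(1), of "Suc k" c] k
    by (auto simp: cycles_def chain_of_length_iff[OF V K(1)])
  moreover have "c \<in> boundaries k K \<longleftrightarrow>
      (\<exists>b. chain_of_length (Suc (Suc k)) K b \<and> aug_boundary V b = c)"
    for c :: "'v list \<Rightarrow> 'f"
  proof -
    have "boundary b = aug_boundary V b" if "chain_of_length (Suc (Suc k)) K b" for b :: "'v list \<Rightarrow> 'f"
      by (rule boundary_eq_aug_boundary[OF V K(1) that]) simp
    then show ?thesis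
      unfolding boundaries_def image_iff Bex_def chain_of_length_iff[OF V K(1)] by metis
  qed
  ultimately show ?thesis unfolding trivial_homology_iff[OF K(2)] subset_iff by (simp only:)
qed

lemma rips_complex_eq_clique_complex: "rips_complex V r = clique_complex (\<lambda>x y. dist x y \<le> r) V"
  by (simp add: rips_complex_def clique_complex_def)

lemma rips_complex_subset: "rips_complex V r \<subseteq> Pow V"
  by (auto simp: rips_complex_def)

lemma rips_complex_downward: "\<forall>\<sigma>\<in>rips_complex V r. Pow \<sigma> \<subseteq> rips_complex V r"
  unfolding rips_complex_def by blast

text \<open>
  Starting from \<open>v\<close>, points within \<open>r\<close> of a point already found are added one at a time. The first
  \<open>j + 1\<close> points found lie within \<open>j r\<close> of \<open>v\<close>, so the process stops before there are \<open>N\<close> of them.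
\<close>

lemma small_closed_set:
  fixes V :: "'a::metric_space set"
  assumes V: "finite V" "v \<in> V" and r: "r \<ge> 0"
    and sparse: "card (V \<inter> cball v (real N * r)) < N"
  shows "\<exists>C\<subseteq>V. v \<in> C \<and> card C < N \<and> (\<forall>u\<in>C. \<forall>w\<in>V. dist u w \<le> r \<longrightarrow> w \<in> C)"
proof (rule ccontr)
  assume no_C: "\<not> ?thesis"
  have "\<exists>S\<subseteq>V. v \<in> S \<and> card S = Suc j \<and> S \<subseteq> cball v (real j * r)" if "Suc j \<le> N" for j
    using that
  proof (induction j)
    case 0
    show ?case by (intro exI[of _ "{v}"]) (simp add: V)
  next
    case (Suc j)
    then obtain S where S: "S \<subseteq> V" "v \<in> S" "card S = Suc j" "S \<subseteq> cball v (real j * r)" by auto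
    then obtain u w where uw: "u \<in> S" "w \<in> V" "dist u w \<le> r" "w \<notin> S"
      using no_C Suc.prems by (metis Suc_le_lessD)
    have "dist v w \<le> dist v u + dist u w" by (rule dist_triangle)
    also have "\<dots> \<le> real (Suc j) * r" using S(4) uw(1,3) by (auto simp: algebra_simps)
    finally have "dist v w \<le> real (Suc j) * r" .
    moreover have "cball v (real j * r) \<subseteq> cball v (real (Suc j) * r)"
      using r by (intro subset_cball mult_right_mono) auto
    moreover have "finite S" using S(1) V(1) finite_subset by blast
    ultimately show ?case using S uw by (intro exI[of _ "insert w S"]) auto
  qed
  from this[of "N - 1"] sparse obtain S
    where S: "S \<subseteq> V" "card S = N" "S \<subseteq> cball v (real (N - 1) * r)" by (cases N) auto
  have "cball v (real (N - 1) * r) \<subseteq> cball v (real N * r)"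
    using r by (intro subset_cball mult_right_mono) auto
  then have "S \<subseteq> V \<inter> cball v (real N * r)" using S by blast
  then have "N \<le> card (V \<inter> cball v (real N * r))"
    using card_mono[of "V \<inter> cball v (real N * r)" S] V(1) S(2) by simp
  then show False using sparse by simp
qed

lemma rips_homology_trivial:
  fixes V :: "'a::metric_space set"
  assumes V: "finite V" and r: "r \<ge> 0" and k: "k \<ge> 1"
    and sparse: "\<And>v. v \<in> V \<Longrightarrow> card (V \<inter> cball v (real (2 * k + 2) * r)) < 2 * k + 2"
  shows "trivial_group (homology TYPE('f::field) k (rips_complex V r))"
  unfolding trivial_homology_iff_fill[OF V rips_complex_subset rips_complex_downward k]
proof (intro allI impI, elim conjE)
  fix c :: "'a list \<Rightarrow> 'f"
  assume c: "chain_of_length (Suc k) (rips_complex V r) c" "aug_boundary V c = (\<lambda>_. 0)"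
  show "\<exists>b. chain_of_length (Suc (Suc k)) (rips_complex V r) b \<and> aug_boundary V b = c"
    unfolding rips_complex_eq_clique_complex
  proof (rule clique_complex_fill[OF _ _ V])
    show "symp (\<lambda>x y :: 'a. dist x y \<le> r)" by (simp add: symp_def dist_commute)
    show "reflp (\<lambda>x y :: 'a. dist x y \<le> r)" using r by (simp add: reflp_def)
    show "\<exists>C\<subseteq>V. v \<in> C \<and> card C < 2 * Suc k \<and> (\<forall>u\<in>C. \<forall>w\<in>V. dist u w \<le> r \<longrightarrow> w \<in> C)"
      if "v \<in> V" for v
      using small_closed_set[OF V that r, of "2 * Suc k"] sparse[OF that] by simp
  qed (use k c in \<open>simp_all add: rips_complex_eq_clique_complex\<close>)
qed

text \<open>
  The points \<open>p (i, True)\<close> and \<open>p (i, False)\<close> are antipodal in the cross-polytope. A vertex that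
  extends the facet of all \<open>p (i, True)\<close> would be near \<open>p (0, True)\<close>, hence a vertex of the
  cross-polytope itself, hence some \<open>p (i, False)\<close>, which is too far from its antipode.
\<close>

lemma rips_homology_nontrivial:
  fixes V :: "'a::metric_space set" and p :: "nat \<times> bool \<Rightarrow> 'a"
  assumes V: "finite V" and r: "r \<ge> 0" and k: "k \<ge> 1"
    and p: "\<And>i s. i \<le> k \<Longrightarrow> p (i, s) \<in> V"
    and close: "\<And>i j s t. i \<le> k \<Longrightarrow> j \<le> k \<Longrightarrow> i \<noteq> j \<Longrightarrow> dist (p (i, s)) (p (j, t)) \<le> r"
    and far: "\<And>i. i \<le> k \<Longrightarrow> dist (p (i, True)) (p (i, False)) > r"
    and isolated: "\<And>v. v \<in> V \<Longrightarrow> dist v (p (0, True)) \<le> r \<Longrightarrow> v \<in> p ` ({..k} \<times> UNIV)"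
  shows "\<not> trivial_group (homology TYPE('f::field) k (rips_complex V r))"
proof (rule cross_polytope_homology_nontrivial[OF V rips_complex_subset rips_complex_downward k])
  show "p (i, True) \<in> V \<and> p (i, False) \<in> V" if "i \<le> k" for i using p that by blast
  have ne: "p (i, True) \<noteq> p (j, s)" if "i \<le> k" "j \<le> k" "i \<noteq> j" for i j s
    using far[OF that(1)] close[OF that(2,1), of s False] that(3) by auto
  then show "inj_on (\<lambda>i. p (i, True)) {..k}" by (intro inj_onI) (metis atMost_iff)
  show "p (i, True) \<noteq> p (l, False)" if "i \<le> k" "l \<le> k" for i l
    using ne[OF that, of False] far[OF that(1)] r by (cases "i = l") auto
  show "(\<lambda>i. if s i then p (i, True) else p (i, False)) ` {..k} \<in> rips_complex V r" for s
  proof -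
    have eq: "(if s i then p (i, True) else p (i, False)) = p (i, s i)" for i by simp
    have "dist (p (i, s i)) (p (j, s j)) \<le> r" if "i \<le> k" "j \<le> k" for i j
      using close[OF that] r by (cases "i = j") auto
    then show ?thesis unfolding rips_complex_def eq using p by auto
  qed
  fix v assume ins: "insert v ((\<lambda>i. p (i, True)) ` {..k}) \<in> rips_complex V r"
  then have v: "v \<in> V" unfolding rips_complex_def by simp
  have near: "dist v (p (i, True)) \<le> r" if "i \<le> k" for i
    using ins that unfolding rips_complex_def by simp
  obtain i s where i_s: "i \<le> k" "v = p (i, s)" using isolated[OF v near[of 0]] by auto
  have s using far[OF i_s(1)] near[OF i_s(1)] i_s(2) by (cases s) (auto simp: dist_commute)
  then show "v \<in> (\<lambda>i. p (i, True)) ` {..k}" using i_s by auto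
qed

section \<open>Measurability of the vanishing of homology\<close>

text \<open>
  Pulling back is cut off outside \<open>V\<close>, where the vertex map \<open>h\<close> is not under control.
\<close>

definition pull_chain :: "('v \<Rightarrow> 'u) \<Rightarrow> 'v set \<Rightarrow> ('u list \<Rightarrow> 'f::field) \<Rightarrow> 'v list \<Rightarrow> 'f" where
  "pull_chain h V c vs = (if set vs \<subseteq> V then c (map h vs) else 0)"

lemma chain_of_length_pull_chain:
  assumes c: "chain_of_length m K' c" and K: "\<And>\<sigma>. \<sigma> \<subseteq> V \<Longrightarrow> h ` \<sigma> \<in> K' \<Longrightarrow> \<sigma> \<in> K"
  shows "chain_of_length m K (pull_chain h V c)"
proof (rule chain_of_lengthI)
  show "alternating (pull_chain h V c)"
  proof (rule alternatingI)
    show "pull_chain h V c (xs @ u # v # zs) = - pull_chain h V c (xs @ v # u # zs)" for xs u v zs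
      using alternating_adjacent[OF chain_of_lengthD(1)[OF c], of "map h xs" "h u" "h v" "map h zs"]
      by (simp add: pull_chain_def)
    show "pull_chain h V c (xs @ u # u # zs) = 0" for xs u zs
      using alternating_repeat[OF chain_of_lengthD(1)[OF c], of "map h xs" "h u" "map h zs"]
      by (simp add: pull_chain_def)
  qed
  fix vs assume "pull_chain h V c vs \<noteq> 0"
  then have vs: "set vs \<subseteq> V" "c (map h vs) \<noteq> 0" by (auto simp: pull_chain_def split: if_splits)
  show "length vs = m" using chain_of_lengthD(2)[OF c vs(2)] by simp
  show "set vs \<in> K" using K[OF vs(1)] chain_of_lengthD(3)[OF c vs(2)] by simp
qed

lemma aug_boundary_pull_chain:
  assumes "bij_betw h V V'"
  shows "aug_boundary V (pull_chain h V c) = pull_chain h V (aug_boundary V' c)"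
proof
  fix vs
  show "aug_boundary V (pull_chain h V c) vs = pull_chain h V (aug_boundary V' c) vs"
    using sum.reindex_bij_betw[OF assms, of "\<lambda>u. c (u # map h vs)"]
    by (auto simp: aug_boundary_def pull_chain_def)
qed

lemma trivial_homology_transfer:
  fixes h :: "'v \<Rightarrow> 'u" and g :: "'u \<Rightarrow> 'v"
  assumes V: "finite V" and K: "K \<subseteq> Pow V" "\<forall>\<sigma>\<in>K. Pow \<sigma> \<subseteq> K"
    and V': "finite V'" and K': "K' \<subseteq> Pow V'" "\<forall>\<sigma>\<in>K'. Pow \<sigma> \<subseteq> K'"
    and k: "k \<ge> 1"
    and h: "\<And>v. v \<in> V \<Longrightarrow> h v \<in> V'" "\<And>v. v \<in> V \<Longrightarrow> g (h v) = v"
    and g: "\<And>u. u \<in> V' \<Longrightarrow> g u \<in> V" "\<And>u. u \<in> V' \<Longrightarrow> h (g u) = u"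
    and faces: "\<And>\<sigma>. \<sigma> \<subseteq> V \<Longrightarrow> h ` \<sigma> \<in> K' \<longleftrightarrow> \<sigma> \<in> K"
    and triv: "trivial_group (homology TYPE('f::field) k K')"
  shows "trivial_group (homology TYPE('f::field) k K)"
  unfolding trivial_homology_iff_fill[OF V K k]
proof (intro allI impI, elim conjE)
  fix c :: "'v list \<Rightarrow> 'f"
  assume c: "chain_of_length (Suc k) K c" "aug_boundary V c = (\<lambda>_. 0)"
  have bij: "bij_betw h V V'" "bij_betw g V' V"
    by (rule bij_betw_byWitness[of _ g]; use h g in blast)
       (rule bij_betw_byWitness[of _ h]; use h g in blast)
  have "\<sigma> \<in> K'" if "\<sigma> \<subseteq> V'" "g ` \<sigma> \<in> K" for \<sigma>
  proof -
    have "h ` g ` \<sigma> = \<sigma>" using that(1) g(2) by (force simp: image_image)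
    then show ?thesis using faces[of "g ` \<sigma>"] that g(1) by auto
  qed
  then have "chain_of_length (Suc k) K' (pull_chain g V' c)"
    by (rule chain_of_length_pull_chain[OF c(1)])
  moreover have "aug_boundary V' (pull_chain g V' c) = (\<lambda>_. 0)"
    unfolding aug_boundary_pull_chain[OF bij(2)] c(2) by (simp add: pull_chain_def fun_eq_iff)
  ultimately obtain b where b: "chain_of_length (Suc (Suc k)) K' b"
      "aug_boundary V' b = pull_chain g V' c"
    using triv unfolding trivial_homology_iff_fill[OF V' K' k] by blast
  have "pull_chain h V (pull_chain g V' c) vs = c vs" for vs
  proof (cases "set vs \<subseteq> V")
    case True
    then have "map (g \<circ> h) vs = vs" using h(2) by (intro map_idI) auto
    then show ?thesis using True h(1) by (auto simp: pull_chain_def)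
  next
    case False
    then show ?thesis using chain_vanish[OF c(1), of vs] K(1) by (auto simp: pull_chain_def)
  qed
  then have "aug_boundary V (pull_chain h V b) = c"
    unfolding aug_boundary_pull_chain[OF bij(1)] b(2) by blast
  moreover have "chain_of_length (Suc (Suc k)) K (pull_chain h V b)"
    by (rule chain_of_length_pull_chain[OF b(1)]) (use faces in blast)
  ultimately show "\<exists>b. chain_of_length (Suc (Suc k)) K b \<and> aug_boundary V b = c" by blast
qed

text \<open>
  Points with the same coincidences and the same near pairs span isomorphic complexes.
\<close>

lemma trivial_rips_homology_pattern:
  fixes a a' :: "'i \<Rightarrow> 'a::metric_space"
  assumes I: "finite I" and k: "k \<ge> 1"
    and eq: "\<And>i j. i \<in> I \<Longrightarrow> j \<in> I \<Longrightarrow> a i = a j \<longleftrightarrow> a' i = a' j"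
    and near: "\<And>i j. i \<in> I \<Longrightarrow> j \<in> I \<Longrightarrow> dist (a i) (a j) \<le> r \<longleftrightarrow> dist (a' i) (a' j) \<le> r"
    and triv: "trivial_group (homology TYPE('f::field) k (rips_complex (a' ` I) r))"
  shows "trivial_group (homology TYPE('f::field) k (rips_complex (a ` I) r))"
proof (rule trivial_homology_transfer[OF _ rips_complex_subset rips_complex_downward
      _ rips_complex_subset rips_complex_downward k _ _ _ _ _ triv])
  define h where "h = a' \<circ> inv_into I a"
  define g where "g = a \<circ> inv_into I a'"
  have h: "h (a i) = a' i" if "i \<in> I" for i
  proof -
    have "inv_into I a (a i) \<in> I" "a (inv_into I a (a i)) = a i"
      using that by (auto intro: inv_into_into f_inv_into_f)
    then show ?thesis using eq[of "inv_into I a (a i)" i] that by (simp add: h_def)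
  qed
  have g: "g (a' i) = a i" if "i \<in> I" for i
  proof -
    have "inv_into I a' (a' i) \<in> I" "a' (inv_into I a' (a' i)) = a' i"
      using that by (auto intro: inv_into_into f_inv_into_f)
    then show ?thesis using eq[of "inv_into I a' (a' i)" i] that by (simp add: g_def)
  qed
  show "h v \<in> a' ` I" "g (h v) = v" if "v \<in> a ` I" for v using that h g by auto
  show "g u \<in> a ` I" "h (g u) = u" if "u \<in> a' ` I" for u using that h g by auto
  show "h ` \<sigma> \<in> rips_complex (a' ` I) r \<longleftrightarrow> \<sigma> \<in> rips_complex (a ` I) r" if sub: "\<sigma> \<subseteq> a ` I" for \<sigma>
  proof -
    obtain J where J: "J \<subseteq> I" "\<sigma> = a ` J" using sub unfolding subset_image_iff by blast
    then have "h ` \<sigma> = a' ` J" using h by (force simp: image_image)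
    then show ?thesis using J near by (auto simp: rips_complex_def subset_iff)
  qed
qed (use I in auto)

text \<open>
  There are finitely many patterns of coincidences and near pairs, and each of them is a measurable
  condition on the points.
\<close>

lemma measurable_trivial_rips_homology:
  fixes x :: "'i \<Rightarrow> 'w \<Rightarrow> 'a::euclidean_space"
  assumes I: "finite I" and k: "k \<ge> 1"
    and x [measurable]: "\<And>i. i \<in> I \<Longrightarrow> x i \<in> borel_measurable M"
  shows "{w \<in> space M. trivial_group (homology TYPE('f::field) k (rips_complex ((\<lambda>i. x i w) ` I) r))}
           \<in> sets M"
proof -
  define triv where "triv w \<longleftrightarrow>
    trivial_group (homology TYPE('f::field) k (rips_complex ((\<lambda>i. x i w) ` I) r))" for w
  define pat where "pat w = ({(i, j) \<in> I \<times> I. x i w = x j w}, {(i, j) \<in> I \<times> I. dist (x i w) (x j w) \<le> r})" for w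
  have "triv w \<longleftrightarrow> triv w'" if "pat w = pat w'" for w w'
  proof -
    have "x i w = x j w \<longleftrightarrow> x i w' = x j w'"
      "dist (x i w) (x j w) \<le> r \<longleftrightarrow> dist (x i w') (x j w') \<le> r" if "i \<in> I" "j \<in> I" for i j
      using \<open>pat w = pat w'\<close> that unfolding pat_def by (auto simp: set_eq_iff)
    then show ?thesis unfolding triv_def
      by (auto intro!: trivial_rips_homology_pattern[OF I k, of "\<lambda>i. x i w" "\<lambda>i. x i w'" r]
          trivial_rips_homology_pattern[OF I k, of "\<lambda>i. x i w'" "\<lambda>i. x i w" r])
  qed
  then have "{w \<in> space M. triv w} = (\<Union>P\<in>pat ` {w \<in> space M. triv w}. {w \<in> space M. pat w = P})"
    by blast
  moreover have "finite (pat ` {w \<in> space M. triv w})"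
    by (rule finite_subset[of _ "Pow (I \<times> I) \<times> Pow (I \<times> I)"]) (use I in \<open>auto simp: pat_def\<close>)
  moreover have "{w \<in> space M. pat w = P} \<in> sets M" if P_in: "P \<in> pat ` {w \<in> space M. triv w}" for P
  proof -
    obtain w0 where P: "P = pat w0" using P_in by blast
    have "{w \<in> space M. pat w = P} = {w \<in> space M. \<forall>i\<in>I. \<forall>j\<in>I.
        (x i w = x j w \<longleftrightarrow> x i w0 = x j w0) \<and>
        (dist (x i w) (x j w) \<le> r \<longleftrightarrow> dist (x i w0) (x j w0) \<le> r)}"
      unfolding P pat_def by (auto simp: set_eq_iff)
    also have "\<dots> \<in> sets M" using I by measurable
    finally show ?thesis .
  qed
  ultimately show ?thesis unfolding triv_def by (metis (no_types, lifting) sets.finite_UN)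
qed

section \<open>Star-shaped events in an i.i.d. sample\<close>

locale iid_sample = prob_space M for M :: "'w measure" +
  fixes x :: "'i \<Rightarrow> 'w \<Rightarrow> 'a::euclidean_space" and J :: "'i set" and D :: "'a measure"
  assumes indep: "indep_vars (\<lambda>_. borel) x J"
    and distr_x: "\<And>i. i \<in> J \<Longrightarrow> distr M borel (x i) = D"
begin

lemma random_variable_x [measurable]: "i \<in> J \<Longrightarrow> x i \<in> borel_measurable M"
  using indep by (auto simp: indep_vars_def)

lemma prob_space_D: "i \<in> J \<Longrightarrow> prob_space D"
  using distr_x prob_space_distr random_variable_x by metis

lemma sets_D: "i \<in> J \<Longrightarrow> sets D = sets borel"
  using distr_x sets_distr by metis

lemma distr_restrict:
  assumes "I \<subseteq> J" "I \<noteq> {}"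
  shows "distr M (\<Pi>\<^sub>M i\<in>I. borel) (\<lambda>w. \<lambda>i\<in>I. x i w) = (\<Pi>\<^sub>M i\<in>I. D)"
proof -
  have "indep_vars (\<lambda>_. borel) x I" using indep assms(1) indep_vars_subset by blast
  then have "distr M (\<Pi>\<^sub>M i\<in>I. borel) (\<lambda>w. \<lambda>i\<in>I. x i w) = (\<Pi>\<^sub>M i\<in>I. distr M borel (x i))"
    using indep_vars_iff_distr_eq_PiM'[OF assms(2), where X = x and M' = "\<lambda>_. borel"] assms(1) random_variable_x
    by blast
  also have "\<dots> = (\<Pi>\<^sub>M i\<in>I. D)"
    by (intro PiM_cong refl) (use assms(1) distr_x in auto)
  finally show ?thesis .
qed

definition star :: "'i \<Rightarrow> 'i set \<Rightarrow> ('i \<Rightarrow> 'a) \<Rightarrow> real \<Rightarrow> 'w set" where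
  "star c L p \<rho> = {w \<in> space M. \<forall>l\<in>L. x l w \<in> cball (x c w + p l) \<rho>}"

lemma star_measurable [measurable]:
  assumes "finite L" "insert c L \<subseteq> J"
  shows "star c L p \<rho> \<in> sets M"
proof -
  have [measurable]: "x i \<in> borel_measurable M" if "i \<in> insert c L" for i
    using assms(2) that by auto
  show ?thesis unfolding star_def mem_cball using assms(1) by measurable
qed

text \<open>
  Given the value \<open>y\<close> of \<open>x c\<close>, the conditions on the points with indices in \<open>L\<close> are independent.
\<close>

lemma emeasure_star:
  assumes L: "finite L" "insert c L \<subseteq> J" "c \<notin> L"
  shows "emeasure M (star c L p \<rho>) = (\<integral>\<^sup>+y. (\<Prod>l\<in>L. emeasure D (cball (y + p l) \<rho>)) \<partial>D)"
proof -
  interpret D: prob_space D using prob_space_D L(2) by blast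
  interpret PD: product_prob_space "\<lambda>_. D" UNIV ..
  have sets_D' [measurable_cong]: "sets D = sets borel" using sets_D L(2) by blast
  let ?I = "insert c L"
  let ?B = "{f \<in> space (\<Pi>\<^sub>M i\<in>?I. D). \<forall>l\<in>L. f l \<in> cball (f c + p l) \<rho>}"
  have B [measurable]: "?B \<in> sets (\<Pi>\<^sub>M i\<in>?I. D)"
    unfolding mem_cball using L(1) by measurable
  have meas: "(\<lambda>w. \<lambda>i\<in>?I. x i w) \<in> measurable M (\<Pi>\<^sub>M i\<in>?I. borel)"
    using L(2) by (intro measurable_restrict random_variable_x) auto
  have sets_eq: "sets (\<Pi>\<^sub>M i\<in>?I. borel) = sets (\<Pi>\<^sub>M i\<in>?I. D)"
    by (intro sets_PiM_cong refl) (simp add: sets_D')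
  have "star c L p \<rho> = (\<lambda>w. \<lambda>i\<in>?I. x i w) -` ?B \<inter> space M"
    using sets_eq_imp_space_eq[OF sets_D'] by (auto simp: star_def space_PiM)
  then have "emeasure M (star c L p \<rho>) = emeasure (distr M (\<Pi>\<^sub>M i\<in>?I. borel) (\<lambda>w. \<lambda>i\<in>?I. x i w)) ?B"
    using meas B by (subst emeasure_distr) (auto simp: sets_eq)
  also have "\<dots> = emeasure (\<Pi>\<^sub>M i\<in>?I. D) ?B"
    using distr_restrict[OF L(2)] by simp
  also have "\<dots> = (\<integral>\<^sup>+f. indicator ?B f \<partial>(\<Pi>\<^sub>M i\<in>?I. D))"
    by (rule nn_integral_indicator[OF B, symmetric])
  also have "\<dots> = (\<integral>\<^sup>+y. (\<integral>\<^sup>+f. indicator ?B (f(c := y)) \<partial>(\<Pi>\<^sub>M i\<in>L. D)) \<partial>D)"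
    by (rule PD.product_nn_integral_insert_rev[OF L(1,3)]) measurable
  also have "\<dots> = (\<integral>\<^sup>+y. (\<Prod>l\<in>L. emeasure D (cball (y + p l) \<rho>)) \<partial>D)"
  proof (rule nn_integral_cong)
    fix y assume "y \<in> space D"
    have "(\<integral>\<^sup>+f. indicator ?B (f(c := y)) \<partial>(\<Pi>\<^sub>M i\<in>L. D)) =
        (\<integral>\<^sup>+f. indicator (\<Pi>\<^sub>E l\<in>L. cball (y + p l) \<rho>) f \<partial>(\<Pi>\<^sub>M i\<in>L. D))"
    proof (rule nn_integral_cong)
      fix f assume "f \<in> space (\<Pi>\<^sub>M i\<in>L. D)"
      then have f: "f \<in> extensional L" by (auto simp: space_PiM PiE_def)
      have "f(c := y) \<in> ?B \<longleftrightarrow> f \<in> (\<Pi>\<^sub>E l\<in>L. cball (y + p l) \<rho>)"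
        using f L(3) sets_eq_imp_space_eq[OF sets_D']
        by (auto simp: space_PiM PiE_def extensional_def Pi_def)
      then show "indicator ?B (f(c := y)) = (indicator (\<Pi>\<^sub>E l\<in>L. cball (y + p l) \<rho>) f :: ennreal)"
        by (simp only: indicator_def)
    qed
    also have "\<dots> = emeasure (\<Pi>\<^sub>M i\<in>L. D) (\<Pi>\<^sub>E l\<in>L. cball (y + p l) \<rho>)"
      using L(1) by (intro nn_integral_indicator sets_PiM_I_finite) (auto simp: sets_D')
    also have "\<dots> = (\<Prod>l\<in>L. emeasure D (cball (y + p l) \<rho>))"
      using L(1) by (intro PD.emeasure_PiM) (auto simp: sets_D')
    finally show "(\<integral>\<^sup>+f. indicator ?B (f(c := y)) \<partial>(\<Pi>\<^sub>M i\<in>L. D)) =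
        (\<Prod>l\<in>L. emeasure D (cball (y + p l) \<rho>))" .
  qed
  finally show ?thesis .
qed

lemma prob_star_le:
  assumes L: "finite L" "insert c L \<subseteq> J" "c \<notin> L"
    and q: "q \<ge> 0" "\<And>y. emeasure D (cball y \<rho>) \<le> ennreal q"
  shows "prob (star c L p \<rho>) \<le> q ^ card L"
proof -
  interpret D: prob_space D using prob_space_D L(2) by blast
  have "emeasure M (star c L p \<rho>) = (\<integral>\<^sup>+y. (\<Prod>l\<in>L. emeasure D (cball (y + p l) \<rho>)) \<partial>D)"
    by (rule emeasure_star[OF L])
  also have "\<dots> \<le> (\<integral>\<^sup>+y. ennreal (q ^ card L) \<partial>D)"
  proof (rule nn_integral_mono)
    fix y
    have "(\<Prod>l\<in>L. emeasure D (cball (y + p l) \<rho>)) \<le> (\<Prod>l\<in>L. ennreal q)"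
      by (intro prod_mono_ennreal) (auto simp: q)
    also have "\<dots> = ennreal (q ^ card L)" by (simp add: ennreal_power q(1))
    finally show "(\<Prod>l\<in>L. emeasure D (cball (y + p l) \<rho>)) \<le> ennreal (q ^ card L)" .
  qed
  also have "\<dots> = ennreal (q ^ card L)" by (simp add: D.emeasure_space_1)
  finally show ?thesis using q(1) by (simp add: emeasure_eq_measure)
qed

lemma prob_star_ge:
  assumes L: "finite L" "insert c L \<subseteq> J" "c \<notin> L"
    and Y: "Y \<in> sets borel" "emeasure D Y \<ge> ennreal \<alpha>" and "\<alpha> \<ge> 0" "\<beta> \<ge> 0"
    and ball: "\<And>y l. y \<in> Y \<Longrightarrow> l \<in> L \<Longrightarrow> emeasure D (cball (y + p l) \<rho>) \<ge> ennreal \<beta>"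
  shows "prob (star c L p \<rho>) \<ge> \<alpha> * \<beta> ^ card L"
proof -
  have sets_D': "sets D = sets borel" using sets_D L(2) by blast
  have "ennreal (\<alpha> * \<beta> ^ card L) = ennreal (\<beta> ^ card L) * ennreal \<alpha>"
    using assms(6,7) by (simp add: ennreal_mult mult.commute)
  also have "\<dots> \<le> ennreal (\<beta> ^ card L) * emeasure D Y" by (intro mult_left_mono Y(2)) simp
  also have "\<dots> = (\<integral>\<^sup>+y. ennreal (\<beta> ^ card L) * indicator Y y \<partial>D)"
    using Y(1) sets_D' by (simp add: nn_integral_cmult_indicator)
  also have "\<dots> \<le> (\<integral>\<^sup>+y. (\<Prod>l\<in>L. emeasure D (cball (y + p l) \<rho>)) \<partial>D)"
  proof (rule nn_integral_mono)
    fix y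
    show "ennreal (\<beta> ^ card L) * indicator Y y \<le> (\<Prod>l\<in>L. emeasure D (cball (y + p l) \<rho>))"
    proof (cases "y \<in> Y")
      case True
      have "ennreal (\<beta> ^ card L) = (\<Prod>l\<in>L. ennreal \<beta>)" by (simp add: ennreal_power assms(7))
      also have "\<dots> \<le> (\<Prod>l\<in>L. emeasure D (cball (y + p l) \<rho>))"
        by (intro prod_mono_ennreal) (auto simp: ball True)
      finally show ?thesis using True by simp
    qed simp
  qed
  also have "\<dots> = emeasure M (star c L p \<rho>)" by (rule emeasure_star[OF L, symmetric])
  finally show ?thesis by (simp add: emeasure_eq_measure)
qed

lemma indep_star:
  assumes L: "finite L" "insert c L \<subseteq> J" and L': "finite L'" "insert c' L' \<subseteq> J"
    and disj: "insert c L \<inter> insert c' L' = {}"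
  shows "prob (star c L p \<rho> \<inter> star c' L' p' \<rho>') = prob (star c L p \<rho>) * prob (star c' L' p' \<rho>')"
proof -
  define S where "S c L p \<rho> = {f \<in> space (\<Pi>\<^sub>M i\<in>insert c L. borel :: 'a measure).
      \<forall>l\<in>L. f l \<in> cball (f c + p l) \<rho>}" for c :: 'i and L p \<rho>
  have S [measurable]: "S c L p \<rho> \<in> sets (\<Pi>\<^sub>M i\<in>insert c L. borel)" if "finite L" for c L p \<rho>
    unfolding S_def mem_cball using that by measurable
  have star_eq: "star c L p \<rho> = (\<lambda>w. \<lambda>i\<in>insert c L. x i w) -` S c L p \<rho> \<inter> space M" for c L p \<rho>
    by (auto simp: star_def S_def space_PiM)
  have "indep_var (\<Pi>\<^sub>M i\<in>insert c L. borel) (\<lambda>w. \<lambda>i\<in>insert c L. x i w)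
      (\<Pi>\<^sub>M i\<in>insert c' L'. borel) (\<lambda>w. \<lambda>i\<in>insert c' L'. x i w)"
    by (rule indep_var_restrict[OF indep disj L(2) L'(2)])
  from indep_varD[OF this S[OF L(1)] S[OF L'(1)]]
  have "prob ((\<lambda>w. (\<lambda>i\<in>insert c L. x i w, \<lambda>i\<in>insert c' L'. x i w)) -` (S c L p \<rho> \<times> S c' L' p' \<rho>') \<inter> space M)
      = prob (star c L p \<rho>) * prob (star c' L' p' \<rho>')"
    by (simp add: star_eq)
  moreover have "(\<lambda>w. (\<lambda>i\<in>insert c L. x i w, \<lambda>i\<in>insert c' L'. x i w)) -` (S c L p \<rho> \<times> S c' L' p' \<rho>') \<inter> space M
      = star c L p \<rho> \<inter> star c' L' p' \<rho>'"
    unfolding star_eq by auto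
  ultimately show ?thesis by simp
qed

end

section \<open>Local bounds on the mass of a bounded density\<close>

lemma emeasure_lborel_translation_vimage:
  fixes c :: "'a::euclidean_space"
  assumes "A \<in> sets borel"
  shows "emeasure lborel {z. c + z \<in> A} = emeasure lborel A"
proof -
  have "emeasure lborel A = emeasure (distr lborel borel ((+) c)) A" by (simp add: lborel_distr_plus)
  also have "\<dots> = emeasure lborel {z. c + z \<in> A}"
    using assms by (subst emeasure_distr) (auto simp: vimage_def)
  finally show ?thesis ..
qed

text \<open>
  Small translations keep \<open>K\<close> inside an open neighbourhood \<open>U\<close>, so those that leave \<open>K\<close> end in
  \<open>U - K\<close>, whose measure is small by outer regularity.
\<close>

lemma emeasure_lborel_compact_translation:
  fixes K :: "'a::euclidean_space set"
  assumes K: "compact K" and \<eta>: "\<eta> > 0"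
  shows "\<exists>t>0. \<forall>u. norm u \<le> t \<longrightarrow> emeasure lborel {y \<in> K. y + u \<notin> K} \<le> ennreal \<eta>"
proof -
  have [measurable]: "K \<in> sets borel" using K by (simp add: borel_compact)
  obtain U where U: "open U" "K \<subseteq> U" "emeasure lborel (U - K) < ennreal \<eta>"
    using outer_regular_lborel[of K \<eta>] \<eta> by (auto simp: borel_compact K)
  obtain t where t: "t > 0" "(\<Union>y\<in>K. cball y t) \<subseteq> U"
    using compact_subset_open_imp_cball_epsilon_subset[OF K U(1,2)] by blast
  have [measurable]: "U \<in> sets borel" using U(1) by simp
  have "emeasure lborel {y \<in> K. y + u \<notin> K} \<le> ennreal \<eta>" if u: "norm u \<le> t" for u
  proof -
    have "y + u \<in> U" if "y \<in> K" for y
      using t(2) that u by (auto simp: dist_norm intro!: subsetD[OF t(2)] bexI[of _ y])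
    then have "{y \<in> K. y + u \<notin> K} \<subseteq> {y. u + y \<in> U - K}" by (auto simp: add.commute)
    then have "emeasure lborel {y \<in> K. y + u \<notin> K} \<le> emeasure lborel {y. u + y \<in> U - K}"
      by (intro emeasure_mono) measurable
    also have "\<dots> = emeasure lborel (U - K)" by (rule emeasure_lborel_translation_vimage) measurable
    finally show ?thesis using U(3) by simp
  qed
  then show ?thesis using t(1) by blast
qed

text \<open>
  A substitute for Lebesgue's density theorem that is uniform in the scale \<open>r\<close>: for most \<open>y\<close> in
  \<open>K\<close>, the set \<open>K\<close> fills at least half of each ball around \<open>y + r p\<close>. By Fubini's theorem, the average
  over \<open>y\<close> of the part of the ball that is missed is an average over displacements \<open>u\<close> of the measure
  of those \<open>y\<close> for which \<open>y + u\<close> leaves \<open>K\<close>. This is small, and Markov's inequality applies.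
\<close>

lemma uniform_translates_dense:
  fixes K :: "'a::euclidean_space set"
  assumes K: "compact K" and P: "finite P" and e: "e > 0" and pos: "emeasure lborel K = ennreal \<alpha>" "\<alpha> > 0"
  shows "\<exists>r0>0. \<forall>r. 0 < r \<and> r \<le> r0 \<longrightarrow>
    (\<exists>Y\<in>sets borel. Y \<subseteq> K \<and> emeasure lborel Y \<ge> ennreal (\<alpha> / 2) \<and>
      (\<forall>y\<in>Y. \<forall>p\<in>P. emeasure lborel (K \<inter> cball (y + r *\<^sub>R p) (r * e)) \<ge>
        ennreal (unit_ball_vol (DIM('a)) * (r * e) ^ DIM('a) / 2)))"
proof -
  have K_borel [measurable]: "K \<in> sets borel" using K by (simp add: borel_compact)
  \<comment> \<open>The exceptional set for each \<open>p\<close> has measure at most \<open>2 \<eta>\<close>; together they cover at most half of \<open>K\<close>.\<close>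
  define \<eta> where "\<eta> = \<alpha> / (4 * (real (card P) + 1))"
  have \<eta>: "\<eta> > 0" using pos(2) by (simp add: \<eta>_def add_nonneg_pos)
  obtain t where t: "t > 0" "\<And>u. norm u \<le> t \<Longrightarrow> emeasure lborel {y \<in> K. y + u \<notin> K} \<le> ennreal \<eta>"
    using emeasure_lborel_compact_translation[OF K \<eta>] by blast
  obtain b where b: "\<And>p. p \<in> P \<Longrightarrow> norm p \<le> b"
    using finite_imp_bounded[OF P] by (auto simp: bounded_iff)
  \<comment> \<open>All displacements \<open>u\<close> in the ball around \<open>r p\<close> of radius \<open>r e\<close> have norm at most \<open>r (\<bar>b\<bar> + e)\<close>.\<close>
  define r0 where "r0 = t / (\<bar>b\<bar> + e)"
  have r0: "r0 > 0" using t(1) e by (simp add: r0_def add_nonneg_pos)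
  have cancel: "a \<le> b" if "a + ennreal c \<le> b + ennreal c" for a b c
    using that by (simp add: ennreal_add_left_cancel_le add.commute[of a] add.commute[of b])
  have "\<exists>Y\<in>sets borel. Y \<subseteq> K \<and> emeasure lborel Y \<ge> ennreal (\<alpha> / 2) \<and>
      (\<forall>y\<in>Y. \<forall>p\<in>P. emeasure lborel (K \<inter> cball (y + r *\<^sub>R p) (r * e)) \<ge>
        ennreal (unit_ball_vol (DIM('a)) * (r * e) ^ DIM('a) / 2))"
    if r: "0 < r" "r \<le> r0" for r
  proof -
    define v where "v = unit_ball_vol (DIM('a)) * (r * e) ^ DIM('a)"
    have v: "v > 0" using r(1) e by (simp add: v_def)
    have vol: "emeasure lborel (cball c (r * e) :: 'a set) = ennreal v" for c :: 'a
      unfolding v_def using r(1) e by (intro emeasure_cball) simp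
    define miss where "miss p y = emeasure lborel {u \<in> cball (r *\<^sub>R p) (r * e). y + u \<notin> K}" for p y
    have miss_eq: "miss p y =
        (\<integral>\<^sup>+u. (indicator (cball (r *\<^sub>R p) (r * e)) u * indicator (- K) (y + u)) \<partial>lborel)" for p y
    proof -
      have "miss p y = (\<integral>\<^sup>+u. indicator {u \<in> cball (r *\<^sub>R p) (r * e). y + u \<notin> K} u \<partial>lborel)"
        unfolding miss_def mem_cball by (rule nn_integral_indicator[symmetric]) measurable
      also have "\<dots> = (\<integral>\<^sup>+u. (indicator (cball (r *\<^sub>R p) (r * e)) u * indicator (- K) (y + u)) \<partial>lborel)"
        by (intro nn_integral_cong) (auto simp: indicator_def)
      finally show ?thesis .
    qed
    have ind: "(\<lambda>z. indicator A (g z) :: ennreal) \<in> borel_measurable N"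
      if "g \<in> borel_measurable N" "A \<in> sets borel" for A :: "'a set" and g and N :: "('a \<times> 'a) measure"
      by (rule measurable_compose[OF that(1) borel_measurable_indicator[OF that(2)]])
    have integrand: "(\<lambda>(y, u). indicator (cball (r *\<^sub>R p) (r * e)) u * indicator (- K) (y + u) :: ennreal)
        \<in> borel_measurable (lborel \<Otimes>\<^sub>M lborel)" for p
      unfolding case_prod_beta by (intro borel_measurable_times_ennreal ind) measurable
    have "(\<lambda>u. indicator (cball (r *\<^sub>R p) (r * e)) u * indicator (- K) (y + u) :: ennreal)
        \<in> borel_measurable lborel" for p y
      using measurable_Pair2[OF integrand, of y p] by simp
    note cmult = nn_integral_cmult[OF this]
    have "(\<lambda>y. miss p y) \<in> borel_measurable lborel" for p
      unfolding miss_eq by (rule lborel.borel_measurable_nn_integral[OF integrand])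
    then have miss_measurable [measurable]: "miss p \<in> borel_measurable borel" for p by simp
    have avg: "(\<integral>\<^sup>+y. miss p y * indicator K y \<partial>lborel) \<le> ennreal (v * \<eta>)" if p: "p \<in> P" for p
    proof -
      have "(\<integral>\<^sup>+y. miss p y * indicator K y \<partial>lborel) = (\<integral>\<^sup>+y. (\<integral>\<^sup>+u. indicator K y *
          (indicator (cball (r *\<^sub>R p) (r * e)) u * indicator (- K) (y + u)) \<partial>lborel) \<partial>lborel)"
        unfolding miss_eq
        by (intro nn_integral_cong, subst cmult) (rule mult.commute)
      also have "\<dots> = (\<integral>\<^sup>+u. (\<integral>\<^sup>+y. indicator K y *
          (indicator (cball (r *\<^sub>R p) (r * e)) u * indicator (- K) (y + u)) \<partial>lborel) \<partial>lborel)"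
        using borel_measurable_times_ennreal[OF ind[of fst "lborel \<Otimes>\<^sub>M lborel" K] integrand[of p]]
        by (intro lborel_pair.Fubini'[symmetric]) (simp add: case_prod_beta)
      also have "\<dots> = (\<integral>\<^sup>+u. (\<integral>\<^sup>+y. indicator (cball (r *\<^sub>R p) (r * e)) u *
          indicator {y \<in> K. y + u \<notin> K} y \<partial>lborel) \<partial>lborel)"
        by (intro nn_integral_cong) (auto simp: indicator_def)
      also have "\<dots> = (\<integral>\<^sup>+u. indicator (cball (r *\<^sub>R p) (r * e)) u *
          emeasure lborel {y \<in> K. y + u \<notin> K} \<partial>lborel)"
        by (intro nn_integral_cong) (subst nn_integral_cmult; simp)
      also have "\<dots> \<le> (\<integral>\<^sup>+u. ennreal \<eta> * indicator (cball (r *\<^sub>R p) (r * e)) u \<partial>lborel)"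
      proof (rule nn_integral_mono)
        fix u
        show "indicator (cball (r *\<^sub>R p) (r * e)) u * emeasure lborel {y \<in> K. y + u \<notin> K}
            \<le> ennreal \<eta> * indicator (cball (r *\<^sub>R p) (r * e)) u"
        proof (cases "u \<in> cball (r *\<^sub>R p) (r * e)")
          case True
          then have "norm (u - r *\<^sub>R p) \<le> r * e" by (simp add: dist_norm norm_minus_commute)
          then have "norm u \<le> norm (r *\<^sub>R p) + r * e" using norm_triangle_sub[of u "r *\<^sub>R p"] by linarith
          also have "\<dots> \<le> r * (\<bar>b\<bar> + e)"
            using r(1) b[OF p] by (auto simp: algebra_simps intro!: mult_left_mono)
          also have "\<dots> \<le> r0 * (\<bar>b\<bar> + e)" using r(2) e by (intro mult_right_mono) auto
          also have "\<dots> = t" using e by (simp add: r0_def)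
          finally show ?thesis using t(2) True by simp
        qed simp
      qed
      also have "\<dots> = ennreal (v * \<eta>)"
        using v \<eta> by (simp add: nn_integral_cmult_indicator vol ennreal_mult' mult.commute[of v])
      finally show ?thesis .
    qed
    define bad where "bad p = {y \<in> K. 1 \<le> ennreal (2 / v) * miss p y}" for p
    have bad_measurable [measurable]: "bad p \<in> sets borel" for p unfolding bad_def by measurable
    have bad: "emeasure lborel (bad p) \<le> ennreal (2 * \<eta>)" if p: "p \<in> P" for p
    proof -
      have "emeasure lborel (bad p) \<le> ennreal (2 / v) * (\<integral>\<^sup>+y. miss p y * indicator K y \<partial>lborel)"
        unfolding bad_def by (rule nn_integral_Markov_inequality) measurable
      also have "\<dots> \<le> ennreal (2 / v) * ennreal (v * \<eta>)" by (intro mult_left_mono avg p) simp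
      also have "\<dots> = ennreal (2 * \<eta>)" using v \<eta> by (simp flip: ennreal_mult)
      finally show ?thesis .
    qed
    define Y where "Y = K - (\<Union>p\<in>P. bad p)"
    have bads: "(\<Union>p\<in>P. bad p) \<in> sets lborel" using P by (intro sets.finite_UN) auto
    have Y [measurable]: "Y \<in> sets borel"
      unfolding Y_def using P by (intro sets.Diff sets.finite_UN) auto
    have "emeasure lborel (\<Union>p\<in>P. bad p) \<le> (\<Sum>p\<in>P. emeasure lborel (bad p))"
      using P by (intro emeasure_subadditive_finite) auto
    also have "\<dots> \<le> (\<Sum>p\<in>P. ennreal (2 * \<eta>))" by (intro sum_mono bad)
    also have "\<dots> = ennreal (card P * (2 * \<eta>))"
      using \<eta> by (simp add: ennreal_mult ennreal_of_nat_eq_real_of_nat)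
    also have "\<dots> \<le> ennreal (\<alpha> / 2)"
      using pos(2) by (intro ennreal_leI) (simp add: \<eta>_def field_simps)
    finally have bad_le: "emeasure lborel (\<Union>p\<in>P. bad p) \<le> ennreal (\<alpha> / 2)" .
    have "ennreal \<alpha> \<le> emeasure lborel (Y \<union> (\<Union>p\<in>P. bad p))"
      unfolding pos(1)[symmetric] using bads Y by (intro emeasure_mono sets.Un) (auto simp: Y_def)
    also have "\<dots> \<le> emeasure lborel Y + emeasure lborel (\<Union>p\<in>P. bad p)"
      using bads Y by (intro emeasure_subadditive) auto
    also have "\<dots> \<le> emeasure lborel Y + ennreal (\<alpha> / 2)" by (intro add_left_mono bad_le)
    finally have "ennreal (\<alpha> / 2) + ennreal (\<alpha> / 2) \<le> emeasure lborel Y + ennreal (\<alpha> / 2)"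
      using pos(2) by (simp flip: ennreal_plus)
    then have "ennreal (\<alpha> / 2) \<le> emeasure lborel Y"
      by (rule cancel)
    moreover have "emeasure lborel (K \<inter> cball (y + r *\<^sub>R p) (r * e)) \<ge> ennreal (v / 2)"
      if y: "y \<in> Y" and p: "p \<in> P" for y p
    proof -
      have "\<not> 1 \<le> ennreal (2 / v) * miss p y" using y p by (auto simp: Y_def bad_def)
      then have "ennreal (2 / v) * miss p y < 1" by simp
      have miss_le: "miss p y \<le> ennreal (v / 2)"
      proof (rule ccontr)
        assume "\<not> miss p y \<le> ennreal (v / 2)"
        then have "ennreal (2 / v) * ennreal (v / 2) \<le> ennreal (2 / v) * miss p y"
          by (intro mult_left_mono) auto
        then show False using \<open>ennreal (2 / v) * miss p y < 1\<close> v
          by (simp flip: ennreal_mult)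
      qed
      let ?B = "cball (r *\<^sub>R p) (r * e)"
      have m1: "{u \<in> ?B. y + u \<notin> K} \<in> sets borel" "{u. y + u \<in> K \<inter> cball (y + r *\<^sub>R p) (r * e)} \<in> sets borel"
        unfolding Int_iff mem_cball by measurable
      have "ennreal v = emeasure lborel ?B" by (rule vol[symmetric])
      also have "\<dots> \<le> emeasure lborel ({u. y + u \<in> K \<inter> cball (y + r *\<^sub>R p) (r * e)} \<union> {u \<in> ?B. y + u \<notin> K})"
        using m1 by (intro emeasure_mono sets.Un) (auto simp: dist_norm)
      also have "\<dots> \<le> emeasure lborel {u. y + u \<in> K \<inter> cball (y + r *\<^sub>R p) (r * e)} + miss p y"
        unfolding miss_def using m1 by (intro emeasure_subadditive) auto
      also have "\<dots> \<le> emeasure lborel {u. y + u \<in> K \<inter> cball (y + r *\<^sub>R p) (r * e)} + ennreal (v / 2)"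
        by (intro add_left_mono miss_le)
      also have "\<dots> = emeasure lborel (K \<inter> cball (y + r *\<^sub>R p) (r * e)) + ennreal (v / 2)"
        by (subst emeasure_lborel_translation_vimage) simp_all
      finally have "ennreal (v / 2) + ennreal (v / 2) \<le> \<dots>" using v by (simp flip: ennreal_plus)
      then show ?thesis
        by (rule cancel)
    qed
    ultimately show ?thesis using Y unfolding v_def Y_def by blast
  qed
  then show ?thesis using r0 by blast
qed

lemma compact_superlevel_set:
  fixes f :: "'a::euclidean_space \<Rightarrow> real"
  assumes f: "f \<in> borel_measurable lebesgue" and nz: "(\<integral>\<^sup>+y. ennreal (f y) \<partial>lebesgue) \<noteq> 0"
  shows "\<exists>K \<delta>. compact K \<and> emeasure lborel K > 0 \<and> \<delta> > 0 \<and> (\<forall>y\<in>K. \<delta> \<le> f y)"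
proof -
  define S where "S n = {y. 1 / real (Suc n) \<le> f y} \<inter> cball 0 (real n)" for n
  have S: "S n \<in> sets lebesgue" for n
  proof -
    have "{y \<in> space lebesgue. 1 / real (Suc n) \<le> f y} \<in> sets lebesgue" using f by measurable
    then show ?thesis unfolding S_def by (intro sets.Int) auto
  qed
  have "\<exists>n. emeasure lebesgue (S n) > 0"
  proof (rule ccontr)
    assume "\<not> ?thesis"
    then have "S n \<in> null_sets lebesgue" for n using S by (auto simp: null_sets_def)
    then have null: "(\<Union>n. S n) \<in> null_sets lebesgue" by blast
    have "y \<in> (\<Union>n. S n)" if f_pos: "f y > 0" for y
    proof -
      obtain m where m: "1 / real (Suc m) < f y" 
        using reals_Archimedean[of "f y"] f_pos unfolding inverse_eq_divide by blast
      obtain l where l: "norm y \<le> real l" using real_arch_simple by blast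
      have "1 / real (Suc (max m l)) \<le> 1 / real (Suc m)" by (simp add: frac_le)
      then have "y \<in> S (max m l)" using m l by (auto simp: S_def)
      then show ?thesis by blast
    qed
    then have "AE y in lebesgue. ennreal (f y) = 0"
      using null by (intro AE_I'[OF null]) (auto simp: ennreal_eq_0_iff not_le)
    then show False using nz nn_integral_0_iff_AE[of "\<lambda>y. ennreal (f y)" lebesgue] f by simp
  qed
  then obtain n where n: "emeasure lebesgue (S n) > 0" by blast
  have "emeasure lebesgue (S n) \<le> emeasure lebesgue (cball 0 (real n) :: 'a set)"
    by (intro emeasure_mono) (auto simp: S_def)
  also have "\<dots> = emeasure lborel (cball 0 (real n) :: 'a set)" by simp
  also have "\<dots> < \<infinity>" using emeasure_compact_finite[of "cball (0::'a) (real n)"] by simp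
  finally have fin: "emeasure lebesgue (S n) < \<infinity>" .
  define m where "m = enn2real (emeasure lebesgue (S n))"
  have m: "emeasure lebesgue (S n) = ennreal m" "m > 0"
    using n fin by (auto simp: m_def enn2real_positive_iff)
  obtain T where T: "closed T" "T \<subseteq> S n" "S n - T \<in> lmeasurable" "emeasure lebesgue (S n - T) < ennreal m"
    using sets_lebesgue_inner_closed[OF S m(2)] by blast
  have "compact T"
    using T(1,2) bounded_subset[OF bounded_cball] by (auto simp: compact_eq_bounded_closed S_def)
  moreover have "emeasure lborel T \<noteq> 0"
  proof
    assume "emeasure lborel T = 0"
    then have "T \<in> null_sets lebesgue" using T(1) by (simp add: null_sets_def)
    then have "emeasure lebesgue (S n - T) = emeasure lebesgue (S n)"
      using S by (simp add: emeasure_Diff_null_set)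
    then show False using T(4) m by simp
  qed
  moreover have "1 / real (Suc n) \<le> f y" if "y \<in> T" for y using T(2) that by (auto simp: S_def)
  ultimately show ?thesis
    by (intro exI[of _ T] exI[of _ "1 / real (Suc n)"]) (auto simp: zero_less_iff_neq_zero)
qed

text \<open>
  The law \<open>D\<close> dominates a multiple of Lebesgue measure on a compact set \<open>K\<close> of positive measure, so
  the bound reduces to the proportion of the balls that is filled by \<open>K\<close>.
\<close>

lemma density_local_lower_bound:
  fixes f :: "'a::euclidean_space \<Rightarrow> real"
  assumes f: "f \<in> borel_measurable lebesgue" "(\<integral>\<^sup>+y. ennreal (f y) \<partial>lebesgue) \<noteq> 0"
    and D: "\<And>A. A \<in> sets borel \<Longrightarrow> emeasure D A = (\<integral>\<^sup>+y\<in>A. ennreal (f y) \<partial>lebesgue)"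
    and P: "finite P" and e: "e > 0"
  obtains \<alpha> \<beta> r0 where "\<alpha> > 0" "\<beta> > 0" "r0 > 0"
    and "\<And>r. 0 < r \<Longrightarrow> r \<le> r0 \<Longrightarrow> \<exists>Y\<in>sets borel. emeasure D Y \<ge> ennreal \<alpha> \<and>
      (\<forall>y\<in>Y. \<forall>p\<in>P. emeasure D (cball (y + r *\<^sub>R p) (r * e)) \<ge> ennreal (\<beta> * r ^ DIM('a)))"
proof -
  obtain K \<delta> where K: "compact K" "emeasure lborel K > 0" and \<delta>: "\<delta> > 0" "\<And>y. y \<in> K \<Longrightarrow> \<delta> \<le> f y"
    using compact_superlevel_set[OF f] by blast
  have K_borel: "K \<in> sets borel" using K(1) by (simp add: borel_compact)
  define m where "m = enn2real (emeasure lborel K)"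
  have m: "emeasure lborel K = ennreal m" "m > 0"
    using K emeasure_compact_finite[OF K(1)] by (auto simp: m_def enn2real_positive_iff)
  have lower: "ennreal \<delta> * emeasure lborel (K \<inter> A) \<le> emeasure D A" if A: "A \<in> sets borel" for A
  proof -
    have "ennreal \<delta> * emeasure lborel (K \<inter> A) = ennreal \<delta> * emeasure lebesgue (K \<inter> A)"
      using A K_borel by simp
    also have "\<dots> = (\<integral>\<^sup>+y. ennreal \<delta> * indicator (K \<inter> A) y \<partial>lebesgue)"
      using A K_borel by (intro nn_integral_cmult_indicator[symmetric]) auto
    also have "\<dots> \<le> (\<integral>\<^sup>+y\<in>A. ennreal (f y) \<partial>lebesgue)"
      by (intro nn_integral_mono) (auto simp: indicator_def \<delta>(2) ennreal_leI)
    finally show ?thesis using D[OF A] by simp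
  qed
  obtain r0 where r0: "r0 > 0" and Y: "\<And>r. 0 < r \<Longrightarrow> r \<le> r0 \<Longrightarrow>
    (\<exists>Y\<in>sets borel. Y \<subseteq> K \<and> emeasure lborel Y \<ge> ennreal (m / 2) \<and>
      (\<forall>y\<in>Y. \<forall>p\<in>P. emeasure lborel (K \<inter> cball (y + r *\<^sub>R p) (r * e)) \<ge>
        ennreal (unit_ball_vol (DIM('a)) * (r * e) ^ DIM('a) / 2)))"
    using uniform_translates_dense[OF K(1) P e m] by blast
  define \<beta> where "\<beta> = \<delta> * unit_ball_vol (DIM('a)) * e ^ DIM('a) / 2"
  have "\<exists>Y\<in>sets borel. emeasure D Y \<ge> ennreal (\<delta> * (m / 2)) \<and>
      (\<forall>y\<in>Y. \<forall>p\<in>P. emeasure D (cball (y + r *\<^sub>R p) (r * e)) \<ge> ennreal (\<beta> * r ^ DIM('a)))"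
    if r: "0 < r" "r \<le> r0" for r :: real
  proof -
    obtain Y where Y: "Y \<in> sets borel" "Y \<subseteq> K" "emeasure lborel Y \<ge> ennreal (m / 2)"
      and ball: "\<And>y p. y \<in> Y \<Longrightarrow> p \<in> P \<Longrightarrow> emeasure lborel (K \<inter> cball (y + r *\<^sub>R p) (r * e)) \<ge>
        ennreal (unit_ball_vol (DIM('a)) * (r * e) ^ DIM('a) / 2)"
      using Y[OF r] by blast
    have "ennreal (\<delta> * (m / 2)) = ennreal \<delta> * ennreal (m / 2)" using \<delta>(1) m by (intro ennreal_mult) auto
    also have "\<dots> \<le> ennreal \<delta> * emeasure lborel (K \<inter> Y)"
      using Y(2,3) by (intro mult_left_mono) (auto simp: Int_absorb1)
    also have "\<dots> \<le> emeasure D Y" by (rule lower[OF Y(1)])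
    finally have "emeasure D Y \<ge> ennreal (\<delta> * (m / 2))" .
    moreover have "emeasure D (cball (y + r *\<^sub>R p) (r * e)) \<ge> ennreal (\<beta> * r ^ DIM('a))"
      if "y \<in> Y" "p \<in> P" for y p
    proof -
      have "ennreal (\<beta> * r ^ DIM('a)) = ennreal \<delta> * ennreal (unit_ball_vol (DIM('a)) * (r * e) ^ DIM('a) / 2)"
        using \<delta>(1) r(1) e by (subst ennreal_mult[symmetric]) (auto simp: \<beta>_def power_mult_distrib)
      also have "\<dots> \<le> ennreal \<delta> * emeasure lborel (K \<inter> cball (y + r *\<^sub>R p) (r * e))"
        by (intro mult_left_mono ball that) simp
      also have "\<dots> \<le> emeasure D (cball (y + r *\<^sub>R p) (r * e))" by (rule lower) simp
      finally show ?thesis .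
    qed
    ultimately show ?thesis using Y(1) by blast
  qed
  moreover have "\<delta> * (m / 2) > 0" "\<beta> > 0" using \<delta>(1) m(2) e by (auto simp: \<beta>_def)
  ultimately show ?thesis using r0 that[of "\<delta> * (m / 2)" \<beta> r0] by blast
qed

lemma bounded_density_ball_upper_bound:
  fixes f :: "'a::euclidean_space \<Rightarrow> real"
  assumes D: "\<And>A. A \<in> sets borel \<Longrightarrow> emeasure D A = (\<integral>\<^sup>+y\<in>A. ennreal (f y) \<partial>lebesgue)"
    and B: "\<And>y. f y \<le> B" "B \<ge> 0" and \<rho>: "\<rho> \<ge> 0"
  shows "emeasure D (cball y \<rho>) \<le> ennreal (B * unit_ball_vol (DIM('a)) * \<rho> ^ DIM('a))"
proof -
  have "emeasure D (cball y \<rho>) \<le> (\<integral>\<^sup>+z. ennreal B * indicator (cball y \<rho>) z \<partial>lebesgue)"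
    by (subst D) (auto intro!: nn_integral_mono simp: indicator_def B ennreal_leI)
  also have "\<dots> = ennreal B * emeasure lborel (cball y \<rho>)"
    by (subst nn_integral_cmult_indicator) auto
  also have "\<dots> = ennreal (B * unit_ball_vol (DIM('a)) * \<rho> ^ DIM('a))"
    using B(2) \<rho> by (simp add: emeasure_cball ennreal_mult mult.assoc)
  finally show ?thesis .
qed

section \<open>Counting configurations\<close>

context prob_space
begin

text \<open>
  By Chebyshev's inequality: pairs outside \<open>R\<close> are not positively correlated, so only the pairs in \<open>R\<close>
  contribute to the bound on the variance of the number of events that occur.
\<close>

lemma second_moment_count:
  fixes A :: "'i \<Rightarrow> 'a set"
  assumes F: "finite F" and A: "\<And>i. i \<in> F \<Longrightarrow> A i \<in> events"
    and R: "R \<subseteq> F \<times> F" "\<And>i j. i \<in> F \<Longrightarrow> j \<in> F \<Longrightarrow> (i, j) \<notin> R \<Longrightarrow> prob (A i \<inter> A j) \<le> prob (A i) * prob (A j)"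
    and \<mu>: "\<mu> = (\<Sum>i\<in>F. prob (A i))" "\<mu> > 0"
  shows "prob {w \<in> space M. (\<Sum>i\<in>F. indicator (A i) w) \<le> \<mu> / 2} \<le> 4 * (\<Sum>(i, j)\<in>R. prob (A i \<inter> A j)) / \<mu>\<^sup>2"
proof -
  define X where "X w = (\<Sum>i\<in>F. indicator (A i) w :: real)" for w
  have int_ind: "integrable M (indicator (A i) :: 'a \<Rightarrow> real)" if "i \<in> F" for i
    using A[OF that] by (intro integrable_real_indicator) (auto simp: emeasure_eq_measure)
  have EX: "expectation X = \<mu>"
    unfolding X_def \<mu>(1) using A by (subst Bochner_Integration.integral_sum) (auto intro!: int_ind)
  have X2: "(X w)\<^sup>2 = (\<Sum>(i, j)\<in>F \<times> F. indicator (A i \<inter> A j) w)" for w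
    by (simp add: X_def power2_eq_square sum_product sum.cartesian_product indicator_inter_arith)
  have int_X: "integrable M X" unfolding X_def by (intro Bochner_Integration.integrable_sum int_ind)
  have int_ind2: "integrable M (indicator (A i \<inter> A j) :: 'a \<Rightarrow> real)" if "i \<in> F" "j \<in> F" for i j
    using A that by (intro integrable_real_indicator) (auto simp: emeasure_eq_measure)
  have int_X2: "integrable M (\<lambda>w. (X w)\<^sup>2)"
    unfolding X2 by (intro Bochner_Integration.integrable_sum) (auto intro: int_ind2)
  have "expectation (\<lambda>w. (X w)\<^sup>2) = (\<Sum>(i, j)\<in>F \<times> F. prob (A i \<inter> A j))"
    unfolding X2 using A
    by (subst Bochner_Integration.integral_sum) (auto intro!: int_ind2 sum.cong simp: sets.Int)
  also have "\<dots> = (\<Sum>(i, j)\<in>F \<times> F - R. prob (A i \<inter> A j)) + (\<Sum>(i, j)\<in>R. prob (A i \<inter> A j))"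
    using F R(1) by (intro sum.subset_diff) auto
  also have "(\<Sum>(i, j)\<in>F \<times> F - R. prob (A i \<inter> A j)) \<le> (\<Sum>(i, j)\<in>F \<times> F - R. prob (A i) * prob (A j))"
    using R(2) by (intro sum_mono) auto
  also have "\<dots> \<le> (\<Sum>(i, j)\<in>F \<times> F. prob (A i) * prob (A j))"
    using F by (intro sum_mono2) auto
  also have "\<dots> = \<mu>\<^sup>2"
    by (simp add: \<mu>(1) power2_eq_square sum_product sum.cartesian_product)
  finally have var: "variance X \<le> (\<Sum>(i, j)\<in>R. prob (A i \<inter> A j))"
    using variance_eq[OF int_X int_X2] unfolding EX by linarith
  have X_meas [measurable]: "X \<in> borel_measurable M" using int_X by simp
  have "prob {w \<in> space M. X w \<le> \<mu> / 2} \<le> prob {w \<in> space M. \<mu> / 2 \<le> \<bar>X w - expectation X\<bar>}"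
    by (intro finite_measure_mono Collect_mono) (auto simp: EX abs_real_def)
  also have "\<dots> \<le> variance X / (\<mu> / 2)\<^sup>2"
    using int_X2 \<mu>(2) by (intro Chebyshev_inequality) auto
  also have "\<dots> \<le> (\<Sum>(i, j)\<in>R. prob (A i \<inter> A j)) / (\<mu> / 2)\<^sup>2"
    by (intro divide_right_mono var) simp
  finally show ?thesis by (simp add: X_def power_divide mult.commute)
qed

text \<open>
  If no \<open>A i\<close> occurs without \<open>B i\<close>, then at most as many of the \<open>A i\<close> occur as of the \<open>B i\<close>. But
  usually more than half the expected number of the \<open>A i\<close> occur, and by Markov's inequality
  usually fewer of the \<open>B i\<close>.
\<close>

lemma prob_exists_unspoiled:
  fixes A B :: "'i \<Rightarrow> 'a set"
  assumes F: "finite F" and A: "\<And>i. i \<in> F \<Longrightarrow> A i \<in> events"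
    and R: "R \<subseteq> F \<times> F" "\<And>i j. i \<in> F \<Longrightarrow> j \<in> F \<Longrightarrow> (i, j) \<notin> R \<Longrightarrow> prob (A i \<inter> A j) \<le> prob (A i) * prob (A j)"
    and \<mu>: "\<mu> \<le> (\<Sum>i\<in>F. prob (A i))" "\<mu> > 0"
    and \<Delta>: "(\<Sum>(i, j)\<in>R. prob (A i \<inter> A j)) \<le> \<Delta>"
    and B: "\<And>i. i \<in> F \<Longrightarrow> B i \<in> events" "(\<Sum>i\<in>F. prob (B i)) \<le> b"
  shows "prob (\<Union>i\<in>F. A i - B i) \<ge> 1 - 4 * \<Delta> / \<mu>\<^sup>2 - 2 * b / \<mu>"
proof -
  define X Z where "X w = (\<Sum>i\<in>F. indicator (A i) w :: real)"
    and "Z w = (\<Sum>i\<in>F. indicator (B i) w :: real)" for w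
  define \<nu> where "\<nu> = (\<Sum>i\<in>F. prob (A i))"
  have \<nu>: "\<nu> > 0" "\<mu> \<le> \<nu>" using \<mu> by (auto simp: \<nu>_def)
  let ?S = "\<Sum>(i, j)\<in>R. prob (A i \<inter> A j)"
  have S: "0 \<le> ?S" by (intro sum_nonneg) auto
  have X_meas [measurable]: "X \<in> borel_measurable M"
    unfolding X_def using A by (intro borel_measurable_sum borel_measurable_indicator)
  have int_ind: "integrable M (indicator (B i) :: 'a \<Rightarrow> real)" if "i \<in> F" for i
    using B(1)[OF that] by (intro integrable_real_indicator) (auto simp: emeasure_eq_measure)
  have int_Z: "integrable M Z" unfolding Z_def by (intro Bochner_Integration.integrable_sum int_ind)
  then have Z_meas [measurable]: "Z \<in> borel_measurable M" by simp
  have Z_nonneg: "0 \<le> Z w" for w unfolding Z_def by (intro sum_nonneg) auto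
  have EZ: "expectation Z = (\<Sum>i\<in>F. prob (B i))"
    unfolding Z_def using B(1) by (subst Bochner_Integration.integral_sum) (auto intro!: int_ind)
  have "prob {w \<in> space M. X w \<le> \<nu> / 2} \<le> 4 * ?S / \<nu>\<^sup>2"
    unfolding X_def by (rule second_moment_count[OF F A R \<nu>_def \<nu>(1)])
  also have "\<dots> \<le> 4 * \<Delta> / \<mu>\<^sup>2"
    using \<Delta> S \<mu>(2) \<nu>(2) by (intro frac_le power_mono) auto
  finally have PX: "prob {w \<in> space M. X w \<le> \<nu> / 2} \<le> 4 * \<Delta> / \<mu>\<^sup>2" .
  have "prob {w \<in> space M. \<nu> / 2 \<le> Z w} \<le> expectation Z / (\<nu> / 2)"
    using int_Z \<nu>(1) Z_nonneg by (intro integral_Markov_inequality_measure[where A = "{}"]) auto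
  also have "\<dots> \<le> b / (\<mu> / 2)"
    using B(2) \<mu>(2) \<nu>(2) unfolding EZ by (intro frac_le) (auto intro!: sum_nonneg order.trans[OF _ B(2)])
  finally have PZ: "prob {w \<in> space M. \<nu> / 2 \<le> Z w} \<le> 2 * b / \<mu>" by (simp add: mult.commute)
  let ?G = "\<Union>i\<in>F. A i - B i"
  have G: "?G \<in> events" using F A B(1) by (intro sets.finite_UN sets.Diff) auto
  have "space M - ?G \<subseteq> {w \<in> space M. X w \<le> \<nu> / 2} \<union> {w \<in> space M. \<nu> / 2 \<le> Z w}"
  proof
    fix w assume w: "w \<in> space M - ?G"
    then have "X w \<le> Z w" unfolding X_def Z_def by (intro sum_mono) (auto simp: indicator_def)
    then show "w \<in> {w \<in> space M. X w \<le> \<nu> / 2} \<union> {w \<in> space M. \<nu> / 2 \<le> Z w}" using w by auto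
  qed
  then have "prob (space M - ?G) \<le> prob ({w \<in> space M. X w \<le> \<nu> / 2} \<union> {w \<in> space M. \<nu> / 2 \<le> Z w})"
    by (intro finite_measure_mono) measurable
  also have "\<dots> \<le> prob {w \<in> space M. X w \<le> \<nu> / 2} + prob {w \<in> space M. \<nu> / 2 \<le> Z w}"
    by (intro measure_Un_le) measurable
  also have "\<dots> \<le> 4 * \<Delta> / \<mu>\<^sup>2 + 2 * b / \<mu>" using PX PZ by linarith
  finally show ?thesis using prob_compl[OF G] by simp
qed

end

context iid_sample
begin

text \<open>
  A ball that contains \<open>N\<close> sample points and is centred at one of them yields an index \<open>c\<close> and \<open>N - 1\<close>
  further indices of points within \<open>\<rho>\<close> of \<open>x c\<close>. There are at most \<open>card I ^ N\<close> such choices, each of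
  probability at most \<open>q ^ (N - 1)\<close>.
\<close>

lemma prob_crowded_le:
  assumes I: "finite I" "I \<subseteq> J" and N: "N > 0"
    and q: "q \<ge> 0" "\<And>y. emeasure D (cball y \<rho>) \<le> ennreal q"
  shows "\<exists>B\<in>events. prob B \<le> real (card I) ^ N * q ^ (N - 1) \<and>
    (\<forall>w\<in>space M - B. \<forall>v\<in>(\<lambda>i. x i w) ` I. card ((\<lambda>i. x i w) ` I \<inter> cball v \<rho>) < N)"
proof -
  let ?\<L> = "\<lambda>c. {L. L \<subseteq> I - {c} \<and> card L = N - 1}"
  define B where "B = (\<Union>c\<in>I. \<Union>L\<in>?\<L> c. star c L (\<lambda>_. 0) \<rho>)"
  have fin: "finite (?\<L> c)" for c by (rule finite_subset[of _ "Pow I"]) (use I in auto)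
  have star_ev: "star c L (\<lambda>_. 0) \<rho> \<in> events" if "c \<in> I" "L \<in> ?\<L> c" for c L
    using that I by (intro star_measurable) (auto intro: finite_subset)
  have B: "B \<in> events" unfolding B_def using I(1) fin star_ev by (intro sets.finite_UN) auto
  have "prob B \<le> (\<Sum>c\<in>I. prob (\<Union>L\<in>?\<L> c. star c L (\<lambda>_. 0) \<rho>))"
    unfolding B_def using I(1) fin star_ev
    by (intro finite_measure_subadditive_finite) (auto intro!: sets.finite_UN)
  also have "\<dots> \<le> (\<Sum>c\<in>I. \<Sum>L\<in>?\<L> c. prob (star c L (\<lambda>_. 0) \<rho>))"
    using fin star_ev by (intro sum_mono finite_measure_subadditive_finite) auto
  also have "\<dots> \<le> (\<Sum>c\<in>I. \<Sum>L\<in>?\<L> c. q ^ (N - 1))"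
  proof (intro sum_mono)
    fix c L assume "c \<in> I" "L \<in> ?\<L> c"
    then show "prob (star c L (\<lambda>_. 0) \<rho>) \<le> q ^ (N - 1)"
      using prob_star_le[of L c q \<rho> "\<lambda>_. 0"] q I by (auto intro: finite_subset)
  qed
  also have "\<dots> \<le> (\<Sum>c\<in>I. real (card I) ^ (N - 1) * q ^ (N - 1))"
  proof (intro sum_mono)
    fix c assume "c \<in> I"
    have "card (?\<L> c) = (card (I - {c}) choose (N - 1))" using I(1) by (intro n_subsets) auto
    also have "\<dots> \<le> card (I - {c}) ^ (N - 1)"
      by (cases "N - 1 \<le> card (I - {c})") (auto intro: binomial_le_pow simp: binomial_eq_0)
    also have "\<dots> \<le> card I ^ (N - 1)" using I(1) by (intro power_mono card_mono) auto
    finally have "real (card (?\<L> c)) \<le> real (card I) ^ (N - 1)" by (simp flip: of_nat_power)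
    then show "(\<Sum>L\<in>?\<L> c. q ^ (N - 1)) \<le> real (card I) ^ (N - 1) * q ^ (N - 1)"
      using q(1) by (auto intro: mult_right_mono)
  qed
  also have "\<dots> = real (card I) ^ N * q ^ (N - 1)"
    using N by (cases N) auto
  finally have PB: "prob B \<le> real (card I) ^ N * q ^ (N - 1)" .
  have "card ((\<lambda>i. x i w) ` I \<inter> cball v \<rho>) < N"
    if w: "w \<in> space M - B" and v: "v \<in> (\<lambda>i. x i w) ` I" for w v
  proof (rule ccontr)
    let ?V = "(\<lambda>i. x i w) ` I"
    assume "\<not> card (?V \<inter> cball v \<rho>) < N"
    then have "N - 1 \<le> card (?V \<inter> cball v \<rho> - {v})"
      using card_Diff1_le[of "?V \<inter> cball v \<rho>" v] diff_card_le_card_Diff[of "{v}" "?V \<inter> cball v \<rho>"]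
      by (simp add: card_Diff_singleton_if split: if_splits)
    then obtain T where T: "T \<subseteq> ?V \<inter> cball v \<rho> - {v}" "card T = N - 1"
      using obtain_subset_with_card_n by metis
    then have "T \<subseteq> ?V" by blast
    then obtain L where L: "L \<subseteq> I" "inj_on (\<lambda>i. x i w) L" "T = (\<lambda>i. x i w) ` L"
      using subset_image_inj[of T "\<lambda>i. x i w" I] by blast
    obtain c where c: "c \<in> I" "v = x c w" using v by blast
    have "L \<in> ?\<L> c" using L T c by (auto simp: card_image)
    moreover have "w \<in> star c L (\<lambda>_. 0) \<rho>" using w T L c by (auto simp: star_def)
    ultimately show False using w c(1) by (auto simp: B_def)
  qed
  then show ?thesis using B PB by blast
qed

text \<open>
  The shape \<open>p\<close> is sought among the sample points at scale \<open>r\<close>, up to an error \<open>r e\<close> in each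
  position. Each label draws its index from its own block of \<open>m\<close> indices, so the candidates are
  the functions from \<open>\<Lambda>\<close> to \<open>{..<m}\<close>. They involve distinct indices automatically, and two
  candidates share an index only by agreeing at a label, which makes all sums over candidates factor
  over the labels. Points of two copies with a common index are within \<open>4 r\<close> of the point with
  that index, because each copy has radius at most \<open>2 r\<close> about its base point.
\<close>

lemma prob_isolated_configuration_ge:
  fixes \<Lambda> :: "'l set" and p :: "'l \<Rightarrow> 'a"
  assumes I: "finite I" "I \<subseteq> J"
    and \<Lambda>: "finite \<Lambda>" "l0 \<in> \<Lambda>" and m: "m > 0" "m * card \<Lambda> \<le> card I"
    and p: "p l0 = 0" "\<And>l. l \<in> \<Lambda> \<Longrightarrow> norm (p l) + e \<le> 2" and e: "e > 0" and r: "r > 0"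
    and q: "q \<ge> 0" "\<And>y. emeasure D (cball y (4 * r)) \<le> ennreal q" "real m * q \<le> 1"
    and Y: "Y \<in> sets borel" "emeasure D Y \<ge> ennreal \<alpha>" "\<alpha> > 0" "\<beta> > 0"
    and ball: "\<And>y l. y \<in> Y \<Longrightarrow> l \<in> \<Lambda> \<Longrightarrow> emeasure D (cball (y + r *\<^sub>R p l) (r * e)) \<ge> ennreal \<beta>"
  defines "N \<equiv> card \<Lambda>" defines "a \<equiv> \<alpha> * \<beta> ^ (N - 1)"
  shows "\<exists>G\<in>events. prob G \<ge> 1 - 4 * 2 ^ N * q ^ (N - 1) / (real m ^ N * a\<^sup>2) - 2 * real (card I) * q ^ N / a \<and>
    (\<forall>w\<in>G. \<exists>h. h ` \<Lambda> \<subseteq> I \<and> (\<forall>l\<in>\<Lambda>. x (h l) w \<in> cball (x (h l0) w + r *\<^sub>R p l) (r * e)) \<and>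
      (\<forall>j\<in>I - h ` \<Lambda>. dist (x j w) (x (h l0) w) > 2 * r))"
proof -
  have N: "N > 0" using \<Lambda> by (auto simp: N_def card_gt_0_iff)
  have a: "a > 0" using Y by (simp add: a_def)
  have "card (\<Lambda> \<times> {..<m}) \<le> card I" using m by (simp add: card_cartesian_product mult.commute)
  then obtain idx where idx: "idx ` (\<Lambda> \<times> {..<m}) \<subseteq> I" "inj_on idx (\<Lambda> \<times> {..<m})"
    using card_le_inj[of "\<Lambda> \<times> {..<m}" I] I(1) \<Lambda>(1) by auto
  define lab where "lab i = fst (inv_into (\<Lambda> \<times> {..<m}) idx i)" for i
  have lab: "lab (idx (l, t)) = l" if "l \<in> \<Lambda>" "t < m" for l t
    using that by (simp add: lab_def inv_into_f_f[OF idx(2)])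
  define F where "F = (\<Lambda> \<rightarrow>\<^sub>E {..<m})"
  have F: "finite F" unfolding F_def using \<Lambda>(1) by (intro finite_PiE) auto
  have card_F: "card F = m ^ N" unfolding F_def N_def using \<Lambda>(1) by (simp add: card_PiE)
  have Fm: "g l < m" if "g \<in> F" "l \<in> \<Lambda>" for g l using that unfolding F_def by auto
  define h where "h g l = idx (l, g l)" for g l
  have h_I: "h g ` \<Lambda> \<subseteq> I" if "g \<in> F" for g
    using idx(1) Fm[OF that] by (auto simp: h_def)
  have h_eq: "h g l = h g' l' \<longleftrightarrow> l = l' \<and> g l = g' l'"
    if "g \<in> F" "g' \<in> F" "l \<in> \<Lambda>" "l' \<in> \<Lambda>" for g g' l l'
    using inj_on_eq_iff[OF idx(2), of "(l, g l)" "(l', g' l')"] that Fm by (auto simp: h_def)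
  have h_inj: "inj_on (h g) \<Lambda>" if "g \<in> F" for g using h_eq[OF that that] by (auto intro: inj_onI)
  define tip where "tip g = h g ` (\<Lambda> - {l0})" for g
  have tip: "finite (tip g)" "insert (h g l0) (tip g) = h g ` \<Lambda>" "h g l0 \<notin> tip g" "card (tip g) = N - 1"
    if "g \<in> F" for g
    using \<Lambda> h_eq[OF that that] card_image[OF inj_on_subset[OF h_inj[OF that]], of "\<Lambda> - {l0}"]
    by (auto simp: tip_def N_def)
  \<comment> \<open>the points with the indices \<open>h g l\<close> form a copy of the shape\<close>
  define A where "A g = star (h g l0) (tip g) (\<lambda>i. r *\<^sub>R p (lab i)) (r * e)" for g
  have J: "insert (h g l0) (tip g) \<subseteq> J" if "g \<in> F" for g
    using tip(2)[OF that] h_I[OF that] I(2) by auto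
  have A: "A g \<in> events" if "g \<in> F" for g
    unfolding A_def using tip(1) J that by (intro star_measurable) auto
  have A_mem: "x (h g l) w \<in> cball (x (h g l0) w + r *\<^sub>R p l) (r * e)"
    if "g \<in> F" "w \<in> A g" "l \<in> \<Lambda>" for g w l
  proof (cases "l = l0")
    case False
    then have "h g l \<in> tip g" using that(3) by (simp add: tip_def)
    then have "x (h g l) w \<in> cball (x (h g l0) w + r *\<^sub>R p (lab (h g l))) (r * e)"
      using that(2) unfolding A_def star_def by blast
    then show ?thesis unfolding h_def lab[OF that(3) Fm[OF that(1,3)]] .
  qed (use p(1) e r in simp)
  have A_near: "dist (x (h g l) w) (x (h g l0) w) \<le> 2 * r" if "g \<in> F" "w \<in> A g" "l \<in> \<Lambda>" for g w l
  proof -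
    have "dist (x (h g l0) w) (x (h g l) w) \<le> dist (x (h g l0) w) (x (h g l0) w + r *\<^sub>R p l)
        + dist (x (h g l0) w + r *\<^sub>R p l) (x (h g l) w)" by (rule dist_triangle)
    also have "\<dots> \<le> r * norm (p l) + r * e"
      using A_mem[OF that] r by (simp add: dist_norm)
    also have "\<dots> = r * (norm (p l) + e)" by (simp add: algebra_simps)
    also have "\<dots> \<le> r * 2" using p(2)[OF that(3)] r by (intro mult_left_mono) auto
    finally show ?thesis by (simp add: dist_commute mult.commute)
  qed
  have PA: "prob (A g) \<ge> a" if "g \<in> F" for g
    unfolding A_def a_def tip(4)[OF that, symmetric]
  proof (rule prob_star_ge[OF tip(1)[OF that] J[OF that] tip(3)[OF that] Y(1,2)])
    fix y i assume "y \<in> Y" "i \<in> tip g"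
    then show "emeasure D (cball (y + r *\<^sub>R p (lab i)) (r * e)) \<ge> ennreal \<beta>"
      using ball[of y "lab i"] lab Fm[OF that] by (auto simp: tip_def h_def)
  qed (use Y in auto)
  define R where "R = {(g, g') \<in> F \<times> F. h g ` \<Lambda> \<inter> h g' ` \<Lambda> \<noteq> {}}"
  have indep_A: "prob (A g \<inter> A g') \<le> prob (A g) * prob (A g')"
    if "g \<in> F" "g' \<in> F" "(g, g') \<notin> R" for g g'
  proof -
    have "insert (h g l0) (tip g) \<inter> insert (h g' l0) (tip g') = {}"
      using that by (simp add: R_def tip(2))
    then show ?thesis
      unfolding A_def using indep_star[OF tip(1) J tip(1) J] that by simp
  qed
  have overlap: "prob (A g \<inter> A g') \<le> q ^ (N - 1) * (\<Prod>l\<in>\<Lambda>. if g' l = g l then 1 else q)"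
    if gg': "(g, g') \<in> R" for g g'
  proof -
    have g: "g \<in> F" "g' \<in> F" using gg' by (auto simp: R_def)
    obtain c where c: "c \<in> h g ` \<Lambda>" "c \<in> h g' ` \<Lambda>" using gg' by (auto simp: R_def)
    \<comment> \<open>written as a disjoint union, to count the indices that are used by one of the two copies\<close>
    define U where "U = h g ` \<Lambda> \<union> h g' ` {l \<in> \<Lambda>. g' l \<noteq> g l}"
    have U_eq: "U = h g ` \<Lambda> \<union> h g' ` \<Lambda>"
      unfolding U_def using h_eq[OF g] by (auto simp: image_iff) metis
    have finU: "finite U" using \<Lambda>(1) by (simp add: U_def)
    have "h g ` \<Lambda> \<inter> h g' ` {l \<in> \<Lambda>. g' l \<noteq> g l} = {}" using h_eq[OF g] by auto
    then have "card U = N + card {l \<in> \<Lambda>. g' l \<noteq> g l}"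
      unfolding U_def using \<Lambda>(1) h_inj[OF g(1)] inj_on_subset[OF h_inj[OF g(2)], of "{l \<in> \<Lambda>. g' l \<noteq> g l}"]
      by (subst card_Un_disjoint) (auto simp: card_image N_def)
    then have cardU: "card (U - {c}) = (N - 1) + card {l \<in> \<Lambda>. g' l \<noteq> g l}"
      using c(1) N finU by (simp add: card_Diff_singleton_if U_def)
    have "A g \<inter> A g' \<subseteq> star c (U - {c}) (\<lambda>_. 0) (4 * r)"
    proof
      fix w assume w: "w \<in> A g \<inter> A g'"
      obtain l l' where l: "l \<in> \<Lambda>" "c = h g l" "l' \<in> \<Lambda>" "c = h g' l'" using c by blast
      have "dist (x c w) (x u w) \<le> 4 * r" if "u \<in> U" for u
      proof -
        from that consider k where "k \<in> \<Lambda>" "u = h g k" | k where "k \<in> \<Lambda>" "u = h g' k"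
          unfolding U_eq by blast
        then show ?thesis
        proof cases
          case 1
          then show ?thesis using A_near[OF g(1), of w l] A_near[OF g(1), of w k] w l
            dist_triangle2[of "x c w" "x u w" "x (h g l0) w"] by auto
        next
          case 2
          then show ?thesis using A_near[OF g(2), of w l'] A_near[OF g(2), of w k] w l
            dist_triangle2[of "x c w" "x u w" "x (h g' l0) w"] by auto
        qed
      qed
      then show "w \<in> star c (U - {c}) (\<lambda>_. 0) (4 * r)"
        using w by (auto simp: star_def A_def)
    qed
    moreover have UJ: "insert c (U - {c}) \<subseteq> J" unfolding U_eq using c h_I g I(2) by blast
    ultimately have "prob (A g \<inter> A g') \<le> prob (star c (U - {c}) (\<lambda>_. 0) (4 * r))"
      using finU by (intro finite_measure_mono star_measurable) auto
    also have "\<dots> \<le> q ^ card (U - {c})"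
      by (rule prob_star_le) (use finU UJ q in auto)
    also have "\<dots> = q ^ (N - 1) * (\<Prod>l\<in>\<Lambda>. if g' l = g l then 1 else q)"
    proof -
      have "\<Lambda> \<inter> - {l. g' l = g l} = {l \<in> \<Lambda>. g' l \<noteq> g l}" by blast
      then show ?thesis using \<Lambda>(1) by (simp add: cardU power_add prod.If_cases)
    qed
    finally show ?thesis .
  qed
  have sum_R: "(\<Sum>(g, g')\<in>R. prob (A g \<inter> A g')) \<le> real m ^ N * (q ^ (N - 1) * 2 ^ N)"
  proof -
    let ?w = "\<lambda>g g'. q ^ (N - 1) * (\<Prod>l\<in>\<Lambda>. if g' l = g l then 1 else q)"
    have w_nonneg: "?w g g' \<ge> 0" for g g' using q(1) by (intro mult_nonneg_nonneg prod_nonneg) auto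
    have "(\<Sum>(g, g')\<in>R. prob (A g \<inter> A g')) \<le> (\<Sum>(g, g')\<in>R. ?w g g')"
      using overlap by (intro sum_mono) auto
    also have "\<dots> \<le> (\<Sum>(g, g')\<in>F \<times> F. ?w g g')"
      using F w_nonneg by (intro sum_mono2) (auto simp: R_def)
    also have "\<dots> = (\<Sum>g\<in>F. \<Sum>g'\<in>F. ?w g g')" by (simp add: sum.cartesian_product)
    also have "\<dots> \<le> (\<Sum>g\<in>F. q ^ (N - 1) * 2 ^ N)"
    proof (rule sum_mono)
      fix g assume g: "g \<in> F"
      \<comment> \<open>each label contributes one agreement and \<open>m - 1\<close> disagreements, together at most \<open>1 + m q \<le> 2\<close>\<close>
      have "(\<Sum>g'\<in>F. \<Prod>l\<in>\<Lambda>. if g' l = g l then 1 else q) = (\<Prod>l\<in>\<Lambda>. \<Sum>t<m. if t = g l then 1 else q)"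
        unfolding F_def using \<Lambda>(1) by (subst prod_sum_PiE) auto
      also have "\<dots> \<le> (\<Prod>l\<in>\<Lambda>. 2)"
      proof (rule prod_mono)
        fix l assume l: "l \<in> \<Lambda>"
        have "(\<Sum>t<m. if t = g l then 1 else q) \<le> (\<Sum>t<m. (if t = g l then 1 else 0) + q)"
          using q(1) by (intro sum_mono) auto
        also have "\<dots> = 1 + real m * q" using Fm[OF g l] by (simp add: sum.distrib)
        finally show "0 \<le> (\<Sum>t<m. if t = g l then 1 else q) \<and> (\<Sum>t<m. if t = g l then 1 else q) \<le> 2"
          using q(1,3) by (auto intro!: sum_nonneg)
      qed
      also have "\<dots> = 2 ^ N" by (simp add: N_def)
      finally show "(\<Sum>g'\<in>F. ?w g g') \<le> q ^ (N - 1) * 2 ^ N"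
        using q(1) by (simp flip: sum_distrib_left add: mult_left_mono)
    qed
    also have "\<dots> = real m ^ N * (q ^ (N - 1) * 2 ^ N)" by (simp add: card_F)
    finally show ?thesis .
  qed
  \<comment> \<open>contains the event that \<open>A g\<close> occurs and a further point is within \<open>2 r\<close> of the base point\<close>
  define B where "B g = (\<Union>j\<in>I - h g ` \<Lambda>. star (h g l0) (insert j (tip g)) (\<lambda>_. 0) (4 * r))" for g
  have B_props: "B g \<in> events" "prob (B g) \<le> real (card I) * q ^ N" if g: "g \<in> F" for g
  proof -
    have ins: "finite (insert j (tip g))" "insert (h g l0) (insert j (tip g)) \<subseteq> J"
        "h g l0 \<notin> insert j (tip g)" "card (insert j (tip g)) = N" if "j \<in> I - h g ` \<Lambda>" for j
    proof -
      have "j \<notin> tip g" "j \<noteq> h g l0" using that tip(2)[OF g] by auto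
      then show "finite (insert j (tip g))" "insert (h g l0) (insert j (tip g)) \<subseteq> J"
        "h g l0 \<notin> insert j (tip g)" "card (insert j (tip g)) = N"
        using tip(1,3,4)[OF g] J[OF g] that I(2) N by auto
    qed
    show "B g \<in> events" unfolding B_def using I(1) ins by (intro sets.finite_UN star_measurable) auto
    have "prob (B g) \<le> (\<Sum>j\<in>I - h g ` \<Lambda>. prob (star (h g l0) (insert j (tip g)) (\<lambda>_. 0) (4 * r)))"
      unfolding B_def using I(1) ins
      by (intro finite_measure_subadditive_finite image_subsetI star_measurable) auto
    also have "\<dots> \<le> (\<Sum>j\<in>I - h g ` \<Lambda>. q ^ N)"
    proof (rule sum_mono)
      fix j assume j: "j \<in> I - h g ` \<Lambda>"
      show "prob (star (h g l0) (insert j (tip g)) (\<lambda>_. 0) (4 * r)) \<le> q ^ N"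
        using prob_star_le[OF ins(1-3)[OF j] q(1,2)] unfolding ins(4)[OF j] .
    qed
    also have "\<dots> \<le> real (card I) * q ^ N"
      using q(1) I(1) by (simp add: mult_right_mono card_mono)
    finally show "prob (B g) \<le> real (card I) * q ^ N" .
  qed
  define \<mu> where "\<mu> = real m ^ N * a"
  have \<mu>: "\<mu> > 0" using a m(1) by (simp add: \<mu>_def)
  have "prob (\<Union>g\<in>F. A g - B g) \<ge> 1 - 4 * (real m ^ N * (q ^ (N - 1) * 2 ^ N)) / \<mu>\<^sup>2
      - 2 * (real m ^ N * (real (card I) * q ^ N)) / \<mu>"
  proof (rule prob_exists_unspoiled[OF F A])
    show "R \<subseteq> F \<times> F" by (auto simp: R_def)
    have "(\<Sum>g\<in>F. a) \<le> (\<Sum>g\<in>F. prob (A g))" by (intro sum_mono PA)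
    then show "\<mu> \<le> (\<Sum>g\<in>F. prob (A g))" by (simp add: \<mu>_def card_F)
    have "(\<Sum>g\<in>F. prob (B g)) \<le> (\<Sum>g\<in>F. real (card I) * q ^ N)" by (intro sum_mono B_props)
    then show "(\<Sum>g\<in>F. prob (B g)) \<le> real m ^ N * (real (card I) * q ^ N)" by (simp add: card_F)
  qed (use indep_A \<mu> sum_R B_props in auto)
  also have "4 * (real m ^ N * (q ^ (N - 1) * 2 ^ N)) / \<mu>\<^sup>2 = 4 * 2 ^ N * q ^ (N - 1) / (real m ^ N * a\<^sup>2)"
    using m(1) a by (simp add: \<mu>_def power2_eq_square field_simps)
  also have "2 * (real m ^ N * (real (card I) * q ^ N)) / \<mu> = 2 * real (card I) * q ^ N / a"
    using m(1) a by (simp add: \<mu>_def field_simps)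
  finally have PG: "prob (\<Union>g\<in>F. A g - B g) \<ge>
    1 - 4 * 2 ^ N * q ^ (N - 1) / (real m ^ N * a\<^sup>2) - 2 * real (card I) * q ^ N / a" .
  have "\<exists>h. h ` \<Lambda> \<subseteq> I \<and> (\<forall>l\<in>\<Lambda>. x (h l) w \<in> cball (x (h l0) w + r *\<^sub>R p l) (r * e)) \<and>
      (\<forall>j\<in>I - h ` \<Lambda>. dist (x j w) (x (h l0) w) > 2 * r)" if w: "w \<in> (\<Union>g\<in>F. A g - B g)" for w
  proof -
    obtain g where g: "g \<in> F" "w \<in> A g" "w \<notin> B g" using w by blast
    have "dist (x j w) (x (h g l0) w) > 2 * r" if j: "j \<in> I - h g ` \<Lambda>" for j
    proof (rule ccontr)
      assume "\<not> dist (x j w) (x (h g l0) w) > 2 * r"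
      then have "w \<in> star (h g l0) (insert j (tip g)) (\<lambda>_. 0) (4 * r)"
        using g(2) A_near[OF g(1,2)] r by (fastforce simp: star_def A_def tip_def dist_commute)
      then show False using g(3) j by (auto simp: B_def)
    qed
    then show ?thesis using h_I[OF g(1)] A_mem[OF g(1,2)] by (intro exI[of _ "h g"]) auto
  qed
  moreover have "(\<Union>g\<in>F. A g - B g) \<in> events"
    using F A B_props(1) by (intro sets.finite_UN sets.Diff) auto
  ultimately show ?thesis using PG by blast
qed

end

section \<open>A stable realisation of the cross-polytope graph\<close>

text \<open>
  Normalising \<open>b + i c\<close> for two orthonormal vectors \<open>b\<close>, \<open>c\<close> gives unit vectors no two of which are
  parallel, so the triangle inequality is strict for them.
\<close>

lemma distinct_directions:
  assumes "DIM('a::euclidean_space) \<ge> 2"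
  shows "\<exists>u :: nat \<Rightarrow> 'a. (\<forall>i. norm (u i) = 1) \<and>
    (\<forall>i j \<sigma> \<tau>. i \<noteq> j \<longrightarrow> \<bar>\<sigma>\<bar> = 1 \<longrightarrow> \<bar>\<tau>\<bar> = 1 \<longrightarrow> norm (\<sigma> *\<^sub>R u i + \<tau> *\<^sub>R u j) < 2)"
proof -
  have "\<not> card (Basis :: 'a set) \<le> Suc 0" using assms by simp
  then obtain b c :: 'a where bc: "b \<in> Basis" "c \<in> Basis" "b \<noteq> c"
    by (auto simp: card_le_Suc0_iff_eq)
  define v where "v i = b + real i *\<^sub>R c" for i
  have vb: "v i \<bullet> b = 1" and vc: "v i \<bullet> c = real i" for i
    using bc by (simp_all add: v_def inner_add_left inner_Basis)
  then have nz: "norm (v i) > 0" for i by (metis inner_zero_left zero_less_norm_iff zero_neq_one)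
  define u where "u i = (1 / norm (v i)) *\<^sub>R v i" for i
  have u: "norm (u i) = 1" for i using nz[of i] by (simp add: u_def)
  have "norm (\<sigma> *\<^sub>R u i + \<tau> *\<^sub>R u j) < 2" if "i \<noteq> j" "\<bar>\<sigma>\<bar> = 1" "\<bar>\<tau>\<bar> = 1" for i j \<sigma> \<tau>
  proof (rule ccontr)
    assume "\<not> norm (\<sigma> *\<^sub>R u i + \<tau> *\<^sub>R u j) < 2"
    then have "norm (\<sigma> *\<^sub>R u i + \<tau> *\<^sub>R u j) = norm (\<sigma> *\<^sub>R u i) + norm (\<tau> *\<^sub>R u j)"
      using norm_triangle_ineq[of "\<sigma> *\<^sub>R u i" "\<tau> *\<^sub>R u j"] u that by simp
    then have eq: "\<tau> *\<^sub>R u j = \<sigma> *\<^sub>R u i"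
      unfolding norm_triangle_eq using u that by simp
    have "\<tau> / norm (v j) = \<sigma> / norm (v i)"
      using arg_cong[OF eq, of "\<lambda>y. y \<bullet> b"] by (simp add: u_def vb)
    moreover have "\<tau> / norm (v j) * real j = \<sigma> / norm (v i) * real i"
      using arg_cong[OF eq, of "\<lambda>y. y \<bullet> c"] by (simp add: u_def vc)
    moreover have "\<sigma> / norm (v i) \<noteq> 0" using nz[of i] that by auto
    ultimately show False using that(1) by simp
  qed
  then show ?thesis using u by blast
qed

text \<open>
  Antipodal points on a unit circle are at distance \<open>2\<close>, and finitely many other pairs are at distance
  at most some \<open>m < 2\<close>. Scaling by a factor slightly above \<open>1/2\<close> brings all the other distances
  below \<open>1\<close> and keeps those of antipodal pairs above \<open>1\<close>. The shift puts the base point at the origin.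
\<close>

lemma cross_polytope_configuration:
  assumes "DIM('a::euclidean_space) \<ge> 2"
  obtains p :: "nat \<times> bool \<Rightarrow> 'a::euclidean_space" and e :: real where "e > 0" "p (0, True) = 0"
    and "\<And>l. norm (p l) + e \<le> 2"
    and "\<And>i j s t. i \<le> k \<Longrightarrow> j \<le> k \<Longrightarrow> i \<noteq> j \<Longrightarrow> dist (p (i, s)) (p (j, t)) \<le> 1 - 2 * e"
    and "\<And>i. dist (p (i, True)) (p (i, False)) > 1 + 2 * e"
proof -
  obtain u :: "nat \<Rightarrow> 'a" where u: "\<And>i. norm (u i) = 1"
    "\<And>i j \<sigma> \<tau>. i \<noteq> j \<Longrightarrow> \<bar>\<sigma>\<bar> = 1 \<Longrightarrow> \<bar>\<tau>\<bar> = 1 \<Longrightarrow> norm (\<sigma> *\<^sub>R u i + \<tau> *\<^sub>R u j) < 2"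
    using distinct_directions[OF assms] by blast
  define \<epsilon> where "\<epsilon> s = (if s then 1 else - 1 :: real)" for s :: bool
  have \<epsilon>: "\<bar>\<epsilon> s\<bar> = 1" "\<bar>- \<epsilon> s\<bar> = 1" for s by (auto simp: \<epsilon>_def)
  define w where "w l = \<epsilon> (snd l) *\<^sub>R u (fst l)" for l
  have w_norm: "norm (w l) = 1" for l using u(1) \<epsilon> by (simp add: w_def)
  let ?L = "{..k} \<times> (UNIV :: bool set)"
  define S where "S = insert 0 ((\<lambda>(l, l'). dist (w l) (w l')) ` {(l, l') \<in> ?L \<times> ?L. fst l \<noteq> fst l'})"
  have finS: "finite S" unfolding S_def by (intro finite.insertI finite_imageI) (rule finite_subset[of _ "?L \<times> ?L"], auto)
  define m where "m = Max S"
  have m_ge: "dist (w (i, s)) (w (j, t)) \<le> m" if "i \<le> k" "j \<le> k" "i \<noteq> j" for i j s t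
    unfolding m_def using finS that by (intro Max_ge) (auto simp: S_def image_iff intro!: bexI[of _ "((i, s), (j, t))"])
  have "m \<in> S" unfolding m_def using finS by (intro Max_in) (auto simp: S_def)
  moreover have "dist (w l) (w l') < 2" if "fst l \<noteq> fst l'" for l l'
    using u(2)[OF that \<epsilon>(1) \<epsilon>(2)] by (simp add: w_def dist_norm)
  ultimately have m: "0 \<le> m" "m < 2" by (auto simp: S_def)
  \<comment> \<open>With \<open>c = (1 + 3 e) / 2\<close> below, \<open>c m \<le> 1 - 2 e\<close> holds because \<open>m = 2 - 10 e\<close>.\<close>
  define e where "e = (2 - m) / 10"
  have e: "e > 0" "e \<le> 1 / 5" "m = 2 - 10 * e" using m by (auto simp: e_def field_simps)
  define c where "c = (1 + 3 * e) / 2"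
  have c: "c > 0" "2 * c = 1 + 3 * e" using e by (auto simp: c_def)
  define p where "p l = c *\<^sub>R (w l - w (0, True))" for l
  have dist_p: "dist (p l) (p l') = c * dist (w l) (w l')" for l l'
    using c(1) by (simp add: p_def dist_norm flip: scaleR_diff_right)
  have "norm (p l) + e \<le> 2" for l
  proof -
    have "norm (p l) = c * norm (w l - w (0, True))" using c(1) by (simp add: p_def)
    also have "\<dots> \<le> c * 2" using norm_triangle_ineq4[of "w l" "w (0, True)"] c(1) w_norm
      by (intro mult_left_mono) auto
    finally show ?thesis using c(2) e by simp
  qed
  moreover have "dist (p (i, s)) (p (j, t)) \<le> 1 - 2 * e" if "i \<le> k" "j \<le> k" "i \<noteq> j" for i j s t
  proof -
    have "dist (p (i, s)) (p (j, t)) \<le> c * m"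
      unfolding dist_p using m_ge[OF that] c(1) by (intro mult_left_mono) auto
    also have "\<dots> = 1 - 2 * e - 15 * e\<^sup>2"
      unfolding c_def e(3) by (simp add: power2_eq_square field_simps)
    finally show ?thesis by (smt (verit) zero_le_power2)
  qed
  moreover have "dist (p (i, True)) (p (i, False)) > 1 + 2 * e" for i
  proof -
    have "w (i, True) - w (i, False) = 2 *\<^sub>R u i" by (simp add: w_def \<epsilon>_def scaleR_2)
    then have "dist (w (i, True)) (w (i, False)) = 2" using u(1) by (simp add: dist_norm)
    then show ?thesis unfolding dist_p using c(2) e(1) by simp
  qed
  moreover have "p (0, True) = 0" by (simp add: p_def)
  ultimately show ?thesis using e(1) that[of e p] by blast
qed

lemma rips_homology_nontrivial_near_configuration:
  fixes p z :: "nat \<times> bool \<Rightarrow> 'a::euclidean_space"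
  assumes V: "finite V" "r > 0" "k \<ge> 1" and z_V: "\<And>l. l \<in> {..k} \<times> UNIV \<Longrightarrow> z l \<in> V"
    and close: "\<And>i j s t. i \<le> k \<Longrightarrow> j \<le> k \<Longrightarrow> i \<noteq> j \<Longrightarrow> dist (p (i, s)) (p (j, t)) \<le> 1 - 2 * e"
    and far: "\<And>i. i \<le> k \<Longrightarrow> dist (p (i, True)) (p (i, False)) > 1 + 2 * e"
    and z: "\<And>l. l \<in> {..k} \<times> UNIV \<Longrightarrow> z l \<in> cball (y + r *\<^sub>R p l) (r * e)"
    and isolated: "\<And>v. v \<in> V \<Longrightarrow> dist v (z (0, True)) \<le> r \<Longrightarrow> v \<in> z ` ({..k} \<times> UNIV)"
  shows "\<not> trivial_group (homology TYPE('f::field) k (rips_complex V r))"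
proof (rule rips_homology_nontrivial[OF V(1) _ V(3)])
  have scaled: "dist (y + r *\<^sub>R p l) (y + r *\<^sub>R p l') = r * dist (p l) (p l')" for l l'
    using V(2) by (simp add: dist_norm flip: scaleR_diff_right)
  show "dist (z (i, s)) (z (j, t)) \<le> r" if ij: "i \<le> k" "j \<le> k" "i \<noteq> j" for i j s t
  proof -
    have "dist (z (i, s)) (z (j, t)) \<le> dist (y + r *\<^sub>R p (i, s)) (z (i, s))
        + dist (y + r *\<^sub>R p (i, s)) (y + r *\<^sub>R p (j, t)) + dist (y + r *\<^sub>R p (j, t)) (z (j, t))"
      using dist_triangle3[of "z (i, s)" "z (j, t)" "y + r *\<^sub>R p (i, s)"]
        dist_triangle[of "y + r *\<^sub>R p (i, s)" "z (j, t)" "y + r *\<^sub>R p (j, t)"] by linarith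
    also have "\<dots> \<le> r * e + r * (1 - 2 * e) + r * e"
      unfolding scaled using z[of "(i, s)"] z[of "(j, t)"] ij close[OF ij] V(2)
      by (intro add_mono mult_left_mono) auto
    also have "\<dots> = r" by (simp add: algebra_simps)
    finally show ?thesis .
  qed
  show "dist (z (i, True)) (z (i, False)) > r" if i: "i \<le> k" for i
  proof -
    have "r * (1 + 2 * e) < r * dist (p (i, True)) (p (i, False))"
      using far[OF i] V(2) by (rule mult_strict_left_mono)
    also have "\<dots> = dist (y + r *\<^sub>R p (i, True)) (y + r *\<^sub>R p (i, False))" by (rule scaled[symmetric])
    also have "\<dots> \<le> dist (y + r *\<^sub>R p (i, True)) (z (i, True)) + dist (z (i, True)) (z (i, False))
        + dist (y + r *\<^sub>R p (i, False)) (z (i, False))"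
      using dist_triangle[of "y + r *\<^sub>R p (i, True)" "y + r *\<^sub>R p (i, False)" "z (i, True)"]
        dist_triangle2[of "z (i, True)" "y + r *\<^sub>R p (i, False)" "z (i, False)"] by linarith
    also have "\<dots> \<le> r * e + dist (z (i, True)) (z (i, False)) + r * e"
      using z[of "(i, True)"] z[of "(i, False)"] i by (intro add_mono) auto
    finally show ?thesis by (simp add: algebra_simps)
  qed
qed (use V z_V isolated in auto)

section \<open>Asymptotics and the threshold\<close>

lemma powr_ratio_power:
  fixes r :: real
  assumes "m > 0" "n > 0"
  shows "(r / real n powr (- (real c / real m))) ^ m = real n ^ c * r ^ m"
proof -
  have "(real n powr (- (real c / real m))) ^ m = real n powr (- (real c / real m) * real m)"
    using assms by (simp add: powr_powr flip: powr_realpow)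
  also have "\<dots> = inverse (real n ^ c)"
    using assms by (simp add: powr_minus powr_realpow)
  finally show ?thesis by (simp add: power_divide field_simps)
qed

lemma smallo_powr_tendsto_0:
  assumes m: "m > 0" and r: "r \<in> o(\<lambda>n. real n powr (- (real c / real m)))"
  shows "(\<lambda>n. real n ^ c * r n ^ m) \<longlonglongrightarrow> 0"
proof -
  have "(\<lambda>n. (r n / real n powr (- (real c / real m))) ^ m) \<longlonglongrightarrow> 0 ^ m"
    by (intro tendsto_power smalloD_tendsto[OF r])
  moreover have "\<forall>\<^sub>F n in sequentially. (r n / real n powr (- (real c / real m))) ^ m = real n ^ c * r n ^ m"
    using eventually_gt_at_top[of 0] by eventually_elim (rule powr_ratio_power[OF m])
  ultimately show ?thesis using m by (simp add: tendsto_cong power_0_left)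
qed

lemma smallomega_powr_at_top:
  assumes m: "m > 0" and r: "r \<in> \<omega>(\<lambda>n. real n powr (- (real c / real m)))" and pos: "\<And>n. r n > 0"
  shows "filterlim (\<lambda>n. real n ^ c * r n ^ m) at_top sequentially"
proof -
  let ?g = "\<lambda>n. real n powr (- (real c / real m))"
  have "?g \<in> o(r)" using r by (simp add: smallomega_iff_smallo)
  then have "(\<lambda>n. ?g n / r n) \<longlonglongrightarrow> 0" by (rule smalloD_tendsto)
  moreover have "\<forall>\<^sub>F n in sequentially. 0 < ?g n / r n"
    using eventually_gt_at_top[of 0] by eventually_elim (use pos in simp)
  ultimately have "filterlim (\<lambda>n. inverse (?g n / r n)) at_top sequentially"
    by (rule filterlim_inverse_at_top)
  then have "filterlim (\<lambda>n. (r n / ?g n) ^ m) at_top sequentially"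
    by (intro filterlim_pow_at_top[OF m]) simp
  moreover have "\<forall>\<^sub>F n in sequentially. (r n / ?g n) ^ m = real n ^ c * r n ^ m"
    using eventually_gt_at_top[of 0] by eventually_elim (rule powr_ratio_power[OF m])
  ultimately show ?thesis by (simp add: filterlim_cong)
qed

lemma (in prob_space) asymptotically_almost_surelyI:
  assumes ev: "\<And>n. {w \<in> space M. P n w} \<in> events"
    and bound: "\<forall>\<^sub>F n in sequentially. prob {w \<in> space M. P n w} \<ge> 1 - err n"
    and err: "err \<longlonglongrightarrow> 0"
  shows "asymptotically_almost_surely M P"
  unfolding asymptotically_almost_surely_def
proof (rule tendsto_sandwich[OF bound])
  show "(\<lambda>n. 1 - err n) \<longlonglongrightarrow> 1" using tendsto_diff[OF tendsto_const err, of 1] by simp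
qed auto


lemma iid_sample_of_density:
  fixes x :: "nat \<Rightarrow> 'w \<Rightarrow> 'a::euclidean_space"
  assumes M: "prob_space M" and indep: "prob_space.indep_vars M (\<lambda>_. borel) x {1..}"
    and density: "\<And>i. i \<ge> 1 \<Longrightarrow> has_density M (x i) f"
  shows "iid_sample M x {1..} (distr M borel (x 1))"
    and "\<And>A. A \<in> sets borel \<Longrightarrow>
      emeasure (distr M borel (x 1)) A = (\<integral>\<^sup>+y\<in>A. ennreal (f y) \<partial>lebesgue)"
proof -
  have em: "emeasure (distr M borel (x i)) A = (\<integral>\<^sup>+y\<in>A. ennreal (f y) \<partial>lebesgue)"
    if "i \<ge> 1" "A \<in> sets borel" for i A
    using density[OF that(1)] that(2) unfolding has_density_def by (subst emeasure_distr) auto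
  then show "emeasure (distr M borel (x 1)) A = (\<integral>\<^sup>+y\<in>A. ennreal (f y) \<partial>lebesgue)"
    if "A \<in> sets borel" for A using that by blast
  interpret prob_space M by (rule M)
  show "iid_sample M x {1..} (distr M borel (x 1))"
  proof
    show "indep_vars (\<lambda>_. borel) x {1..}" by (rule indep)
    show "distr M borel (x i) = distr M borel (x 1)" if "i \<in> {1..}" for i
      using that by (intro measure_eqI) (auto simp: em)
  qed
qed

lemma div_ge_half:
  assumes "N > 0" "n \<ge> N"
  shows "real n / (2 * real N) \<le> real (n div N)"
proof -
  have "n < N * Suc (n div N)" using assms(1) by (simp add: dividend_less_times_div)
  also have "\<dots> \<le> N * (2 * (n div N))"
    using assms by (intro mult_left_mono) (auto simp: Suc_le_eq div_greater_zero_iff)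
  finally have "real n < real (N * (2 * (n div N)))" by (simp only: of_nat_less_iff)
  then show ?thesis using assms(1) by (simp add: field_simps)
qed

theorem theorem3p9:
  fixes M :: "'w measure"
    and x :: "nat \<Rightarrow> 'w \<Rightarrow> real ^ 'd"
    and f :: "real ^ 'd \<Rightarrow> real"
    and r :: "nat \<Rightarrow> real"
    and k :: nat
  assumes d: "CARD('d) \<ge> 2"
    and k: "k \<ge> 1"
    and M: "prob_space M"
    and f_measurable: "f \<in> borel_measurable lebesgue"
    and f_nonneg: "\<And>y. 0 \<le> f y"
    and f_integral: "(\<integral>\<^sup>+ y. ennreal (f y) \<partial>lebesgue) = 1"
    and f_bounded: "bounded (range f)"
    and independent: "prob_space.indep_vars M (\<lambda>_. borel) x {1..}"
    and density: "\<And>i. i \<ge> 1 \<Longrightarrow> has_density M (x i) f"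
    and r_pos: "\<And>n. r n > 0"
    and r_sparse: "r \<in> o(\<lambda>n. real n powr (- 1 / real CARD('d)))"
  shows
    "(r \<in> o(\<lambda>n. real n powr (- (2 * real k + 2) / (real CARD('d) * (2 * real k + 1)))) \<longrightarrow>
        asymptotically_almost_surely M (\<lambda>n w.
          trivial_group
            (homology TYPE('f::field) k (rips_complex ((\<lambda>i. x i w) ` {1..n}) (r n))))) \<and>
     (r \<in> \<omega>(\<lambda>n. real n powr (- (2 * real k + 2) / (real CARD('d) * (2 * real k + 1)))) \<longrightarrow>
        asymptotically_almost_surely M (\<lambda>n w.
          \<not> trivial_group
            (homology TYPE('f) k (rips_complex ((\<lambda>i. x i w) ` {1..n}) (r n)))))"
proof -
  interpret prob_space M by (rule M)
  define D where "D = distr M borel (x 1)"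
  define N where "N = 2 * k + 2"
  define d where "d = CARD('d)"
  define T where "T n = real n ^ N * (r n ^ d) ^ (N - 1)" for n
  interpret iid_sample M x "{1..}" D
    unfolding D_def by (rule iid_sample_of_density[OF M independent density])
  have D: "emeasure D A = (\<integral>\<^sup>+y\<in>A. ennreal (f y) \<partial>lebesgue)" if "A \<in> sets borel" for A
    unfolding D_def by (rule iid_sample_of_density(2)[OF M independent density that])
  have N: "N > 0" "N - 1 = 2 * k + 1" and d2: "d \<ge> 2" "d > 0" using d by (auto simp: N_def d_def)
  have DIM: "DIM(real ^ 'd) = d" by (simp add: d_def)
  obtain B where B: "B \<ge> 0" "\<And>y. f y \<le> B"
    using f_bounded unfolding bounded_iff by (metis abs_ge_self norm_ge_zero order_trans rangeI real_norm_def)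
  define C where "C = B * unit_ball_vol (real d)"
  have C: "C \<ge> 0" using B(1) by (simp add: C_def)
  have ball: "emeasure D (cball y \<rho>) \<le> ennreal (C * \<rho> ^ d)" if "\<rho> \<ge> 0" for y \<rho>
    using bounded_density_ball_upper_bound[OF D B(2,1) that, of y] unfolding DIM C_def .
  let ?V = "\<lambda>n w. (\<lambda>i. x i w) ` {1..n}"
  let ?triv = "\<lambda>n w. trivial_group (homology TYPE('f) k (rips_complex (?V n w) (r n)))"
  have triv_event: "{w \<in> space M. ?triv n w} \<in> events" for n
    by (rule measurable_trivial_rips_homology) (use k in auto)
  have exponent: "- (2 * real k + 2) / (real CARD('d) * (2 * real k + 1)) = - (real N / real (d * (N - 1)))"
  proof -
    have "real N = 2 * real k + 2" "real (d * (N - 1)) = real CARD('d) * (2 * real k + 1)"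
      unfolding N(2) by (simp_all add: N_def d_def algebra_simps)
    then show ?thesis by (simp only: minus_divide_left)
  qed
  have T_eq: "T n = real n ^ N * r n ^ (d * (N - 1))" for n by (simp add: T_def power_mult)
  have dN: "d * (N - 1) > 0" using d2 N by simp
  have sparse: "(\<lambda>n. real n * r n ^ d) \<longlonglongrightarrow> 0"
    using smallo_powr_tendsto_0[OF d2(2), of r 1] r_sparse by (simp add: d_def)
  show ?thesis
  proof (intro conjI impI)
    assume "r \<in> o(\<lambda>n. real n powr (- (2 * real k + 2) / (real CARD('d) * (2 * real k + 1))))"
    then have T0: "T \<longlonglongrightarrow> 0"
      unfolding exponent using smallo_powr_tendsto_0[OF dN, of r N] by (simp add: T_eq [abs_def])
    \<comment> \<open>Crowded balls have radius \<open>N r\<close>, so \<open>C * (N * r) ^ d\<close> bounds their mass.\<close>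
    define K where "K = (C * real N ^ d) ^ (N - 1)"
    show "asymptotically_almost_surely M ?triv"
    proof (rule asymptotically_almost_surelyI[OF triv_event])
      show "(\<lambda>n. K * T n) \<longlonglongrightarrow> 0" using tendsto_mult[OF tendsto_const T0, of K] by simp
      have "prob {w \<in> space M. ?triv n w} \<ge> 1 - K * T n" for n
      proof -
        let ?q = "C * (real N * r n) ^ d"
        have "?q \<ge> 0" using C r_pos[of n] by (simp add: less_imp_le)
        then obtain E where E: "E \<in> events" "prob E \<le> real (card {1..n}) ^ N * ?q ^ (N - 1)"
          and good: "\<And>w v. w \<in> space M - E \<Longrightarrow> v \<in> ?V n w \<Longrightarrow>
            card (?V n w \<inter> cball v (real N * r n)) < N"
          using prob_crowded_le[of "{1..n}" N ?q "real N * r n"] ball[of "real N * r n"] N(1) r_pos[of n]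
          by (auto simp: less_imp_le)
        have "?triv n w" if "w \<in> space M - E" for w
          using good[OF that] r_pos[of n] k unfolding N_def
          by (intro rips_homology_trivial) (auto simp: less_imp_le)
        then have "prob (space M - E) \<le> prob {w \<in> space M. ?triv n w}"
          by (intro finite_measure_mono triv_event) auto
        moreover have "real (card {1..n}) ^ N * ?q ^ (N - 1) = K * T n"
          by (simp add: K_def T_def power_mult_distrib)
        ultimately show ?thesis using E prob_compl[OF E(1)] by simp
      qed
      then show "\<forall>\<^sub>F n in sequentially. prob {w \<in> space M. ?triv n w} \<ge> 1 - K * T n" by simp
    qed
  next
    assume "r \<in> \<omega>(\<lambda>n. real n powr (- (2 * real k + 2) / (real CARD('d) * (2 * real k + 1))))"
    then have T_top: "filterlim T at_top sequentially"
      unfolding exponent using smallomega_powr_at_top[OF dN, of r N] r_pos by (simp add: T_eq [abs_def])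
    have "DIM(real ^ 'd) \<ge> 2" unfolding DIM by (rule d2(1))
    then obtain p :: "nat \<times> bool \<Rightarrow> real ^ 'd" and e where e: "e > 0" and p: "p (0, True) = 0"
        "\<And>l. norm (p l) + e \<le> 2"
        "\<And>i j s t. i \<le> k \<Longrightarrow> j \<le> k \<Longrightarrow> i \<noteq> j \<Longrightarrow> dist (p (i, s)) (p (j, t)) \<le> 1 - 2 * e"
        "\<And>i. dist (p (i, True)) (p (i, False)) > 1 + 2 * e"
      by (rule cross_polytope_configuration[where k = k]) (rule that; assumption)
    define \<Lambda> where "\<Lambda> = {..k} \<times> (UNIV :: bool set)"
    have \<Lambda>: "finite \<Lambda>" "(0, True) \<in> \<Lambda>" "card \<Lambda> = N"
      by (auto simp: \<Lambda>_def N_def card_cartesian_product)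
    have f_nz: "(\<integral>\<^sup>+y. ennreal (f y) \<partial>lebesgue) \<noteq> 0" by (simp add: f_integral)
    obtain \<alpha> \<beta> r0 where \<alpha>\<beta>: "\<alpha> > 0" "\<beta> > 0" and r0: "r0 > 0"
      and Y: "\<And>\<rho>. 0 < \<rho> \<Longrightarrow> \<rho> \<le> r0 \<Longrightarrow> \<exists>Y\<in>sets borel. emeasure D Y \<ge> ennreal \<alpha> \<and>
        (\<forall>y\<in>Y. \<forall>z\<in>p ` \<Lambda>. emeasure D (cball (y + \<rho> *\<^sub>R z) (\<rho> * e)) \<ge> ennreal (\<beta> * \<rho> ^ d))"
      by (rule density_local_lower_bound[OF f_measurable f_nz D finite_imageI[OF \<Lambda>(1), of p] e,
            unfolded DIM]) (assumption | rule that; assumption)+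
    define a where "a = \<alpha> * \<beta> ^ (N - 1)"
    have a: "a > 0" using \<alpha>\<beta> by (simp add: a_def)
    \<comment> \<open>\<open>C' * r ^ d\<close> bounds the mass of a ball of radius \<open>4 r\<close>\<close>
    define C' where "C' = C * 4 ^ d"
    have C': "C' \<ge> 0" using C by (simp add: C'_def)
    define K1 where "K1 = 4 * 2 ^ N * C' ^ (N - 1) * (2 * real N) ^ N / a\<^sup>2"
    define K2 where "K2 = 2 * C' ^ N / a"
    define err where "err n = K1 * inverse (T n) + K2 * (real n * r n ^ d)" for n
    show "asymptotically_almost_surely M (\<lambda>n w. \<not> ?triv n w)"
    proof (rule asymptotically_almost_surelyI)
      show "{w \<in> space M. \<not> ?triv n w} \<in> events" for n
        using triv_event by (rule sets.sets_Collect_neg)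
      show "err \<longlonglongrightarrow> 0"
        using tendsto_add[OF tendsto_mult[OF tendsto_const tendsto_inverse_0_at_top[OF T_top], of K1]
            tendsto_mult[OF tendsto_const sparse, of K2]] by (simp add: err_def [abs_def])
      have "r \<in> o(\<lambda>_. 1)"
      proof (rule landau_o.small_big_trans[OF r_sparse])
        show "(\<lambda>n. real n powr (- 1 / real CARD('d))) \<in> O(\<lambda>_. 1)"
        proof (intro bigoI[of _ 1] eventually_mono[OF eventually_ge_at_top[of 1]])
          fix n :: nat assume "1 \<le> n"
          then have "real n powr (- 1 / real CARD('d)) \<le> real n powr 0" by (intro powr_mono) auto
          then show "norm (real n powr (- 1 / real CARD('d))) \<le> 1 * norm (1 :: real)"
            using \<open>1 \<le> n\<close> by simp
        qed
      qed
      then have "r \<longlonglongrightarrow> 0" using smalloD_tendsto by fastforce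
      then have "\<forall>\<^sub>F n in sequentially. r n < r0" using r0 by (rule order_tendstoD)
      moreover have "(\<lambda>n. C' * (real n * r n ^ d)) \<longlonglongrightarrow> 0"
        using tendsto_mult[OF tendsto_const sparse, of C'] by simp
      then have "\<forall>\<^sub>F n in sequentially. C' * (real n * r n ^ d) < 1" by (rule order_tendstoD) simp
      ultimately show "\<forall>\<^sub>F n in sequentially. prob {w \<in> space M. \<not> ?triv n w} \<ge> 1 - err n"
        using eventually_ge_at_top[of N]
      proof eventually_elim
        fix n assume r_small: "r n < r0" and q1: "C' * (real n * r n ^ d) < 1" and n: "N \<le> n"
        define s where "s = r n ^ d"
        have s: "s > 0" using r_pos by (simp add: s_def)
        define m where "m = n div N"
        have m: "m > 0" "m * N \<le> n" "real n / (2 * real N) \<le> real m"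
          using n N(1) div_ge_half[OF N(1) n] by (auto simp: m_def div_greater_zero_iff)
        have n0: "real n > 0" using n N(1) by simp
        have "m \<le> n" by (simp add: m_def)
        obtain Y where Y: "Y \<in> sets borel" "emeasure D Y \<ge> ennreal \<alpha>"
          "\<And>y l. y \<in> Y \<Longrightarrow> l \<in> \<Lambda> \<Longrightarrow> emeasure D (cball (y + r n *\<^sub>R p l) (r n * e)) \<ge> ennreal (\<beta> * s)"
          using Y[OF r_pos less_imp_le[OF r_small]] unfolding s_def by blast
        let ?q = "C' * s" and ?a = "\<alpha> * (\<beta> * s) ^ (N - 1)"
        have a_eq: "?a = a * s ^ (N - 1)" by (simp add: a_def power_mult_distrib)
        have mq: "real m * ?q \<le> 1"
        proof -
          have "real m * ?q \<le> real n * ?q" using \<open>m \<le> n\<close> C' s by (intro mult_right_mono) auto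
          then show ?thesis using q1 by (simp add: s_def mult_ac)
        qed
        have q: "emeasure D (cball y (4 * r n)) \<le> ennreal ?q" for y
          using ball[of "4 * r n" y] r_pos[of n] by (simp add: C'_def s_def power_mult_distrib mult.assoc)
        have "\<exists>G\<in>events. prob G \<ge> 1 - 4 * 2 ^ card \<Lambda> * ?q ^ (card \<Lambda> - 1) /
              (real m ^ card \<Lambda> * (\<alpha> * (\<beta> * s) ^ (card \<Lambda> - 1))\<^sup>2)
            - 2 * real (card {1..n}) * ?q ^ card \<Lambda> / (\<alpha> * (\<beta> * s) ^ (card \<Lambda> - 1)) \<and>
          (\<forall>w\<in>G. \<exists>h. h ` \<Lambda> \<subseteq> {1..n} \<and>
            (\<forall>l\<in>\<Lambda>. x (h l) w \<in> cball (x (h (0, True)) w + r n *\<^sub>R p l) (r n * e)) \<and>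
            (\<forall>j\<in>{1..n} - h ` \<Lambda>. dist (x j w) (x (h (0, True)) w) > 2 * r n))"
        proof (rule prob_isolated_configuration_ge)
          show "real m * ?q \<le> 1" by (rule mq)
          show "emeasure D (cball y (4 * r n)) \<le> ennreal ?q" for y by (rule q)
          show "emeasure D (cball (y + r n *\<^sub>R p l) (r n * e)) \<ge> ennreal (\<beta> * s)"
            if "y \<in> Y" "l \<in> \<Lambda>" for y l by (rule Y(3)[OF that])
          show "emeasure D Y \<ge> ennreal \<alpha>" by (rule Y(2))
          show "norm (p l) + e \<le> 2" for l by (rule p(2))
        qed (use \<Lambda> m(1,2) p(1) e r_pos C' s \<alpha>\<beta> Y(1) in auto)
        then obtain G where G: "G \<in> events"
            "prob G \<ge> 1 - 4 * 2 ^ N * ?q ^ (N - 1) / (real m ^ N * ?a\<^sup>2) - 2 * real n * ?q ^ N / ?a"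
          and good: "\<And>w. w \<in> G \<Longrightarrow> \<exists>h. h ` \<Lambda> \<subseteq> {1..n} \<and>
            (\<forall>l\<in>\<Lambda>. x (h l) w \<in> cball (x (h (0, True)) w + r n *\<^sub>R p l) (r n * e)) \<and>
            (\<forall>j\<in>{1..n} - h ` \<Lambda>. dist (x j w) (x (h (0, True)) w) > 2 * r n)"
          unfolding \<Lambda>(3) by auto
        have "\<not> ?triv n w" if w: "w \<in> G" for w
        proof -
          obtain h where h: "h ` \<Lambda> \<subseteq> {1..n}"
            "\<And>l. l \<in> \<Lambda> \<Longrightarrow> x (h l) w \<in> cball (x (h (0, True)) w + r n *\<^sub>R p l) (r n * e)"
            "\<And>j. j \<in> {1..n} - h ` \<Lambda> \<Longrightarrow> dist (x j w) (x (h (0, True)) w) > 2 * r n"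
            using good[OF w] by blast
          show ?thesis
          proof (rule rips_homology_nontrivial_near_configuration[OF _ r_pos k _ p(3,4) h(2)])
            fix v assume v: "v \<in> ?V n w" "dist v (x (h (0, True)) w) \<le> r n"
            then obtain j where j: "j \<in> {1..n}" "v = x j w" by blast
            have "j \<in> h ` \<Lambda>" using h(3)[of j] j v(2) r_pos[of n] by force
            then show "v \<in> (\<lambda>l. x (h l) w) ` ({..k} \<times> UNIV)" using j(2) by (auto simp: \<Lambda>_def)
          qed (use h(1) in \<open>auto simp: \<Lambda>_def\<close>)
        qed
        then have "prob G \<le> prob {w \<in> space M. \<not> ?triv n w}"
          using sets.sets_into_space[OF G(1)] triv_event
          by (intro finite_measure_mono sets.sets_Collect_neg) auto
        moreover have "4 * 2 ^ N * ?q ^ (N - 1) / (real m ^ N * ?a\<^sup>2) \<le> K1 * inverse (T n)"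
        proof -
          have "4 * 2 ^ N * ?q ^ (N - 1) / (real m ^ N * ?a\<^sup>2)
              = 4 * 2 ^ N * C' ^ (N - 1) / a\<^sup>2 / (real m ^ N * s ^ (N - 1))"
            unfolding a_eq using s by (simp add: power_mult_distrib power2_eq_square mult_ac)
          also have "\<dots> \<le> 4 * 2 ^ N * C' ^ (N - 1) / a\<^sup>2 / ((real n / (2 * real N)) ^ N * s ^ (N - 1))"
            using C' s n0 N(1) m(1,3) by (intro divide_left_mono mult_right_mono power_mono mult_pos_pos) auto
          also have "\<dots> = K1 * inverse (T n)"
            unfolding K1_def T_def s_def using N(1) n0 s by (simp add: power_divide field_simps)
          finally show ?thesis .
        qed
        moreover have "2 * real n * ?q ^ N / ?a = K2 * (real n * r n ^ d)"
        proof -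
          have "s ^ N = s * s ^ (N - 1)" using N(1) by (simp add: power_eq_if)
          then show ?thesis unfolding a_eq K2_def s_def[symmetric] using s a
            by (simp add: power_mult_distrib)
        qed
        ultimately show "prob {w \<in> space M. \<not> ?triv n w} \<ge> 1 - err n"
          using G(2) unfolding err_def by linarith
      qed
    qed
  qed
qed

end
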